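(* Let $L=\{L_1,\dots,L_n\}$ form a T-graph in $\mathbb{R}^2$ with root vertex set $R$. For a marked matching $M'$ of $\mathcal{G}_D=\mathcal{G}_D(L)$ (perfect matching $M$ with chosen subsegments $S'_e$, $e\in M$), let $\mathcal{F}_{M'}$ be the set of edges of $\mathcal{G}_T$ that are not among the $S'_e$, each oriented toward the root vertex of its component. Then $\mathcal{F}_{M'}$ is a directed spanning forest of $\mathcal{G}_T$ rooted at $R$ (all its edges being directed edges of $\mathcal{G}_T$), and the map $M'\mapsto \mathcal{F}_{M'}$ is a bijection between marked matchings of $\mathcal{G}_D$ and directed spanning forests of $\mathcal{G}_T$ rooted at $R$. This bijection is measure preserving: $\mu(M')=\mu_F(\mathcal{F}_{M'})$.
   Context: A disjoint collection $L=\{L_1,\dots,L_n\}$ of open line segments ("complete edges") in $\mathbb{R}^2$ forms a T-graph in $\mathbb{R}^2$ if $\bigcup_i L_i$ is connected and contains all of its limit points except for a finite set $R$ of root vertices, each on the boundary of the unbounded component of $\mathbb{R}^2\setminus\overline{\bigcup_i L_i}$. The directed weighted graph $\mathcal{G}_T=\mathcal{G}_T(L)$ has as vertices the points that are endpoints of some $L_i$. Each non-root vertex $v$ lies in the interior of a unique $L_i$ and has exactly two outgoing edges, to its two immediate neighbours $v_1,v_2$ along $L_i$ (one on each side), with weights summing to $1$ and inversely proportional to $|v-v_1|$ and $|v-v_2|$ respectively; root vertices have no outgoing edges. (Undirected) edges of $\mathcal{G}_T$ are the segments between consecutive vertices along some $L_i$. Let $C$ be a simple closed curve encircling $\bigcup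 L_i$ and passing through the root vertices in clockwise order; faces of $\mathcal{G}_T$ are the bounded components of $\mathbb{R}^2\setminus(\bigcup L_i\cup C)$, outer faces those adjacent to $C$. The bipartite graph $\mathcal{G}_D^r(L)$ has black vertices the $L_i$ and white vertices the faces; face $F$ is adjacent to $L_i$ if a portion of $L_i$ lies on the boundary of $F$, with edge weight the Euclidean length of that portion. $\mathcal{G}_D(L)$ is obtained by deleting one outer white vertex (the dual root). For $e=(F,L_i)$, $S_e$ is the portion of $L_i$ bordering $F$, subdivided by vertices of $\mathcal{G}_T$ into subsegments (edges of $\mathcal{G}_T$). A marked matching is a perfect matching $M$ of $\mathcal{G}_D$ together with one chosen subsegment $S'_e$ of $S_e$ for each $e\in M$; $\mu(M')$ is the probability measure proportional to $\prod_{e\in M}|S'_e|$ (Euclidean lengths), i.e. a $\nu$-weighted random perfect matching with each $S'_e$ then chosen independently with probability proportional to length. A directed spanning forest of $\mathcal{G}_T$ rooted at $R$ is a set of directed edges of $\mathcal{G}_T$ containing no cycle, in which every non-root vertex has exactly one outgoing edge, and each component contains a unique root vertex; $\mu_F$ is the probability measure on such forests proportional to the product of their edge weights. *)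

theory Defs
  imports "HOL-Probability.Probability"
begin

text \<open>
  The Euclidean plane is the type \<^typ>\<open>complex\<close>, as in the library's treatment of Jordan
  curves. A complete edge is an open segment, regarded as a set of points.
\<close>

section \<open>T-graphs\<close>

text \<open>
  Since \<^term>\<open>closure (\<Union>L)\<close> is bounded, \<^term>\<open>outside (closure (\<Union>L))\<close> is the unbounded
  component of its complement.
\<close>

definition t_graph :: "complex set set \<Rightarrow> complex set \<Rightarrow> bool" where
  "t_graph L R \<longleftrightarrow>
     finite L \<and> L \<noteq> {} \<and>
     (\<forall>s\<in>L. \<exists>a b. a \<noteq> b \<and> s = open_segment a b) \<and>
     disjoint L \<and>
     connected (\<Union>L) \<and>
     R = {x. x islimpt \<Union>L \<and> x \<notin> \<Union>L} \<and> finite R \<and>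
     (\<forall>r\<in>R. r \<in> frontier (outside (closure (\<Union>L))))"

section \<open>The directed weighted graph of a T-graph\<close>

definition vertices :: "complex set set \<Rightarrow> complex set" where
  "vertices L = {a. \<exists>b. a \<noteq> b \<and> open_segment a b \<in> L}"

definition consecutive :: "complex set set \<Rightarrow> complex set \<Rightarrow> complex \<Rightarrow> complex \<Rightarrow> bool" where
  "consecutive L s u v \<longleftrightarrow>
     u \<in> vertices L \<and> v \<in> vertices L \<and> u \<noteq> v \<and>
     open_segment u v \<subseteq> s \<and> open_segment u v \<inter> vertices L = {}"

definition edges :: "complex set set \<Rightarrow> complex set set" where
  "edges L = {open_segment u v | u v. \<exists>s\<in>L. consecutive L s u v}"

text \<open>
  A non-root vertex \<open>v\<close> lies on exactly one \<open>s \<in> L\<close>, and its arcs go to its neighbours along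
  this \<open>s\<close> only. Root vertices lie on no \<open>s \<in> L\<close>, so they have no outgoing arcs.
\<close>

definition arcs :: "complex set set \<Rightarrow> (complex \<times> complex) set" where
  "arcs L = {(v, w). \<exists>s\<in>L. v \<in> s \<and> consecutive L s v w}"

definition arc_weight :: "complex set set \<Rightarrow> complex \<times> complex \<Rightarrow> real" where
  "arc_weight L = (\<lambda>(v, w). (1 / dist v w) / (\<Sum>w' | (v, w') \<in> arcs L. 1 / dist v w'))"

text \<open>
  Acyclicity of the relation also excludes a pair of opposite arcs. The components are the
  connected components of the underlying undirected graph on all vertices.
\<close>

definition spanning_forests ::
    "complex set set \<Rightarrow> complex set \<Rightarrow> (complex \<times> complex) set set" where
  "spanning_forests L R =
     {F. F \<subseteq> arcs L \<and> acyclic F \<and>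
         (\<forall>v \<in> vertices L - R. \<exists>!w. (v, w) \<in> F) \<and>
         (\<forall>v \<in> vertices L. \<exists>!r. r \<in> R \<and> (v, r) \<in> (F \<union> F\<inverse>)\<^sup>*)}"

section \<open>Faces and the bipartite graph\<close>

text \<open>
  No orientation or ordering condition on \<open>c\<close> is needed: \<open>\<Union>L\<close> is connected and enclosed by the
  curve, so up to reversal the curve meets the roots in their cyclic order on the outer boundary,
  and only its image is used.
\<close>

definition encircling_curve ::
    "complex set set \<Rightarrow> complex set \<Rightarrow> (real \<Rightarrow> complex) \<Rightarrow> bool" where
  "encircling_curve L R c \<longleftrightarrow>
     simple_path c \<and> pathfinish c = pathstart c \<and>
     \<Union>L \<subseteq> inside (path_image c) \<and> R \<subseteq> path_image c"

definition faces :: "complex set set \<Rightarrow> (real \<Rightarrow> complex) \<Rightarrow> complex set set" where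
  "faces L c = {F \<in> components (- (\<Union>L \<union> path_image c)). bounded F}"

text \<open>
  Adjacency to the curve means sharing a nondegenerate arc of it; a face whose boundary meets the
  curve in a root vertex only is not outer.
\<close>

definition outer_faces :: "complex set set \<Rightarrow> (real \<Rightarrow> complex) \<Rightarrow> complex set set" where
  "outer_faces L c =
     {F \<in> faces L c. \<exists>u v. 0 \<le> u \<and> u < v \<and> v \<le> 1 \<and> c ` {u..v} \<subseteq> frontier F}"

definition portion :: "complex set \<times> complex set \<Rightarrow> complex set" where
  "portion = (\<lambda>(F, s). s \<inter> frontier F)"

text \<open>
  The graph obtained by deleting the outer face \<open>F0\<close>; an edge is given as the pair of its white
  vertex (a face) and its black vertex (an element of \<open>L\<close>). Touching at a single point does not
  make the two adjacent.
\<close>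

definition dual_edges ::
    "complex set set \<Rightarrow> (real \<Rightarrow> complex) \<Rightarrow> complex set \<Rightarrow> (complex set \<times> complex set) set" where
  "dual_edges L c F0 =
     {(F, s). F \<in> faces L c - {F0} \<and> s \<in> L \<and>
              (\<exists>a b. a \<noteq> b \<and> open_segment a b \<subseteq> portion (F, s))}"

definition perfect_matchings ::
    "complex set set \<Rightarrow> (real \<Rightarrow> complex) \<Rightarrow> complex set \<Rightarrow> (complex set \<times> complex set) set set" where
  "perfect_matchings L c F0 =
     {M. M \<subseteq> dual_edges L c F0 \<and>
         (\<forall>F \<in> faces L c - {F0}. \<exists>!s. (F, s) \<in> M) \<and>
         (\<forall>s\<in>L. \<exists>!F. (F, s) \<in> M)}"

definition subsegments ::
    "complex set set \<Rightarrow> complex set \<times> complex set \<Rightarrow> complex set set" where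
  "subsegments L e = {t \<in> edges L. t \<subseteq> portion e}"

text \<open>A marked matching is a perfect matching together with its choice of subsegments.\<close>

type_synonym marked_matching =
  "(complex set \<times> complex set) set \<times> (complex set \<times> complex set \<Rightarrow> complex set)"

definition marked_matchings ::
    "complex set set \<Rightarrow> (real \<Rightarrow> complex) \<Rightarrow> complex set \<Rightarrow> marked_matching set" where
  "marked_matchings L c F0 =
     (SIGMA M : perfect_matchings L c F0. PiE M (subsegments L))"

section \<open>The map from marked matchings to forests\<close>

definition unmarked_edges :: "complex set set \<Rightarrow> marked_matching \<Rightarrow> complex set set" where
  "unmarked_edges L = (\<lambda>(M, S). edges L - S ` M)"

text \<open>
  An edge is oriented from \<open>u\<close> to \<open>v\<close> if it is the first step of a simple path from \<open>u\<close> to a root.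
\<close>

definition orient_to_roots ::
    "complex set \<Rightarrow> complex set set \<Rightarrow> (complex \<times> complex) set" where
  "orient_to_roots R E =
     {(u, v). \<exists>p. distinct (u # v # p) \<and>
                  successively (\<lambda>x y. open_segment x y \<in> E) (u # v # p) \<and>
                  last (v # p) \<in> R}"

definition forest_of ::
    "complex set set \<Rightarrow> complex set \<Rightarrow> marked_matching \<Rightarrow> (complex \<times> complex) set" where
  "forest_of L R m = orient_to_roots R (unmarked_edges L m)"

section \<open>The two measures\<close>

definition normalized_measure :: "'a set \<Rightarrow> ('a \<Rightarrow> real) \<Rightarrow> 'a measure" where
  "normalized_measure A w = point_measure A (\<lambda>x. ennreal (w x / (\<Sum>y\<in>A. w y)))"

text \<open>The length of a segment is its diameter.\<close>

definition matching_measure ::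
    "complex set set \<Rightarrow> (real \<Rightarrow> complex) \<Rightarrow> complex set \<Rightarrow> marked_matching measure" where
  "matching_measure L c F0 =
     normalized_measure (marked_matchings L c F0) (\<lambda>(M, S). \<Prod>e\<in>M. diameter (S e))"

definition forest_measure ::
    "complex set set \<Rightarrow> complex set \<Rightarrow> (complex \<times> complex) set measure" where
  "forest_measure L R =
     normalized_measure (spanning_forests L R) (\<lambda>F. \<Prod>e\<in>F. arc_weight L e)"

end

theory Submission
  imports Defs
begin

text \<open>
  Every non-root vertex has two arcs, along its segment, so a choice of one arc per vertex without
  opposite arcs leaves exactly one edge of each segment unused; the choice is forced by the unused
  edges to point away from them. It remains to see that such a choice is acyclic iff the unused
  edges can be matched to the faces other than the dual root.

  If it is acyclic, its edges together with the curve do not separate the inside of the curve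
  (Janiszewski), while each unused edge does cut the component containing it (the dual form of
  Janiszewski's theorem). So the unused edges are the edges of a tree on the faces, and orienting it
  towards the dual root is the only way to match.

  If it has a cycle, compare, inside that cycle, with the forest in which every vertex points
  upwards for a height function: there the same count gives one more face than there are edges
  outside the upward forest, and hence more faces than segments to match them with.
\<close>

section \<open>Crosscuts of plane domains\<close>

text \<open>Euler's formula is replaced by two inequalities. A crosscut strictly increases the
  number of components, which bounds the faces from below. The setting is a continuum and a bounded
  component of its complement, because it is needed twice: for the encircling curve and for a cycle
  of arcs. Inside a cycle some forest rooted on the cycle must be at hand. The upward one always is,
  since every non-root vertex has a higher neighbour on its segment; it asks for a height that
  separates all vertices, hence a generic tilt of \<open>Re\<close>. A segment with an edge in the
  enclosed region has an edge there outside the upward forest, namely its lowest one. For the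
  measures: a used edge contributes the inverse of its length to the weight of a forest, and every
  vertex a factor that does not depend on the forest.\<close>

lemma open_Diff_closed_segment_nonempty:
  fixes D :: "complex set"
  assumes "open D" "D \<noteq> {}"
  shows "D - closed_segment u v \<noteq> {}"
proof
  assume "D - closed_segment u v = {}"
  then have "D \<subseteq> interior (closed_segment u v)"
    using assms(1) by (simp add: interior_maximal)
  then show False
    using assms(2) interior_closed_segment_ge2[of u v] by simp
qed

lemma Diff_open_segment_eq:
  assumes "u \<notin> D" "v \<notin> D"
  shows "D - open_segment u v = D - closed_segment u v"
  using assms by (auto simp: open_segment_def)

text \<open>On the sphere, the closed segment and the complement of \<open>D\<close> together with
  infinity are two continua that meet in exactly two points. By the dual form of Janiszewski's
  theorem their union separates the sphere. Connectedness of \<open>- D\<close> makes the second set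
  a continuum.\<close>

lemma crosscut_disconnects:
  fixes D :: "complex set"
  assumes "open D" "bounded D" "connected (- D)" and uv: "u \<noteq> v" "u \<notin> D" "v \<notin> D"
    and e: "open_segment u v \<subseteq> D"
  shows "\<not> connected (D - open_segment u v)"
proof
  assume con: "connected (D - open_segment u v)"
  define D' where "D' = D - closed_segment u v"
  have D': "connected D'" "open D'"
    using con uv assms(1) by (auto simp: D'_def Diff_open_segment_eq)
  have "D \<noteq> {}" using e uv by force
  then obtain q where q: "q \<in> D'"
    using open_Diff_closed_segment_nonempty[OF assms(1)] by (fastforce simp: D'_def)
  have qD: "q \<in> D" "q \<notin> closed_segment u v" using q by (auto simp: D'_def)
  \<comment> \<open>Inversion at a point of \<open>D\<close> makes the complement of \<open>D\<close> compact, as Janiszewski's theorem needs.\<close>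
  define \<phi> where "\<phi> = (\<lambda>z. inverse (z - q))"
  define S where "S = \<phi> ` closed_segment u v"
  \<comment> \<open>\<open>0\<close> is the image of infinity. It is added by hand: since
    \<open>inverse 0 = 0\<close>, the second condition reads \<open>q \<notin> D\<close> there and
    fails, and without \<open>0\<close> the set would not be closed.\<close>
  define T where "T = {w. w = 0 \<or> q + inverse w \<notin> D}"
  have inj: "\<phi> x = \<phi> y \<longleftrightarrow> x = y" for x y
    by (simp add: \<phi>_def)
  have phi_inv: "q + inverse (\<phi> z) = z" for z by (simp add: \<phi>_def)
  have cont: "continuous_on A \<phi>" if "q \<notin> A" for A
    unfolding \<phi>_def using that by (intro continuous_intros) auto
  have S: "compact S" "connected S"
    using qD unfolding S_def
    by (auto intro!: compact_continuous_image connected_continuous_image cont)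
  have "- T = - {0} \<inter> (\<lambda>w. q + inverse w) -` D"
    by (auto simp: T_def)
  moreover have "open (- {0} \<inter> (\<lambda>w. q + inverse w) -` D)"
    by (intro continuous_open_preimage continuous_intros) (use assms in auto)
  ultimately have clT: "closed T" by (simp add: closed_def)
  obtain d where d: "d > 0" "ball q d \<subseteq> D"
    using assms(1) qD openE by blast
  have "norm w \<le> 1 / d" if "w \<in> T" for w
  proof (cases "w = 0")
    case False
    then have "q + inverse w \<notin> ball q d" using that d by (auto simp: T_def)
    then have "d \<le> norm (inverse w)" by (simp add: dist_norm)
    then have "d * norm w \<le> norm (inverse w) * norm w" by (intro mult_right_mono) auto
    moreover have "norm (inverse w) * norm w = 1" using False by (simp flip: norm_mult)
    ultimately have "d * norm w \<le> 1" by simp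
    then show ?thesis using d(1) by (simp add: field_simps)
  qed (use d in auto)
  then have "bounded T" using bounded_iff by blast
  with clT have "compact T" by (simp add: compact_eq_bounded_closed)
  have sub: "\<phi> ` (- D) \<subseteq> T" by (auto simp: T_def phi_inv)
  have sub': "T \<subseteq> insert 0 (\<phi> ` (- D))"
  proof
    fix w assume "w \<in> T"
    moreover have "w = \<phi> (q + inverse w)" by (simp add: \<phi>_def)
    ultimately show "w \<in> insert 0 (\<phi> ` (- D))" by (auto simp: T_def)
  qed
  \<comment> \<open>\<open>- D\<close> is unbounded, so its connected image under
    \<open>\<phi>\<close> accumulates at \<open>0\<close>, and adding \<open>0\<close> keeps it
    connected.\<close>
  have "0 \<in> closure (\<phi> ` (- D))"
    unfolding closure_approachable
  proof (intro allI impI)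
    fix \<epsilon> :: real assume \<epsilon>: "\<epsilon> > 0"
    have "\<not> bounded (- D)" using assms(2) cobounded_imp_unbounded by fastforce
    then have "\<not> - D \<subseteq> cball q (1 / \<epsilon>)" using bounded_subset by blast
    then obtain z where z: "z \<in> - D" "z \<notin> cball q (1 / \<epsilon>)" by blast
    then have "norm (z - q) > 1 / \<epsilon>" by (simp add: dist_norm norm_minus_commute)
    then have "norm (\<phi> z) < inverse (1 / \<epsilon>)"
      unfolding \<phi>_def norm_inverse using \<epsilon> by (intro less_imp_inverse_less) auto
    then have "norm (\<phi> z) < \<epsilon>" by simp
    then show "\<exists>y\<in>\<phi> ` (- D). dist y 0 < \<epsilon>" using z(1) by auto
  qed
  then have "T \<subseteq> closure (\<phi> ` (- D))" using sub' closure_subset by fastforce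
  moreover have "connected (\<phi> ` (- D))"
    using qD assms(3) by (auto intro!: connected_continuous_image cont)
  ultimately have "connected T" using sub connected_intermediate_closure by blast
  have "- (S \<union> T) = \<phi> ` (D' - {q})"
  proof
    show "- (S \<union> T) \<subseteq> \<phi> ` (D' - {q})"
    proof
      fix w assume w: "w \<in> - (S \<union> T)"
      have eq: "w = \<phi> (q + inverse w)" by (simp add: \<phi>_def)
      moreover have "q + inverse w \<in> D' - {q}"
      proof -
        have "w \<noteq> 0" "q + inverse w \<in> D" using w by (auto simp: T_def)
        moreover have "q + inverse w \<notin> closed_segment u v"
          using w eq unfolding S_def by blast
        ultimately show ?thesis by (simp add: D'_def)
      qed
      ultimately show "w \<in> \<phi> ` (D' - {q})" by blast
    qed
    show "\<phi> ` (D' - {q}) \<subseteq> - (S \<union> T)"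
      by (auto simp: D'_def S_def T_def inj \<phi>_def)
  qed
  moreover have "connected (\<phi> ` (D' - {q}))"
    using D' by (auto intro!: connected_continuous_image cont connected_open_delete)
  ultimately have "connected (S \<inter> T)"
    using Janiszewski_dual S \<open>compact T\<close> \<open>connected T\<close> by metis
  moreover have "S \<inter> T = {\<phi> u, \<phi> v}"
  proof -
    have "\<phi> z \<notin> T" if "z \<in> open_segment u v" for z
      using that e qD segment_open_subset_closed[of u v] by (auto simp: T_def \<phi>_def)
    moreover have "\<phi> u \<in> T" "\<phi> v \<in> T" using uv by (auto simp: T_def \<phi>_def)
    ultimately show ?thesis unfolding S_def closed_segment_eq_open by auto
  qed
  ultimately have "connected {\<phi> u, \<phi> v}" by simp
  then have "\<exists>a. {\<phi> u, \<phi> v} = {a}"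
    using connected_finite_iff_sing[of "{\<phi> u, \<phi> v}"] by simp
  then show False using uv(1) inj[of u v] by auto
qed

text \<open>Each component of the cut set lies in one component of \<open>W\<close>, and this map
  \<open>h\<close> is onto because a segment has empty interior. It is not injective, since
  \<open>crosscut_disconnects\<close> splits the component that contains the segment.\<close>

lemma components_crosscut_card:
  fixes W :: "complex set"
  assumes W: "open W" "bounded W" "\<And>K. K \<in> components W \<Longrightarrow> connected (- K)"
    and uv: "u \<noteq> v" "u \<notin> W" "v \<notin> W" and e: "open_segment u v \<subseteq> W"
    and fin: "finite (components (W - open_segment u v))"
  shows "finite (components W)"
    and "card (components W) < card (components (W - open_segment u v))"
proof -
  let ?W' = "W - open_segment u v"
  have "\<exists>K. K \<in> components W \<and> K' \<subseteq> K" if "K' \<in> components ?W'" for K'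
    using that in_components_connected in_components_subset[OF that] in_components_nonempty[OF that]
    by (intro exists_component_superset) auto
  then obtain h where h: "\<And>K'. K' \<in> components ?W' \<Longrightarrow> h K' \<in> components W \<and> K' \<subseteq> h K'"
    by metis
  have in_h: "\<exists>K'\<in>components ?W'. x \<in> K' \<and> h K' = K"
    if "x \<in> K" "K \<in> components W" "x \<notin> open_segment u v" for x K
  proof -
    have "x \<in> ?W'" using that in_components_subset by blast
    then obtain K' where K': "K' \<in> components ?W'" "x \<in> K'" using UnionE Union_components by metis
    with h[OF K'(1)] that have "h K' = K" by (metis components_eq disjoint_iff subsetD)
    with K' show ?thesis by blast
  qed
  have surj: "components W = h ` components ?W'"
  proof (intro subset_antisym subsetI)
    fix K assume K: "K \<in> components W"
    then have "open K" "K \<noteq> {}" using W(1) open_components in_components_nonempty by auto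
    then obtain x where "x \<in> K" "x \<notin> closed_segment u v"
      using open_Diff_closed_segment_nonempty by blast
    then show "K \<in> h ` components ?W'" using in_h[of x K] K segment_open_subset_closed by blast
  qed (use h in blast)
  show "finite (components W)" using surj fin by simp
  have "open_segment u v \<noteq> {}" using uv by simp
  with e obtain D where D: "D \<in> components W" "open_segment u v \<subseteq> D"
    using exists_component_superset[of "open_segment u v" W] convex_connected[OF convex_open_segment]
    by fastforce
  have oD: "open D" "D \<noteq> {}" "D \<subseteq> W"
    using D(1) W(1) open_components in_components_nonempty in_components_subset by blast+
  have nc: "\<not> connected (D - open_segment u v)"
    using uv W oD D bounded_subset[OF W(2) oD(3)] by (intro crosscut_disconnects) auto
  have "\<not> inj_on h (components ?W')"
  proof
    assume inj: "inj_on h (components ?W')"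
    obtain x where x: "x \<in> D" "x \<notin> open_segment u v"
      using open_Diff_closed_segment_nonempty[OF oD(1,2), of u v] segment_open_subset_closed by blast
    obtain K where K: "K \<in> components ?W'" "x \<in> K" "h K = D" using in_h[OF x(1) D(1) x(2)] by blast
    have "D - open_segment u v \<subseteq> K"
    proof
      fix y assume "y \<in> D - open_segment u v"
      then obtain K' where "K' \<in> components ?W'" "y \<in> K'" "h K' = D"
        using in_h[of y D] D by blast
      with K inj show "y \<in> K" by (metis inj_onD)
    qed
    moreover have "K \<subseteq> D - open_segment u v"
      using h[OF K(1)] K in_components_subset[OF K(1)] by auto
    ultimately have "D - open_segment u v = K" by blast
    with nc K in_components_connected show False by metis
  qed
  then have "card (h ` components ?W') \<noteq> card (components ?W')"
    using fin inj_on_iff_eq_card by blast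
  then show "card (components W) < card (components ?W')"
    using surj card_image_le[OF fin, of h] by simp
qed

section \<open>The two sides of a segment and the components that border it\<close>

lemma half_plane_Int_ball:
  fixes a d x :: complex
  assumes "d \<noteq> 0" "r > 0" "\<sigma> \<noteq> 0" "Im ((x - a) * cnj d) = 0"
  shows "\<exists>y \<in> ball x r. \<sigma> * Im ((y - a) * cnj d) > 0"
proof -
  \<comment> \<open>\<open>Im ((y - a) * cnj d)\<close> is \<open>norm d\<close> times the signed
    distance of \<open>y\<close> from the line through \<open>a\<close> in direction
    \<open>d\<close>. The point \<open>y\<close> is reached from \<open>x\<close> by a perpendicular
    step of length \<open>r / 2\<close> towards the side chosen by the sign of
    \<open>\<sigma>\<close>.\<close>
  define t where "t = sgn \<sigma> * (r / 2) / norm d"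
  define y where "y = x + of_real t * \<i> * d"
  have "norm (of_real t * \<i> * d) = \<bar>t\<bar> * norm d" by (simp add: norm_mult)
  also have "\<dots> = r / 2" using assms by (simp add: t_def abs_mult abs_sgn_eq)
  finally have "norm (of_real t * \<i> * d) = r / 2" .
  then have "y \<in> ball x r" using assms(2) by (simp add: y_def dist_norm)
  moreover have "(y - a) * cnj d = (x - a) * cnj d + of_real t * \<i> * (d * cnj d)"
    by (simp add: y_def algebra_simps)
  then have "Im ((y - a) * cnj d) = t * (norm d)\<^sup>2"
    unfolding complex_norm_square[symmetric] using assms(4) by simp
  then have "\<sigma> * Im ((y - a) * cnj d) = \<bar>\<sigma>\<bar> * (r/2) * norm d"
    by (simp add: t_def power2_eq_square abs_sgn assms)
  moreover have "\<dots> > 0" using assms by simp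
  ultimately show ?thesis by (metis)
qed

lemma convex_half_plane_Im: "convex {z. \<sigma> * Im ((z - a) * cnj d) > 0}"
  and open_half_plane_Im: "open {z. \<sigma> * Im ((z - a) * cnj d) > (0::real)}"
proof -
  have eq: "{z. \<sigma> * Im ((z - a) * cnj d) > 0}
     = {z. inner (Complex (- (\<sigma> * Im d)) (\<sigma> * Re d)) z > inner (Complex (- (\<sigma> * Im d)) (\<sigma> * Re d)) a}"
    by (auto simp: inner_complex_def algebra_simps)
  show "convex {z. \<sigma> * Im ((z - a) * cnj d) > 0}"
    unfolding eq by (rule convex_halfspace_gt)
  show "open {z. \<sigma> * Im ((z - a) * cnj d) > 0}"
    unfolding eq by (rule open_halfspace_gt)
qed

lemma in_open_segment_iff:
  fixes a b :: complex
  shows "z \<in> open_segment a b \<longleftrightarrow> a \<noteq> b \<and> (\<exists>t. 0 < t \<and> t < 1 \<and> z = a + of_real t * (b - a))"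
  by (auto simp: in_segment scaleR_conv_of_real algebra_simps)

text \<open>Around each point \<open>x\<close> of the segment take the disc whose radius
  \<open>\<delta> x\<close> is the distance to \<open>T\<close> and the two endpoints. The line cuts
  every disc into two halves, and the halves on either side form \<open>P\<close> and
  \<open>Q\<close>.\<close>

lemma open_segment_sides:
  fixes a b :: complex
  assumes ab: "a \<noteq> b" and T: "closed T" "open_segment a b \<inter> T = {}"
  obtains P Q where "open P" "open Q" "connected P" "connected Q"
    "(P \<union> Q) \<inter> open_segment a b = {}" "(P \<union> Q) \<inter> T = {}"
    "open (P \<union> Q \<union> open_segment a b)"
    "open_segment a b \<subseteq> closure P" "open_segment a b \<subseteq> closure Q"
proof -
  define d where "d = b - a"
  have d: "d \<noteq> 0" using ab by (simp add: d_def)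
  let ?e = "open_segment a b"
  have e_iff: "z \<in> ?e \<longleftrightarrow> (\<exists>t. 0 < t \<and> t < 1 \<and> z = a + of_real t * d)" for z
    using ab by (simp add: in_open_segment_iff d_def)
  define \<delta> where "\<delta> x = infdist x (T \<union> {a, b})" for x
  have T': "closed (T \<union> {a, b})" "T \<union> {a, b} \<noteq> {}" using T by auto
  have \<delta>_pos: "\<delta> x > 0" if "x \<in> ?e" for x
    unfolding \<delta>_def using T that by (intro infdist_pos_not_in_closed[OF T']) (auto simp: open_segment_def)
  have \<delta>_le: "\<delta> x \<le> dist x y" if "y \<in> T \<union> {a, b}" for x y
    unfolding \<delta>_def using that by (rule infdist_le)
  have height0: "Im ((z - a) * cnj d) = 0" if "z \<in> ?e" for z
    using that by (auto simp: e_iff mult.assoc complex_mult_cnj)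
  \<comment> \<open>A point of the line within \<open>\<delta> x\<close> of \<open>x\<close> cannot
    lie beyond an endpoint, because both endpoints are at distance at least
    \<open>\<delta> x\<close>.\<close>
  have on_line: "z \<in> ?e" if z: "Im ((z - a) * cnj d) = 0" "z \<in> ball x (\<delta> x)" and x: "x \<in> ?e" for x z
  proof -
    define t where "t = Re ((z - a) * cnj d) / (norm d)\<^sup>2"
    have "(z - a) * cnj d = of_real (Re ((z - a) * cnj d))"
      using z(1) by (simp add: complex_eq_iff)
    then have "(z - a) * (d * cnj d) = of_real (Re ((z - a) * cnj d)) * d"
      by (metis mult.assoc mult.commute)
    then have "(z - a) * of_real ((norm d)\<^sup>2) = of_real (Re ((z - a) * cnj d)) * d"
      unfolding complex_norm_square .
    then have "z - a = of_real t * d"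
      using d by (simp add: t_def field_simps)
    then have za: "z = a + of_real t * d" by (simp add: algebra_simps)
    obtain s where s: "0 < s" "s < 1" "x = a + of_real s * d" using x e_iff by auto
    have "x - z = of_real (s - t) * d" using s(3) za by (simp add: algebra_simps)
    then have "norm (x - z) = \<bar>s - t\<bar> * norm d" by (simp only: norm_mult norm_of_real)
    moreover have "norm (x - a) = s * norm d" using s by (simp add: norm_mult)
    moreover have "norm (x - b) = (1 - s) * norm d"
    proof -
      have "x - b = - (of_real (1 - s) * d)" using s by (simp add: d_def algebra_simps)
      then show ?thesis using s by (simp only: norm_minus_cancel norm_mult norm_of_real)
    qed
    moreover have "norm (x - z) < norm (x - a)" "norm (x - z) < norm (x - b)"
      using z(2) \<delta>_le[of a x] \<delta>_le[of b x] by (auto simp: dist_norm)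
    ultimately have "\<bar>s - t\<bar> < s" "\<bar>s - t\<bar> < 1 - s"
      using d by (metis mult_less_cancel_right_pos zero_less_norm_iff)+
    then have "0 < t" "t < 1" by linarith+
    then show ?thesis using za e_iff by blast
  qed
  define H where "H \<sigma> = {z. \<sigma> * Im ((z - a) * cnj d) > 0}" for \<sigma> :: real
  define P where "P \<sigma> = (\<Union>x\<in>?e. ball x (\<delta> x) \<inter> H \<sigma>)" for \<sigma>
  have "?e \<noteq> {}" using ab by simp
  have op: "open (P \<sigma>)" for \<sigma>
    unfolding P_def H_def by (intro open_UN ballI open_Int open_ball open_half_plane_Im)
  have PT: "P \<sigma> \<inter> T = {}" for \<sigma>
  proof -
    have False if "x \<in> ?e" "dist x z < \<delta> x" "z \<in> T" for x z
      using \<delta>_le[of z x] that by simp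
    then show ?thesis by (auto simp: P_def)
  qed
  have Pe: "P \<sigma> \<inter> ?e = {}" for \<sigma>
    using height0 by (auto simp: P_def H_def)
  have con: "connected (P \<sigma>)" if \<sigma>: "\<bar>\<sigma>\<bar> = 1" for \<sigma>
  proof -
    \<comment> \<open>The curve \<open>g\<close> runs beside the segment at distance
      \<open>\<delta> x / 2\<close> and so passes through every half disc; the half discs are joined
      along it.\<close>
    define g where "g x = x + of_real (\<sigma> * \<delta> x / (2 * norm d)) * (\<i> * d)" for x
    have "continuous_on ?e g"
      unfolding g_def \<delta>_def using d by (intro continuous_intros) auto
    then have "connected (g ` ?e)"
      by (intro connected_continuous_image convex_connected) auto
    have g: "g x \<in> ball x (\<delta> x) \<inter> H \<sigma>" if "x \<in> ?e" for x
    proof -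
      define t where "t = \<sigma> * \<delta> x / (2 * norm d)"
      have "norm (of_real t * (\<i> * d)) = \<bar>t\<bar> * norm d" by (simp add: norm_mult)
      also have "\<dots> < \<delta> x" using d \<sigma> \<delta>_pos[OF that] by (simp add: t_def abs_mult)
      finally have 1: "g x \<in> ball x (\<delta> x)" by (simp add: g_def t_def dist_norm)
      have "(g x - a) * cnj d = (x - a) * cnj d + of_real t * \<i> * (d * cnj d)"
        by (simp add: g_def t_def algebra_simps)
      then have "Im ((g x - a) * cnj d) = t * (norm d)\<^sup>2"
        unfolding complex_norm_square[symmetric] using height0[OF that] by simp
      moreover have "\<sigma> * t = \<delta> x / (2 * norm d)"
        using \<sigma> by (simp add: t_def) (metis abs_mult_self_eq mult.assoc mult_1 times_divide_eq_right)
      then have "\<sigma> * t > 0" using \<delta>_pos[OF that] d by simp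
      ultimately have "\<sigma> * Im ((g x - a) * cnj d) > 0"
        using d by (simp add: mult.assoc[symmetric])
      with 1 show ?thesis by (simp add: H_def)
    qed
    have "P \<sigma> = (\<Union>x\<in>?e. g ` ?e \<union> (ball x (\<delta> x) \<inter> H \<sigma>))"
      using g by (auto simp: P_def)
    also have "connected \<dots>"
    proof (rule connected_Union)
      fix S assume "S \<in> (\<lambda>x. g ` ?e \<union> (ball x (\<delta> x) \<inter> H \<sigma>)) ` ?e"
      then obtain x where x: "x \<in> ?e" "S = g ` ?e \<union> (ball x (\<delta> x) \<inter> H \<sigma>)" by auto
      have "connected (ball x (\<delta> x) \<inter> H \<sigma>)"
        unfolding H_def by (intro convex_connected convex_Int convex_ball convex_half_plane_Im)
      then show "connected S"
        unfolding x(2) using g[OF x(1)] x(1) \<open>connected (g ` ?e)\<close> by (intro connected_Un) auto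
    next
      show "\<Inter> ((\<lambda>x. g ` ?e \<union> (ball x (\<delta> x) \<inter> H \<sigma>)) ` ?e) \<noteq> {}"
        using \<open>?e \<noteq> {}\<close> by auto
    qed
    finally show ?thesis .
  qed
  have clo: "?e \<subseteq> closure (P \<sigma>)" if \<sigma>: "\<bar>\<sigma>\<bar> = 1" for \<sigma>
  proof
    fix x assume x: "x \<in> ?e"
    show "x \<in> closure (P \<sigma>)"
      unfolding closure_approachable
    proof (intro allI impI)
      fix \<epsilon> :: real assume "\<epsilon> > 0"
      then have "min \<epsilon> (\<delta> x) > 0" using \<delta>_pos[OF x] by simp
      then obtain y where "y \<in> ball x (min \<epsilon> (\<delta> x))" "\<sigma> * Im ((y - a) * cnj d) > 0"
        using half_plane_Int_ball[OF d, of "min \<epsilon> (\<delta> x)" \<sigma> x a] height0[OF x] \<sigma> by force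
      then show "\<exists>y\<in>P \<sigma>. dist y x < \<epsilon>"
        using x by (intro bexI[of _ y]) (auto simp: P_def H_def dist_commute)
    qed
  qed
  have "P 1 \<union> P (-1) \<union> ?e = (\<Union>x\<in>?e. ball x (\<delta> x))"
  proof (intro subset_antisym subsetI)
    fix z assume "z \<in> (\<Union>x\<in>?e. ball x (\<delta> x))"
    then obtain x where x: "x \<in> ?e" "z \<in> ball x (\<delta> x)" by blast
    consider "Im ((z - a) * cnj d) > 0" | "Im ((z - a) * cnj d) < 0" | "Im ((z - a) * cnj d) = 0"
      by linarith
    then show "z \<in> P 1 \<union> P (-1) \<union> ?e"
    proof cases
      case 3 then show ?thesis using on_line x by blast
    qed (use x in \<open>auto simp: P_def H_def\<close>)
  next
    fix z assume "z \<in> P 1 \<union> P (-1) \<union> ?e"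
    then show "z \<in> (\<Union>x\<in>?e. ball x (\<delta> x))"
      using \<delta>_pos by (auto simp: P_def) (metis dist_self)
  qed
  moreover have "open (\<Union>x\<in>?e. ball x (\<delta> x))" by blast
  ultimately have "open (P 1 \<union> P (-1) \<union> ?e)" by simp
  then show ?thesis
    using that[of "P 1" "P (-1)"] op con clo PT Pe by (auto simp: Int_Un_distrib2)
qed

text \<open>\<open>K1\<close> and \<open>K2\<close> contain the two sides of the segment and may
  coincide. The sides and the segment form an open neighbourhood of it, so a component with the
  segment in its frontier meets one of the sides. The last conclusion says that gluing the two
  components along the segment gives an open set.\<close>

lemma segment_borders:
  fixes a b :: complex
  assumes ab: "a \<noteq> b" and W: "open W" "open (W \<union> open_segment a b)" "W \<inter> open_segment a b = {}"
  obtains K1 K2 where "K1 \<in> components W" "K2 \<in> components W"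
    "\<And>K. K \<in> components W \<Longrightarrow> open_segment a b \<subseteq> frontier K \<longleftrightarrow> K = K1 \<or> K = K2"
    "open (K1 \<union> K2 \<union> open_segment a b)"
proof -
  let ?e = "open_segment a b"
  have ne: "?e \<noteq> {}" using ab by simp
  have "closed (- (W \<union> ?e))" using W(2) by (simp only: closed_Compl)
  moreover have "?e \<inter> - (W \<union> ?e) = {}" by auto
  ultimately obtain P Q where PQ: "open P" "open Q" "connected P" "connected Q"
    "(P \<union> Q) \<inter> ?e = {}" "(P \<union> Q) \<inter> - (W \<union> ?e) = {}"
    "open (P \<union> Q \<union> ?e)" "?e \<subseteq> closure P" "?e \<subseteq> closure Q"
    using open_segment_sides[OF ab] by metis
  have "P \<noteq> {}" "Q \<noteq> {}" "P \<subseteq> W" "Q \<subseteq> W" using PQ ne by auto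
  then obtain K1 K2 where K: "K1 \<in> components W" "P \<subseteq> K1" "K2 \<in> components W" "Q \<subseteq> K2"
    using PQ exists_component_superset[of P W] exists_component_superset[of Q W] by auto
  have fr: "?e \<subseteq> frontier K" if "K \<in> components W" "P \<subseteq> K \<or> Q \<subseteq> K" for K
  proof -
    have "?e \<subseteq> closure K" using that PQ closure_mono by blast
    moreover have "interior K \<subseteq> W" using in_components_subset[OF that(1)] interior_subset by blast
    ultimately show ?thesis using W by (auto simp: frontier_def)
  qed
  have bd: "?e \<subseteq> frontier K \<longleftrightarrow> K = K1 \<or> K = K2" if "K \<in> components W" for K
  proof
    assume eK: "?e \<subseteq> frontier K"
    obtain x where "x \<in> ?e" using ne by blast
    then have "x \<in> closure K" "x \<in> P \<union> Q \<union> ?e" using eK by (auto simp: frontier_def)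
    then obtain y where y: "y \<in> K" "y \<in> P \<union> Q \<union> ?e"
      using PQ(7) by (metis closure_iff_nhds_not_empty disjoint_iff interior_open order_refl)
    then have "y \<in> P \<union> Q" using in_components_subset[OF that] W by auto
    with y K that show "K = K1 \<or> K = K2" by (metis Un_iff components_eq disjoint_iff subsetD)
  qed (use fr K in auto)
  have "K1 \<union> K2 \<union> ?e = K1 \<union> K2 \<union> (P \<union> Q \<union> ?e)" using K by auto
  moreover have "open (K1 \<union> K2 \<union> (P \<union> Q \<union> ?e))"
    using W(1) K(1,3) PQ(7) open_components by (meson open_Un)
  ultimately have "open (K1 \<union> K2 \<union> ?e)" by simp
  with K bd show ?thesis by (intro that[of K1 K2])
qed

text \<open>\<open>link\<close> says that crossing a segment of \<open>X\<close> never leaves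
  \<open>A\<close>. Adding to \<open>A\<close>, and likewise to the remaining components, the
  segments that they border gives two disjoint open sets covering the connected set
  \<open>\<Omega>\<close>; hence nothing remains outside \<open>A\<close>.\<close>

lemma components_linked_by_segments:
  fixes \<Omega> W :: "complex set"
  assumes \<Omega>: "connected \<Omega>" "\<Omega> = W \<union> \<Union>X" and W: "open W"
    and X: "\<And>e. e \<in> X \<Longrightarrow> \<exists>a b. a \<noteq> b \<and> e = open_segment a b" "disjoint X"
      "\<And>e. e \<in> X \<Longrightarrow> open (W \<union> e)" "\<And>e. e \<in> X \<Longrightarrow> W \<inter> e = {}"
    and A: "A \<subseteq> components W" "A \<noteq> {}"
    and link: "\<And>e K K'. \<lbrakk>e \<in> X; K \<in> A; K' \<in> components W; e \<subseteq> frontier K; e \<subseteq> frontier K'\<rbrakk> \<Longrightarrow> K' \<in> A"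
  shows "A = components W"
proof -
  have bd: "\<exists>K1 K2. K1 \<in> components W \<and> K2 \<in> components W \<and>
    (\<forall>K\<in>components W. e \<subseteq> frontier K \<longleftrightarrow> K = K1 \<or> K = K2) \<and> open (K1 \<union> K2 \<union> e)" if "e \<in> X" for e
  proof -
    obtain a b where "a \<noteq> b" "e = open_segment a b" using X(1)[OF \<open>e \<in> X\<close>] by auto
    then show ?thesis using segment_borders[of a b W] W X(3,4)[OF \<open>e \<in> X\<close>] by metis
  qed
  define U where "U B = \<Union>B \<union> \<Union>{e \<in> X. \<exists>K\<in>B. e \<subseteq> frontier K}" for B
  let ?B = "components W - A"
  have KU: "K \<subseteq> U B" if "K \<in> B" for K B
    using that unfolding U_def by blast
  have eU: "e \<subseteq> U B" if "e \<in> X" "K \<in> B" "e \<subseteq> frontier K" for e K B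
    using that unfolding U_def by blast
  have opU: "open (U B)" if B: "B \<subseteq> components W"
    and lB: "\<And>e K K'. \<lbrakk>e \<in> X; K \<in> B; K' \<in> components W; e \<subseteq> frontier K; e \<subseteq> frontier K'\<rbrakk> \<Longrightarrow> K' \<in> B" for B
  proof (subst open_subopen, intro ballI)
    fix x assume "x \<in> U B"
    then consider K where "K \<in> B" "x \<in> K" | e K where "e \<in> X" "x \<in> e" "K \<in> B" "e \<subseteq> frontier K"
      by (auto simp: U_def)
    then show "\<exists>T. open T \<and> x \<in> T \<and> T \<subseteq> U B"
    proof cases
      case 1
      then show ?thesis using B W open_components by (intro exI[of _ K]) (auto simp: U_def)
    next
      case 2
      obtain K1 K2 where K12: "K1 \<in> components W" "K2 \<in> components W"
        "\<forall>K\<in>components W. e \<subseteq> frontier K \<longleftrightarrow> K = K1 \<or> K = K2" "open (K1 \<union> K2 \<union> e)"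
        using bd[OF 2(1)] by blast
      then have "e \<subseteq> frontier K1" "e \<subseteq> frontier K2" by simp_all
      then have "K1 \<in> B" "K2 \<in> B" using lB[OF 2(1,3) _ 2(4)] K12(1,2) by simp_all
      then have "K1 \<union> K2 \<union> e \<subseteq> U B" using 2 by (auto simp: U_def)
      then show ?thesis using K12(4) 2 by blast
    qed
  qed
  have "open (U A)" using opU A(1) link by blast
  moreover have "open (U ?B)" using link by (intro opU) auto
  moreover have "U A \<inter> U ?B = {}"
  proof -
    have ee: "e \<inter> e' = {}" if "e \<in> X" "K \<in> A" "e \<subseteq> frontier K" "e' \<in> X" "K' \<in> ?B" "e' \<subseteq> frontier K'" for e e' K K'
    proof -
      have "e \<noteq> e'" using link[OF that(1,2)] that by blast
      then show ?thesis using X(2) that(1,4) by (simp add: disjointD)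
    qed
    have KK: "K \<inter> K' = {}" if "K \<in> A" "K' \<in> ?B" for K K'
      using that A(1) by (metis DiffD1 DiffD2 components_eq subsetD)
    have Ke: "K \<inter> e = {}" if "K \<in> components W" "e \<in> X" for K e
      using X(4)[OF that(2)] in_components_subset[OF that(1)] by auto
    have U: "\<exists>K\<in>B. x \<in> K \<or> (\<exists>e\<in>X. x \<in> e \<and> e \<subseteq> frontier K)" if "x \<in> U B" for x B
      using that by (auto simp: U_def)
    have False if xA: "x \<in> U A" and xB: "x \<in> U ?B" for x
    proof -
      obtain K where K: "K \<in> A" "x \<in> K \<or> (\<exists>e\<in>X. x \<in> e \<and> e \<subseteq> frontier K)" using U[OF xA] by blast
      obtain K' where K': "K' \<in> ?B" "x \<in> K' \<or> (\<exists>e\<in>X. x \<in> e \<and> e \<subseteq> frontier K')" using U[OF xB] by blast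
      have "K \<in> components W" "K' \<in> components W" using K(1) K'(1) A(1) by auto
      note ne = Ke[OF this(1)] Ke[OF this(2)]
      from K(2) K'(2) show False
      proof (elim disjE bexE conjE)
        assume "x \<in> K" "x \<in> K'" then show False using KK[OF K(1) K'(1)] by blast
      next
        fix e assume "x \<in> K" "x \<in> e" "e \<in> X" then show False using ne(1) by blast
      next
        fix e assume "x \<in> K'" "x \<in> e" "e \<in> X" then show False using ne(2) by blast
      next
        fix e e' assume "e \<in> X" "x \<in> e" "e \<subseteq> frontier K" "e' \<in> X" "x \<in> e'" "e' \<subseteq> frontier K'"
        then show False using ee[of e K e' K'] K(1) K'(1) by blast
      qed
    qed
    then show ?thesis by blast
  qed
  moreover have "\<Omega> \<subseteq> U A \<union> U ?B"
  proof
    fix x assume "x \<in> \<Omega>"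
    then consider "x \<in> W" | e where "e \<in> X" "x \<in> e" using \<Omega>(2) by blast
    then show "x \<in> U A \<union> U ?B"
    proof cases
      case 1
      then obtain K where "K \<in> components W" "x \<in> K" using Union_components by blast
      then show ?thesis using KU[of K A] KU[of K ?B] by blast
    next
      case 2
      obtain K where "K \<in> components W" "e \<subseteq> frontier K" using bd[OF 2(1)] by metis
      then show ?thesis using 2 eU[of e K A] eU[of e K ?B] by blast
    qed
  qed
  moreover have meets: "U B \<inter> \<Omega> \<noteq> {}" if B: "B \<subseteq> components W" "B \<noteq> {}" for B
  proof -
    obtain K where K: "K \<in> B" using B(2) by blast
    then have Kc: "K \<in> components W" using B(1) by blast
    obtain x where "x \<in> K" using in_components_nonempty[OF Kc] by blast
    then have "x \<in> U B" "x \<in> \<Omega>"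
      using in_components_subset[OF Kc] \<Omega>(2) KU[OF K] by (simp_all add: subsetD)
    then show ?thesis by blast
  qed
  ultimately have "U A \<inter> \<Omega> = {} \<or> U ?B \<inter> \<Omega> = {}"
    by (intro connectedD[OF \<Omega>(1)]) auto
  then have "U ?B \<inter> \<Omega> = {}" using meets[OF A] by simp
  then have "?B = {}" using meets[of ?B] by blast
  then show ?thesis using A(1) by blast
qed

section \<open>Faces of a drawing with a spanning forest\<close>

text \<open>A connected set that avoids \<open>T\<close> also avoids \<open>C\<close>, so if it
  meets \<open>\<Omega>\<close> it stays there. Components within the region thereby become
  components in the plane, where theorems on complements of connected sets apply.\<close>

lemma components_Diff_superset:
  assumes "\<Omega> \<in> components (- C)" "C \<subseteq> T" "K \<in> components (\<Omega> - T)"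
  shows "K \<in> components (- T)"
  unfolding in_components_maximal
proof (intro conjI allI impI)
  show "K \<noteq> {}" "connected K" "K \<subseteq> - T"
    using assms(3) unfolding in_components_maximal by auto
  fix D assume D: "D \<noteq> {} \<and> K \<subseteq> D \<and> D \<subseteq> - T \<and> connected D"
  have "K \<subseteq> \<Omega>" "K \<noteq> {}" using assms(3) unfolding in_components_maximal by auto
  then have "\<Omega> \<inter> D \<noteq> {}" using D by blast
  moreover have "D \<subseteq> - C" using D assms(2) by blast
  ultimately have "D \<subseteq> \<Omega>" using D components_maximal[OF assms(1)] by blast
  then have "D \<subseteq> \<Omega> - T" using D by blast
  then show "D = K" using assms(3) D unfolding in_components_maximal by simp
qed

text \<open>\<open>p\<close> is a parent map whose paths end on \<open>C\<close>; with
  \<open>C\<close> contracted to a point its edges form a spanning tree. In one instance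
  \<open>C\<close> is the encircling curve and \<open>p\<close> any spanning forest, in the other
  \<open>C\<close> is a cycle of arcs and \<open>p\<close> the upward forest inside it.\<close>

locale planar_region =
  fixes C \<Omega> V :: "complex set" and p :: "complex \<Rightarrow> complex" and E :: "complex set set"
  assumes C: "compact C" "connected C"
    and \<Omega>: "\<Omega> \<in> components (- C)" "bounded \<Omega>"
    and V: "finite V" "V \<subseteq> \<Omega>"
    and E: "finite E" "disjoint E"
      "\<And>e. e \<in> E \<Longrightarrow> \<exists>u v. u \<noteq> v \<and> u \<in> V \<union> C \<and> v \<in> V \<union> C \<and> e = open_segment u v"
      "\<And>e. e \<in> E \<Longrightarrow> e \<subseteq> \<Omega>" "\<And>e. e \<in> E \<Longrightarrow> e \<inter> V = {}"
    and p: "\<And>v. v \<in> V \<Longrightarrow> p v \<in> V \<union> C" "\<And>v. v \<in> V \<Longrightarrow> open_segment v (p v) \<in> E"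
      "acyclic {(v, p v) |v. v \<in> V}"
begin

definition tree_edges :: "complex set set" where
  "tree_edges = (\<lambda>v. open_segment v (p v)) ` V"

definition cross_edges :: "complex set set" where
  "cross_edges = E - tree_edges"

definition drawing :: "complex set set \<Rightarrow> complex set" where
  "drawing E' = C \<union> V \<union> \<Union>E'"

lemma \<Omega>_C: "\<Omega> \<inter> C = {}" "\<Omega> \<noteq> {}" "connected \<Omega>" "open \<Omega>"
proof -
  have "open (- C)" using C(1) compact_imp_closed by blast
  then show "open \<Omega>" using \<Omega>(1) open_components by blast
qed (use \<Omega>(1) in_components_subset[of \<Omega> "- C"] in_components_nonempty in_components_connected in auto)

lemma p_neq: "v \<in> V \<Longrightarrow> p v \<noteq> v"
proof
  assume "v \<in> V" "p v = v"
  then have "(v, v) \<in> {(v, p v) |v. v \<in> V}" by auto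
  then show False using p(3) by (auto simp: acyclic_def)
qed

lemma tree_edge_inj:
  assumes "v \<in> V" "w \<in> V" "open_segment v (p v) = open_segment w (p w)"
  shows "v = w"
proof (rule ccontr)
  assume "v \<noteq> w"
  then have "w = p v" "v = p w"
    using assms p_neq[OF assms(1)] p_neq[OF assms(2)] by (auto simp: doubleton_eq_iff)
  then have "(v, w) \<in> {(v, p v) |v. v \<in> V}" "(w, v) \<in> {(v, p v) |v. v \<in> V}" using assms by auto
  then show False using p(3) by (meson acyclic_def trancl.simps)
qed

lemma closure_edge:
  "e \<in> E \<Longrightarrow> e \<subseteq> closure e \<and> closure e \<subseteq> e \<union> V \<union> C \<and> connected (closure e) \<and>
    closure e \<inter> (V \<union> C) \<noteq> {}"
proof -
  assume "e \<in> E"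
  then obtain u v where "u \<noteq> v" "u \<in> V \<union> C" "v \<in> V \<union> C" "e = open_segment u v" using E(3) by blast
  moreover have "connected (closed_segment u v)" by (simp add: convex_connected)
  ultimately show ?thesis by (auto simp: closed_segment_eq_open)
qed

lemma closed_drawing:
  assumes "E' \<subseteq> E"
  shows "closed (drawing E')"
proof -
  have "drawing E' = C \<union> V \<union> (\<Union>e\<in>E'. closure e)"
    using closure_edge assms unfolding drawing_def by blast
  moreover have "closed \<dots>"
    using C(1) V(1) E(1) assms finite_subset
    by (intro closed_Un closed_UN) (auto simp: compact_imp_closed finite_imp_closed)
  ultimately show ?thesis by simp
qed

section \<open>Forests attached to the boundary do not separate the region\<close>

definition subforest :: "complex set \<Rightarrow> complex set" where
  "subforest A = C \<union> (\<Union>v\<in>A. closed_segment v (p v))"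

text \<open>Induction by removing a leaf \<open>v\<close>. Its segment meets the rest only in the
  single point \<open>p v\<close>, a connected set, so by Janiszewski's theorem it separates no two
  points that the rest left together.\<close>

lemma subforest_properties:
  assumes "A \<subseteq> V" "p ` A \<subseteq> A \<union> C"
  shows "connected (subforest A) \<and> connected (\<Omega> - subforest A) \<and> \<Omega> - subforest A \<noteq> {}"
proof -
  have "finite A" using assms V finite_subset by blast
  then show ?thesis using assms
  proof (induction A rule: finite_psubset_induct)
    case (psubset A)
    show ?case
    proof (cases "A = {}")
      case True
      then show ?thesis using C \<Omega>_C by (simp add: subforest_def Diff_triv)
    next
      case False
      have fin: "finite {(v, p v) |v. v \<in> V}" using V(1) by simp
      then have "wf {(v, p v) |v. v \<in> V}" using p(3) finite_acyclic_wf by blast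
      moreover obtain v0 where "v0 \<in> A" using False by blast
      \<comment> \<open>A minimal element for the parent relation: no vertex of \<open>A\<close> has
        \<open>v\<close> as its parent, so \<open>v\<close> is a leaf.\<close>
      ultimately obtain v where v: "v \<in> A" "\<And>y. (y, v) \<in> {(v, p v) |v. v \<in> V} \<Longrightarrow> y \<notin> A"
        by (elim wfE_min) auto
      then have vp: "v \<notin> p ` A" using psubset.prems(1) by auto
      define A' where "A' = A - {v}"
      have A': "A' \<subset> A" "A' \<subseteq> V" "p ` A' \<subseteq> A' \<union> C" "A = insert v A'" "v \<notin> A'"
        using v(1) vp psubset.prems by (auto simp: A'_def)
      note IH = psubset.IH[OF A'(1-3)]
      let ?S = "closed_segment v (p v)" and ?T = "subforest A'"
      have sub: "subforest A = ?S \<union> ?T" using A'(4) by (auto simp: subforest_def)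
      have vV: "v \<in> V" using v psubset.prems by auto
      have int: "?S \<inter> ?T = {p v}"
      proof -
        have "p v \<in> ?T"
          using psubset.prems(2) v(1) vp p_neq[OF vV] by (force simp: subforest_def A'_def)
        moreover have "v \<notin> ?T"
        proof
          assume "v \<in> ?T"
          moreover have "v \<notin> C" using vV V(2) \<Omega>_C by auto
          ultimately obtain w where w: "w \<in> A'" "v \<in> closed_segment w (p w)" by (auto simp: subforest_def)
          then have "v \<in> open_segment w (p w)" using vp A'(4,5) by (auto simp: open_segment_def)
          then show False using E(5)[OF p(2)[of w]] w A' vV by auto
        qed
        moreover have "open_segment v (p v) \<inter> ?T = {}"
        proof -
          have "open_segment v (p v) \<inter> C = {}" using E(4)[OF p(2)[OF vV]] \<Omega>_C by auto
          moreover have "open_segment v (p v) \<inter> closed_segment w (p w) = {}" if "w \<in> A'" for w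
          proof -
            have w: "w \<in> V" "w \<noteq> v" using that A' by auto
            then have "open_segment v (p v) \<inter> open_segment w (p w) = {}"
              using tree_edge_inj[OF vV w(1)] E(2) p(2) vV by (metis disjointD)
            moreover have "open_segment v (p v) \<inter> {w, p w} = {}"
              using E(4,5)[OF p(2)[OF vV]] w(1) p(1)[OF w(1)] \<Omega>_C by auto
            ultimately show ?thesis by (auto simp: closed_segment_eq_open)
          qed
          ultimately show ?thesis by (auto simp: subforest_def)
        qed
        ultimately show ?thesis by (auto simp: closed_segment_eq_open)
      qed
      have clT: "closed ?T"
        unfolding subforest_def using C(1) A' V(1) finite_subset[OF A'(2)]
        by (intro closed_Un closed_UN) (auto simp: compact_imp_closed)
      have "connected (subforest A)"
        unfolding sub using IH int by (intro connected_Un) (auto simp: convex_connected)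
      moreover have "connected (\<Omega> - subforest A)"
        unfolding connected_iff_connected_component
      proof (intro ballI)
        fix a b assume ab: "a \<in> \<Omega> - subforest A" "b \<in> \<Omega> - subforest A"
        have "connected_component (- (?S \<union> ?T)) a b"
        proof (rule Janiszewski)
          have "connected (- ?S)" by (intro connected_complement_bounded_convex) (auto simp: compact_imp_bounded)
          then show "connected_component (- ?S) a b"
            using ab sub by (auto simp: connected_iff_connected_component)
          have "connected_component (\<Omega> - ?T) a b"
            using ab sub IH by (auto simp: connected_iff_connected_component)
          then show "connected_component (- ?T) a b"
            by (rule connected_component_of_subset) auto
        qed (use clT int in auto)
        then obtain D where D: "connected D" "D \<subseteq> - subforest A" "a \<in> D" "b \<in> D"
          unfolding sub connected_component_def by auto
        \<comment> \<open>Janiszewski's theorem connects \<open>a\<close> and \<open>b\<close>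
          somewhere in the plane; the connecting set avoids \<open>C\<close> and therefore cannot
          leave \<open>\<Omega>\<close>.\<close>
        have "D \<subseteq> \<Omega>"
          using D ab by (intro components_maximal[OF \<Omega>(1)]) (auto simp: subforest_def)
        then show "connected_component (\<Omega> - subforest A) a b"
          using D unfolding connected_component_def by blast
      qed
      moreover have "\<Omega> - subforest A \<noteq> {}"
      proof -
        have "open (\<Omega> - ?T)" using clT \<Omega>_C by auto
        then have "\<Omega> - ?T - ?S \<noteq> {}" using IH open_Diff_closed_segment_nonempty by blast
        then show ?thesis using sub by auto
      qed
      ultimately show ?thesis by blast
    qed
  qed
qed

lemma tree_edges_subset: "tree_edges \<subseteq> E"
  using p(2) by (auto simp: tree_edges_def)

lemma drawing_tree_edges: "drawing tree_edges = subforest V"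
proof -
  have "p ` V \<subseteq> V \<union> C" using p(1) by auto
  then show ?thesis
    unfolding drawing_def tree_edges_def subforest_def closed_segment_eq_open by blast
qed

lemma tree_properties:
  "connected (drawing tree_edges)" "connected (\<Omega> - drawing tree_edges)" "\<Omega> - drawing tree_edges \<noteq> {}"
proof -
  have "p ` V \<subseteq> V \<union> C" using p(1) by blast
  note subforest_properties[OF order_refl this]
  then show "connected (drawing tree_edges)" "connected (\<Omega> - drawing tree_edges)" "\<Omega> - drawing tree_edges \<noteq> {}"
    unfolding drawing_tree_edges by simp_all
qed

text \<open>Removing a connected drawing leaves components with connected complements, which is what
  allows the next cross edge to act as a crosscut.\<close>

lemma connected_drawing:
  assumes "X' \<subseteq> cross_edges"
  shows "connected (drawing (tree_edges \<union> X'))"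
proof -
  have X': "e \<in> E" if "e \<in> X'" for e using that assms by (auto simp: cross_edges_def)
  have "drawing (tree_edges \<union> X') = drawing tree_edges \<union> \<Union>(closure ` X')"
    using closure_edge[OF X'] unfolding drawing_def by blast
  also have "connected \<dots>"
    using closure_edge[OF X'] by (intro connected_Un_UN tree_properties(1)) (auto simp: drawing_def)
  finally show ?thesis .
qed

text \<open>The tree leaves one component, and every cross edge added afterwards is a crosscut that
  creates at least one more. Finiteness is assumed for the full drawing and handed down to the
  smaller ones by \<open>components_crosscut_card\<close>.\<close>

lemma card_components_ge:
  assumes "finite (components (\<Omega> - drawing E))"
  shows "card cross_edges + 1 \<le> card (components (\<Omega> - drawing E))"
proof -
  have fX: "finite cross_edges" using E(1) by (simp add: cross_edges_def)
  have "card X' + 1 \<le> card (components (\<Omega> - drawing (tree_edges \<union> X')))"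
    if "finite (components (\<Omega> - drawing (tree_edges \<union> X')))" "X' \<subseteq> cross_edges" for X'
    using finite_subset[OF that(2) fX] that
  proof (induction X' rule: finite_induct)
    case empty
    have "components (\<Omega> - drawing tree_edges) = {\<Omega> - drawing tree_edges}"
      using tree_properties by (simp add: components_eq_sing_iff)
    then show ?case by simp
  next
    case (insert e X')
    let ?W = "\<Omega> - drawing (tree_edges \<union> X')"
    have eE: "e \<in> E" "X' \<subseteq> E" "e \<notin> tree_edges" using insert.prems by (auto simp: cross_edges_def)
    then obtain u v where uv: "u \<noteq> v" "u \<in> V \<union> C" "v \<in> V \<union> C" "e = open_segment u v" using E(3) by blast
    have W': "\<Omega> - drawing (tree_edges \<union> insert e X') = ?W - open_segment u v"
      using uv(4) by (auto simp: drawing_def)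
    have "e \<inter> e' = {}" if "e' \<in> tree_edges \<union> X'" for e'
      using that E(2) eE tree_edges_subset insert.hyps(2) by (metis Un_iff disjointD subsetD)
    then have eW: "open_segment u v \<subseteq> ?W"
      using E(4,5)[OF eE(1)] \<Omega>_C uv(4) by (auto simp: drawing_def)
    have op: "open ?W"
      using \<Omega>_C eE tree_edges_subset by (intro open_Diff closed_drawing) auto
    have bd: "bounded ?W" using \<Omega>(2) bounded_diff by blast
    have co: "connected (- K)" if "K \<in> components ?W" for K
    proof (rule component_complement_connected)
      show "connected (drawing (tree_edges \<union> X'))" using connected_drawing insert.prems(2) by simp
      show "K \<in> components (- drawing (tree_edges \<union> X'))"
        by (rule components_Diff_superset[OF \<Omega>(1) _ that]) (auto simp: drawing_def)
    qed
    have uvW: "u \<notin> ?W" "v \<notin> ?W" using uv by (auto simp: drawing_def)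
    note * = components_crosscut_card[OF op bd co uv(1) uvW eW]
    show ?case
      using insert insert.prems * unfolding W' by force
  qed
  moreover have "tree_edges \<union> cross_edges = E" using tree_edges_subset by (auto simp: cross_edges_def)
  ultimately show ?thesis using assms by (metis order_refl)
qed

lemma open_region: "E' \<subseteq> E \<Longrightarrow> open (\<Omega> - drawing E')"
  by (intro open_Diff \<Omega>_C closed_drawing)

lemma region_Un_edge:
  assumes "e \<in> E"
  shows "(\<Omega> - drawing E) \<union> e = \<Omega> - drawing (E - {e})"
proof -
  have "e \<inter> e' = {}" if "e' \<in> E - {e}" for e'
    using that E(2) assms by (metis DiffE disjointD insertI1)
  then have "e \<inter> drawing (E - {e}) = {}" using assms E(4,5)[OF assms] \<Omega>_C by (auto simp: drawing_def)
  moreover have "drawing E = drawing (E - {e}) \<union> e" using assms by (auto simp: drawing_def)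
  ultimately show ?thesis using E(4)[OF assms] by auto
qed

lemma edge_borders:
  assumes "e \<in> E"
  obtains K1 K2 where "K1 \<in> components (\<Omega> - drawing E)" "K2 \<in> components (\<Omega> - drawing E)"
    "\<And>K. K \<in> components (\<Omega> - drawing E) \<Longrightarrow> e \<subseteq> frontier K \<longleftrightarrow> K = K1 \<or> K = K2"
proof -
  obtain u v where uv: "u \<noteq> v" "e = open_segment u v" using E(3)[OF assms] by blast
  have "(\<Omega> - drawing E) \<inter> e = {}" using assms by (auto simp: drawing_def)
  moreover have "open (\<Omega> - drawing E)" "open ((\<Omega> - drawing E) \<union> e)"
    using region_Un_edge[OF assms] open_region[of E] open_region[of "E - {e}"] by auto
  ultimately show ?thesis
    using segment_borders[OF uv(1), of "\<Omega> - drawing E" thesis] that unfolding uv(2) by auto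
qed

text \<open>The region without the tree is connected and arises from the components by gluing along
  cross edges, so tree edges need never be crossed.\<close>

lemma components_linked:
  assumes "A \<subseteq> components (\<Omega> - drawing E)" "A \<noteq> {}"
    and "\<And>e K K'. \<lbrakk>e \<in> cross_edges; K \<in> A; K' \<in> components (\<Omega> - drawing E);
      e \<subseteq> frontier K; e \<subseteq> frontier K'\<rbrakk> \<Longrightarrow> K' \<in> A"
  shows "A = components (\<Omega> - drawing E)"
proof (rule components_linked_by_segments[of "\<Omega> - drawing tree_edges" _ cross_edges])
  have XE: "e \<in> E" if "e \<in> cross_edges" for e using that by (auto simp: cross_edges_def)
  show "connected (\<Omega> - drawing tree_edges)" by (rule tree_properties)
  have "e \<inter> drawing tree_edges = {}" if "e \<in> cross_edges" for e
  proof -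
    have "e \<inter> e' = {}" if "e' \<in> tree_edges" for e'
      using that \<open>e \<in> cross_edges\<close> E(2) tree_edges_subset
      by (metis Diff_iff cross_edges_def disjointD subsetD)
    then show ?thesis using E(4,5)[OF XE[OF that]] \<Omega>_C by (auto simp: drawing_def)
  qed
  moreover have "drawing E = drawing tree_edges \<union> \<Union>cross_edges"
    using tree_edges_subset by (auto simp: drawing_def cross_edges_def)
  moreover have "\<Union>cross_edges \<subseteq> \<Omega>" using E(4) XE by blast
  ultimately show "\<Omega> - drawing tree_edges = (\<Omega> - drawing E) \<union> \<Union>cross_edges" by blast
  show "open (\<Omega> - drawing E)" by (rule open_region) simp
  show "\<exists>a b. a \<noteq> b \<and> e = open_segment a b" if "e \<in> cross_edges" for e
    using E(3)[OF XE[OF that]] by blast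
  show "disjoint cross_edges" using E(2) by (simp add: cross_edges_def pairwise_subset)
  show "open (\<Omega> - drawing E \<union> e)" if "e \<in> cross_edges" for e
    using region_Un_edge[OF XE[OF that]] open_region[of "E - {e}"] by auto
  show "(\<Omega> - drawing E) \<inter> e = {}" if "e \<in> cross_edges" for e
    using XE[OF that] by (auto simp: drawing_def)
qed (use assms in auto)

end

section \<open>Matchings in a tree\<close>

locale linked_incidence =
  fixes \<Phi> :: "'a set" and X :: "'b set" and I :: "'a \<Rightarrow> 'b \<Rightarrow> bool" and F0 :: 'a
  assumes fin: "finite X" and F0: "F0 \<in> \<Phi>"
    and ends: "\<And>e. e \<in> X \<Longrightarrow> \<exists>K1 K2. \<forall>K\<in>\<Phi>. I K e \<longleftrightarrow> K = K1 \<or> K = K2"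
    and linked: "\<And>A. \<lbrakk>A \<subseteq> \<Phi>; A \<noteq> {};
      \<And>e K K'. \<lbrakk>e \<in> X; K \<in> A; K' \<in> \<Phi>; I K e; I K' e\<rbrakk> \<Longrightarrow> K' \<in> A\<rbrakk> \<Longrightarrow> A = \<Phi>"
begin

lemma third_end:
  assumes "e \<in> X" "K \<in> \<Phi>" "K' \<in> \<Phi>" "K'' \<in> \<Phi>" "I K e" "I K' e" "I K'' e" "K \<noteq> K'"
  shows "K'' = K \<or> K'' = K'"
  using ends[OF assms(1)] assms(2-) by metis

text \<open>A tree grown from \<open>F0\<close>, where \<open>m K\<close> is the link by which
  \<open>K\<close> was attached. The last clause keeps all ends of used links in \<open>A\<close>,
  so a link that leaves \<open>A\<close> is still free.\<close>

definition partial_matching :: "'a set \<Rightarrow> ('a \<Rightarrow> 'b) \<Rightarrow> bool" where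
  "partial_matching A m \<longleftrightarrow> F0 \<in> A \<and> A \<subseteq> \<Phi> \<and> finite A \<and> inj_on m (A - {F0}) \<and> m ` (A - {F0}) \<subseteq> X \<and>
     (\<forall>K\<in>A - {F0}. I K (m K) \<and> (\<forall>K'\<in>\<Phi>. I K' (m K) \<longrightarrow> K' \<in> A))"

lemma extend_partial_matching:
  assumes "partial_matching A m" "A \<noteq> \<Phi>"
  shows "\<exists>K m'. K \<notin> A \<and> partial_matching (insert K A) m'"
proof -
  have A: "A \<subseteq> \<Phi>" "F0 \<in> A" using assms by (auto simp: partial_matching_def)
  then obtain e K K' where e: "e \<in> X" "K \<in> A" "K' \<in> \<Phi>" "I K e" "I K' e" "K' \<notin> A"
    using linked[of A] assms(2) by blast
  have PM: "finite A" "inj_on m (A - {F0})" "m ` (A - {F0}) \<subseteq> X"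
    "\<And>G. G \<in> A - {F0} \<Longrightarrow> I G (m G)"
    "\<And>G G'. \<lbrakk>G \<in> A - {F0}; G' \<in> \<Phi>; I G' (m G)\<rbrakk> \<Longrightarrow> G' \<in> A"
    using assms(1) unfolding partial_matching_def by auto
  define m' where "m' = m(K' := e)"
  have m': "m' G = m G" if "G \<in> A - {F0}" for G using that e(6) by (auto simp: m'_def)
  have "m' K' = e" by (simp add: m'_def)
  have "e \<notin> m ` (A - {F0})" using PM(5) e by blast
  have ends: "K'' \<in> insert K' A" if "K'' \<in> \<Phi>" "I K'' e" for K''
    using third_end[of e K K' K''] e that A by blast
  have ins: "insert K' A - {F0} = insert K' (A - {F0})" using e A by auto
  have img: "m' ` (A - {F0}) = m ` (A - {F0})" using m' by (intro image_cong) auto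
  have inj: "inj_on m' (A - {F0})" using PM(2) m' by (metis inj_on_cong)
  have "partial_matching (insert K' A) m'"
    unfolding partial_matching_def ins
  proof (intro conjI)
    show "inj_on m' (insert K' (A - {F0}))"
      using inj \<open>e \<notin> m ` (A - {F0})\<close> \<open>m' K' = e\<close> img e(6) by (simp add: inj_on_insert)
    show "m' ` insert K' (A - {F0}) \<subseteq> X" using img PM(3) e(1) \<open>m' K' = e\<close> by simp
    show "\<forall>G\<in>insert K' (A - {F0}). I G (m' G) \<and> (\<forall>G'\<in>\<Phi>. I G' (m' G) \<longrightarrow> G' \<in> insert K' A)"
    proof
      fix G assume "G \<in> insert K' (A - {F0})"
      then consider "G = K'" | "G \<in> A - {F0}" by blast
      then show "I G (m' G) \<and> (\<forall>G'\<in>\<Phi>. I G' (m' G) \<longrightarrow> G' \<in> insert K' A)"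
      proof cases
        case 1
        then show ?thesis using e(5) ends \<open>m' K' = e\<close> by simp
      next
        case 2
        then show ?thesis using PM(4)[OF 2] PM(5)[OF 2] m'[OF 2] by simp
      qed
    qed
  qed (use A e PM(1) in auto)
  with e(6) show ?thesis by blast
qed

text \<open>A grown tree spends one link per node other than \<open>F0\<close>, so it never exceeds
  \<open>card X + 1\<close> nodes; since growth stops only at \<open>\<Phi>\<close>, this proves
  finiteness as well. If \<open>\<Phi>\<close> attains the bound, every link has been spent.\<close>

lemma matching_exists:
  "finite \<Phi>" "card \<Phi> \<le> card X + 1"
  "card X + 1 \<le> card \<Phi> \<Longrightarrow> \<exists>m. bij_betw m (\<Phi> - {F0}) X \<and> (\<forall>K\<in>\<Phi> - {F0}. I K (m K))"
proof -
  have small: "card A \<le> card X + 1" if "partial_matching A m" for A m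
  proof -
    have "card (A - {F0}) \<le> card X"
      using that fin card_inj_on_le unfolding partial_matching_def by blast
    then show ?thesis using that by (auto simp: partial_matching_def)
  qed
  have "(\<exists>m. partial_matching \<Phi> m) \<or> (\<exists>A m. partial_matching A m \<and> card A = Suc n)" for n
  proof (induction n)
    case 0
    have "partial_matching {F0} m" for m using F0 by (auto simp: partial_matching_def)
    then show ?case by force
  next
    case (Suc n)
    then show ?case
    proof
      assume "\<exists>A m. partial_matching A m \<and> card A = Suc n"
      then obtain A m where A: "partial_matching A m" "card A = Suc n" by blast
      show ?thesis
      proof (cases "A = \<Phi>")
        case False
        obtain K m' where "K \<notin> A" "partial_matching (insert K A) m'"
          using extend_partial_matching[OF A(1) False] by blast
        moreover have "finite A" using A by (auto simp: partial_matching_def)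
        ultimately show ?thesis using A(2) by (metis card_insert_disjoint)
      qed (use A in blast)
    qed simp
  qed
  \<comment> \<open>For this value the second alternative asks for a tree with
    \<open>card X + 2\<close> nodes, one more than possible.\<close>
  from this[of "card X + 1"] obtain m where m: "partial_matching \<Phi> m"
    using small by fastforce
  then show f: "finite \<Phi>" and "card \<Phi> \<le> card X + 1"
    using small by (auto simp: partial_matching_def)
  assume c: "card X + 1 \<le> card \<Phi>"
  have "m ` (\<Phi> - {F0}) = X"
  proof (rule card_subset_eq[OF fin])
    show "m ` (\<Phi> - {F0}) \<subseteq> X" using m by (auto simp: partial_matching_def)
    have "card (m ` (\<Phi> - {F0})) = card \<Phi> - 1"
      using m F0 f by (simp add: partial_matching_def card_image card_Diff_singleton)
    then show "card (m ` (\<Phi> - {F0})) = card X" using c small[OF m] by simp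
  qed
  then show "\<exists>m. bij_betw m (\<Phi> - {F0}) X \<and> (\<forall>K\<in>\<Phi> - {F0}. I K (m K))"
    using m by (intro exI[of _ m]) (auto simp: partial_matching_def bij_betw_def)
qed

text \<open>\<open>P\<close> leads from a node to the other end of the link that \<open>m\<close>
  gives it. Every node is led to \<open>F0\<close>, yet a disagreement between \<open>m\<close> and
  \<open>m'\<close> is passed on at each step and cannot exist at \<open>F0\<close>.\<close>

lemma matching_unique:
  assumes m: "bij_betw m (\<Phi> - {F0}) X" "\<And>K. K \<in> \<Phi> - {F0} \<Longrightarrow> I K (m K)"
    and m': "bij_betw m' (\<Phi> - {F0}) X" "\<And>K. K \<in> \<Phi> - {F0} \<Longrightarrow> I K (m' K)"
    and K: "K \<in> \<Phi> - {F0}"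
  shows "m K = m' K"
proof (rule ccontr)
  assume neq: "m K \<noteq> m' K"
  have mX: "m K \<in> X" "m' K \<in> X" if "K \<in> \<Phi> - {F0}" for K
    using m(1) m'(1) that by (auto simp: bij_betw_def)
  define P where "P = {(K, K'). K \<in> \<Phi> - {F0} \<and> K' \<in> \<Phi> \<and> I K' (m K) \<and> K' \<noteq> K}"
  have "{K \<in> \<Phi>. (K, F0) \<in> P\<^sup>*} = \<Phi>"
  proof (rule linked)
    fix e K K' assume e: "e \<in> X" "K \<in> {K \<in> \<Phi>. (K, F0) \<in> P\<^sup>*}" "K' \<in> \<Phi>" "I K e" "I K' e"
    obtain G where G: "G \<in> \<Phi> - {F0}" "m G = e" using m(1) e(1) unfolding bij_betw_def by blast
    show "K' \<in> {K \<in> \<Phi>. (K, F0) \<in> P\<^sup>*}"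
    proof (cases "K = K'")
      case False
      \<comment> \<open>The node \<open>G\<close> to which \<open>m\<close> gives the link
        \<open>e\<close> is one of its two ends. If it is \<open>K'\<close>, then \<open>P\<close>
        leads from \<open>K'\<close> to \<open>K\<close>; if it is \<open>K\<close>, then
        \<open>K'\<close> is the next node on the way from \<open>K\<close> to
        \<open>F0\<close>.\<close>
      then consider "G = K" | "G = K'"
        using third_end[OF e(1) _ e(3) _ e(4,5), of G] e(2) G m(2)[OF G(1)] by auto
      then show ?thesis
      proof cases
        case 1
        then have "K \<noteq> F0" "(K, F0) \<in> P\<^sup>*" using G e by auto
        then obtain G' where G': "(K, G') \<in> P" "(G', F0) \<in> P\<^sup>*" by (metis converse_rtranclE)
        then have "G' = K'"
          using third_end[OF e(1) _ e(3) _ e(4,5) _ False, of G'] 1 G e(2) by (auto simp: P_def)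
        then show ?thesis using G' e by auto
      next
        case 2
        then have "(K', K) \<in> P" using G e False by (auto simp: P_def)
        then show ?thesis using e by (auto intro: converse_rtrancl_into_rtrancl)
      qed
    qed (use e in auto)
  qed (use F0 in auto)
  then have "(K, F0) \<in> P\<^sup>*" using K by auto
  moreover have "H \<noteq> F0 \<and> m H \<noteq> m' H" if "(K, H) \<in> P\<^sup>*" for H
    using that
  proof (induction rule: rtrancl_induct)
    case (step G H)
    then have G: "G \<in> \<Phi> - {F0}" "H \<in> \<Phi>" "I H (m G)" "H \<noteq> G" by (auto simp: P_def)
    \<comment> \<open>\<open>m'\<close> gives the link \<open>m G\<close> to a node other than
      \<open>G\<close>, hence to its other end \<open>H\<close>. By injectivity \<open>m\<close>
      does not give it to \<open>H\<close>, so the two matchings disagree at \<open>H\<close>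
      too.\<close>
    obtain G' where G': "G' \<in> \<Phi> - {F0}" "m' G' = m G"
      using m'(1) mX[OF G(1)] unfolding bij_betw_def by (metis imageE)
    then have "G' \<noteq> G" using step by auto
    then have "G' = H"
      using third_end[of "m G" G H G'] G G' m(2)[OF G(1)] m'(2)[OF G'(1)] mX[OF G(1)] by auto
    moreover have "m H \<noteq> m G" if "H \<noteq> F0"
      using m(1) G that unfolding bij_betw_def inj_on_def by blast
    ultimately show ?case using G' by auto
  qed (use K neq in auto)
  ultimately show False by blast
qed

end

section \<open>Neighbours along a segment\<close>

text \<open>Two points with different imaginary parts are level for only one value of
  \<open>t\<close>, and these finitely many values are avoided. A pair with equal imaginary parts
  puts \<open>0\<close> into \<open>bad\<close> by division by zero, which does no harm.\<close>

lemma exists_injective_height: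
  fixes V :: "complex set"
  assumes "finite V"
  shows "\<exists>t. inj_on (\<lambda>z. Re z + t * Im z) V"
proof -
  define bad where "bad = (\<lambda>(z, w). (Re z - Re w) / (Im w - Im z)) ` (V \<times> V)"
  have "finite bad" using assms by (simp add: bad_def)
  then obtain t where t: "t \<notin> bad" using ex_new_if_finite infinite_UNIV_char_0 by metis
  have "z = w" if zw: "z \<in> V" "w \<in> V" "Re z + t * Im z = Re w + t * Im w" for z w
  proof (cases "Im z = Im w")
    case False
    have "t = (Re z - Re w) / (Im w - Im z)" using zw(3) False by (simp add: field_simps)
    then have "t \<in> bad" using zw by (auto simp: bad_def)
    then show ?thesis using t by simp
  qed (use zw in \<open>auto simp: complex_eq_iff\<close>)
  then show ?thesis by (auto simp: inj_on_def)
qed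

lemma closure_finite_Union: "finite A \<Longrightarrow> closure (\<Union>A) = (\<Union>s\<in>A. closure s)"
  by (induction A rule: finite_induct) auto

lemma vertices_eq:
  assumes "\<And>s. s \<in> L \<Longrightarrow> \<exists>a b. a \<noteq> b \<and> s = open_segment a b"
  shows "vertices L = (\<Union>s\<in>L. closure s - s)"
proof -
  have cl: "closure (open_segment a b) - open_segment a b = {a, b}" if "a \<noteq> b" for a b :: complex
  proof -
    have "a \<notin> open_segment a b" "b \<notin> open_segment a b" by (simp_all add: open_segment_def)
    then show ?thesis using that by (auto simp: closed_segment_eq_open)
  qed
  show ?thesis
  proof (intro subset_antisym subsetI)
    fix x assume "x \<in> vertices L"
    then obtain b where b: "x \<noteq> b" "open_segment x b \<in> L" unfolding vertices_def by blast
    then have "x \<in> closure (open_segment x b) - open_segment x b" unfolding cl[OF b(1)] by simp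
    with b show "x \<in> (\<Union>s\<in>L. closure s - s)" by blast
  next
    fix x assume "x \<in> (\<Union>s\<in>L. closure s - s)"
    then obtain s where s: "s \<in> L" "x \<in> closure s - s" by blast
    obtain a b where ab: "a \<noteq> b" "s = open_segment a b" using assms[OF s(1)] by blast
    then have "x = a \<or> x = b" using cl s by auto
    moreover have "open_segment b a \<in> L" using ab s open_segment_commute by metis
    ultimately show "x \<in> vertices L" using ab s unfolding vertices_def by auto
  qed
qed

lemma finite_vertices:
  assumes "t_graph L R"
  shows "finite (vertices L)"
proof -
  have seg: "\<exists>a b. a \<noteq> b \<and> s = open_segment a b" if "s \<in> L" for s
    using assms that unfolding t_graph_def by blast
  have "finite (closure s - s)" if "s \<in> L" for s
  proof -
    obtain a b where "a \<noteq> b" "s = open_segment a b" using seg[OF \<open>s \<in> L\<close>] by blast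
    then have "closure s - s \<subseteq> {a, b}" by (auto simp: closed_segment_eq_open)
    then show ?thesis using finite_subset by blast
  qed
  moreover have "vertices L = (\<Union>s\<in>L. closure s - s)" using seg by (rule vertices_eq)
  moreover have "finite L" using assms by (simp add: t_graph_def)
  ultimately show ?thesis by simp
qed

text \<open>The tilt \<open>t\<close> makes no two vertices level. Hence each segment has a lower
  and an upper end, and the two neighbours of a vertex on its segment are told apart as the one
  above and the one below.\<close>

locale tgraph =
  fixes L :: "complex set set" and R :: "complex set" and t :: real
  assumes t_graph: "t_graph L R"
    and inj_t: "inj_on (\<lambda>z. Re z + t * Im z) (vertices L)"
begin

definition h :: "complex \<Rightarrow> real" where "h z = Re z + t * Im z"

abbreviation "V \<equiv> vertices L"
abbreviation "E \<equiv> edges L"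

lemma inj_h: "u \<in> V \<Longrightarrow> v \<in> V \<Longrightarrow> h u = h v \<longleftrightarrow> u = v"
  using inj_t by (auto simp: inj_on_def h_def)

lemma finite_L: "finite L" and disjoint_L: "disjoint L"
  and L_segment: "s \<in> L \<Longrightarrow> \<exists>a b. a \<noteq> b \<and> s = open_segment a b"
  using t_graph by (auto simp: t_graph_def)

lemma L_unique: "s \<in> L \<Longrightarrow> s' \<in> L \<Longrightarrow> x \<in> s \<Longrightarrow> x \<in> s' \<Longrightarrow> s = s'"
  using disjoint_L unfolding pairwise_def disjnt_def by blast

section \<open>Height as the order along a segment\<close>

lemma in_closed_segment_h:
  "x \<in> closed_segment a b \<longleftrightarrow> (\<exists>r. 0 \<le> r \<and> r \<le> 1 \<and> x = a + of_real r * (b - a) \<and> h x = h a + r * (h b - h a))"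
proof -
  have "(1 - r) *\<^sub>R a + r *\<^sub>R b = a + of_real r * (b - a)"
    "h (a + of_real r * (b - a)) = h a + r * (h b - h a)" for r
    by (simp_all add: h_def scaleR_conv_of_real algebra_simps)
  then show ?thesis unfolding in_segment by auto
qed

lemma h_inj_segment:
  assumes "h a \<noteq> h b" "x \<in> closed_segment a b" "y \<in> closed_segment a b" "h x = h y"
  shows "x = y"
proof -
  obtain r r' where "x = a + of_real r * (b - a)" "h x = h a + r * (h b - h a)"
    "y = a + of_real r' * (b - a)" "h y = h a + r' * (h b - h a)"
    using assms(2,3) unfolding in_closed_segment_h by blast
  then show ?thesis using assms(1,4) by simp
qed

text \<open>\<open>h\<close> is affine and injective on the segment, so betweenness turns into
  comparison of heights; the arguments about neighbours rest on this numerical order.\<close>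

lemma in_closed_segment_iff_h:
  assumes ab: "h a < h b" and x: "x \<in> closed_segment a b" and z: "z \<in> closed_segment a b" and y: "y \<in> closed_segment a b"
  shows "h x < h z \<Longrightarrow> y \<in> open_segment x z \<longleftrightarrow> h x < h y \<and> h y < h z"
proof -
  assume xz: "h x < h z"
  have sub: "closed_segment x z \<subseteq> closed_segment a b" using x z by (simp add: subset_closed_segment)
  have "y \<in> closed_segment x z \<longleftrightarrow> h x \<le> h y \<and> h y \<le> h z"
  proof
    assume "y \<in> closed_segment x z"
    then obtain r where "0 \<le> r" "r \<le> 1" "h y = h x + r * (h z - h x)" using in_closed_segment_h by blast
    then show "h x \<le> h y \<and> h y \<le> h z"
      using xz mult_left_le_one_le[of "h z - h x" r] mult_nonneg_nonneg[of r "h z - h x"] by linarith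
  next
    assume *: "h x \<le> h y \<and> h y \<le> h z"
    define r where "r = (h y - h x) / (h z - h x)"
    have r: "0 \<le> r" "r \<le> 1" using * xz by (auto simp: r_def)
    define w where "w = x + of_real r * (z - x)"
    have hw: "h w = h x + r * (h z - h x)" by (simp add: w_def h_def algebra_simps)
    also have "\<dots> = h y" using xz by (simp add: r_def)
    finally have "h w = h y" .
    moreover have w: "w \<in> closed_segment x z"
      using r hw unfolding in_closed_segment_h by (intro exI[of _ r]) (simp add: w_def)
    ultimately have "w = y" using h_inj_segment[of a b w y] ab y sub by auto
    with w show "y \<in> closed_segment x z" by simp
  qed
  moreover have "h y = h x \<longleftrightarrow> y = x" "h y = h z \<longleftrightarrow> y = z"
    using h_inj_segment[of a b] ab x y z by auto
  ultimately show ?thesis by (auto simp: open_segment_def)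
qed

lemma V_closure: "V = (\<Union>s\<in>L. closure s - s)"
  using L_segment by (rule vertices_eq)

lemma segment_ends:
  assumes "s \<in> L"
  obtains a b where "s = open_segment a b" "a \<in> V" "b \<in> V" "h a < h b" "closure s = closed_segment a b"
proof -
  obtain a b where ab: "a \<noteq> b" "s = open_segment a b" using L_segment[OF assms] by blast
  then have s: "open_segment a b \<in> L" "open_segment b a \<in> L" using assms open_segment_commute by metis+
  then have V: "a \<in> V" "b \<in> V" using ab(1) unfolding vertices_def by auto
  consider "h a < h b" | "h b < h a" using inj_h[OF V] ab by linarith
  then show ?thesis
  proof cases
    case 1 then show ?thesis using that[of a b] ab V by simp
  next
    case 2 then show ?thesis using that[of b a] ab V by (simp add: open_segment_commute closed_segment_commute)
  qed
qed

lemma finite_V: "finite V"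
  using t_graph by (rule finite_vertices)

lemma L_subset_closure: "closure s \<subseteq> s \<union> V" if "s \<in> L"
  using that unfolding V_closure by blast

lemma R_subset_V: "R \<subseteq> V" and R_not_L: "R \<inter> \<Union>L = {}" and V_minus_R: "V - R \<subseteq> \<Union>L"
proof -
  have R: "R = {x. x islimpt \<Union>L \<and> x \<notin> \<Union>L}" using t_graph by (auto simp: t_graph_def)
  then show "R \<inter> \<Union>L = {}" by blast
  have cl: "closure (\<Union>L) = (\<Union>s\<in>L. closure s)" using finite_L by (rule closure_finite_Union)
  show "R \<subseteq> V"
  proof
    fix x assume "x \<in> R"
    then have "x \<in> closure (\<Union>L)" "x \<notin> \<Union>L" using R by (auto simp: closure_def)
    then show "x \<in> V" unfolding cl using L_subset_closure by blast
  qed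
  show "V - R \<subseteq> \<Union>L"
  proof
    fix x assume x: "x \<in> V - R"
    then obtain s where "s \<in> L" "x \<in> closure s" unfolding V_closure by blast
    then have "x \<in> closure (\<Union>L)" unfolding cl by blast
    then show "x \<in> \<Union>L" using x R by (auto simp: closure_def)
  qed
qed

text \<open>These are the non-root vertices, see \<open>N_eq\<close>.\<close>

definition N :: "complex set" where "N = V \<inter> \<Union>L"

lemma N_eq: "N = V - R"
  using R_not_L V_minus_R by (auto simp: N_def)

lemma V_eq: "V = N \<union> R" using R_subset_V by (auto simp: N_eq)

lemma finite_N: "finite N" using finite_V by (simp add: N_def)

definition seg :: "complex \<Rightarrow> complex set" where "seg v = (THE s. s \<in> L \<and> v \<in> s)"

lemma seg_eqI: "s \<in> L \<Longrightarrow> v \<in> s \<Longrightarrow> seg v = s"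
  unfolding seg_def by (rule the_equality) (simp, metis L_unique)

lemma seg:
  assumes "v \<in> N"
  shows "seg v \<in> L" "v \<in> seg v" "v \<in> V"
proof -
  obtain s where "s \<in> L" "v \<in> s" using assms by (auto simp: N_def)
  then show "seg v \<in> L" "v \<in> seg v" using seg_eqI[of s v] by simp_all
qed (use assms in \<open>simp add: N_def\<close>)

lemma consecutive_commute: "consecutive L s u w \<longleftrightarrow> consecutive L s w u"
  by (auto simp: consecutive_def open_segment_commute)

lemma consecutive_iff:
  assumes "s \<in> L" "h u < h w"
  shows "consecutive L s u w \<longleftrightarrow> u \<in> V \<inter> closure s \<and> w \<in> V \<inter> closure s \<and>
    (\<forall>x\<in>V \<inter> closure s. \<not> (h u < h x \<and> h x < h w))"
proof -
  obtain a b where ab: "s = open_segment a b" "a \<in> V" "b \<in> V" "h a < h b" "closure s = closed_segment a b"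
    using segment_ends[OF assms(1)] .
  have neq: "u \<noteq> w" using assms by auto
  show ?thesis
  proof
    assume c: "consecutive L s u w"
    have "closure (open_segment u w) \<subseteq> closure s" using c by (intro closure_mono) (simp add: consecutive_def)
    then have uw: "u \<in> closed_segment a b" "w \<in> closed_segment a b" using neq ab by auto
    then show "u \<in> V \<inter> closure s \<and> w \<in> V \<inter> closure s \<and> (\<forall>x\<in>V \<inter> closure s. \<not> (h u < h x \<and> h x < h w))"
      using c ab in_closed_segment_iff_h[OF ab(4) uw _ assms(2)] unfolding consecutive_def by blast
  next
    assume *: "u \<in> V \<inter> closure s \<and> w \<in> V \<inter> closure s \<and> (\<forall>x\<in>V \<inter> closure s. \<not> (h u < h x \<and> h x < h w))"
    then have uw: "u \<in> closed_segment a b" "w \<in> closed_segment a b" using ab by auto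
    have aba: "a \<in> closed_segment a b" "b \<in> closed_segment a b" by auto
    have sub: "open_segment u w \<subseteq> s"
    proof
      fix y assume y: "y \<in> open_segment u w"
      then have yc: "y \<in> closed_segment a b"
        using uw by (meson convex_closed_segment convex_contains_open_segment subsetD)
      have "h u < h y" "h y < h w" using in_closed_segment_iff_h[OF ab(4) uw yc assms(2)] y by auto
      moreover have "h a \<le> h u" "h w \<le> h b" using uw ab(4) by (auto simp: in_closed_segment_h mult_left_le_one_le) (smt (verit) mult_left_le_one_le)
      ultimately show "y \<in> s" using ab(1) in_closed_segment_iff_h[OF ab(4) aba yc ab(4)] by auto
    qed
    moreover have "open_segment u w \<inter> V = {}"
    proof -
      have False if "x \<in> open_segment u w" "x \<in> V" for x
      proof -
        have "x \<in> closure s" using sub that closure_subset by blast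
        then show False using that * in_closed_segment_iff_h[OF ab(4) uw _ assms(2), of x] ab by auto
      qed
      then show ?thesis by blast
    qed
    ultimately show "consecutive L s u w" using * neq by (auto simp: consecutive_def)
  qed
qed

lemma consecutive_neq: "consecutive L s u w \<Longrightarrow> h u \<noteq> h w"
  using inj_h by (auto simp: consecutive_def)

lemma consecutive_closure:
  assumes "s \<in> L" "consecutive L s u w"
  shows "u \<in> V \<inter> closure s \<and> w \<in> V \<inter> closure s"
proof (cases "h u < h w")
  case False
  then have "h w < h u" using consecutive_neq[OF assms(2)] by linarith
  then show ?thesis using assms consecutive_iff[OF assms(1), of w u] consecutive_commute[of s u w] by blast
qed (use assms consecutive_iff in blast)

text \<open>The neighbour is the lowest of the finitely many vertices above \<open>u\<close> on the
  closed segment; \<open>w0\<close> guarantees that there is one.\<close>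

lemma upper_neighbour:
  assumes s: "s \<in> L" and u: "u \<in> V \<inter> closure s" and w0: "w0 \<in> V \<inter> closure s" "h u < h w0"
  shows "\<exists>!w. consecutive L s u w \<and> h u < h w"
proof -
  let ?A = "{w \<in> V \<inter> closure s. h u < h w}"
  have "finite ?A" "?A \<noteq> {}" using finite_V w0 by auto
  then obtain w where w: "w \<in> ?A" "\<And>x. x \<in> ?A \<Longrightarrow> h w \<le> h x"
    using arg_min_if_finite[of ?A h] by (metis (no_types, lifting) not_less)
  have "\<not> (h u < h x \<and> h x < h w)" if "x \<in> V \<inter> closure s" for x using w(2)[of x] that by auto
  then have cw: "consecutive L s u w" using w u by (subst consecutive_iff[OF s]) auto
  have "w' = w" if "consecutive L s u w'" "h u < h w'" for w'
  proof -
    have "w' \<in> ?A" using that consecutive_closure[OF s that(1)] by auto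
    then have "h w = h w'"
      using w that consecutive_iff[OF s that(2)] by force
    then show ?thesis using inj_h[of w w'] w \<open>w' \<in> ?A\<close> by auto
  qed
  then show ?thesis using cw w by (metis (no_types, lifting) mem_Collect_eq)
qed

lemma lower_neighbour:
  assumes s: "s \<in> L" and u: "u \<in> V \<inter> closure s" and w0: "w0 \<in> V \<inter> closure s" "h w0 < h u"
  shows "\<exists>!w. consecutive L s u w \<and> h w < h u"
proof -
  let ?A = "{w \<in> V \<inter> closure s. h w < h u}"
  have "finite ?A" "?A \<noteq> {}" using finite_V w0 by auto
  then obtain w where w: "w \<in> ?A" "\<And>x. x \<in> ?A \<Longrightarrow> h x \<le> h w"
    using arg_min_if_finite[of ?A "\<lambda>x. - h x"] by (metis (no_types, lifting) not_less neg_less_iff_less)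
  have "\<not> (h w < h x \<and> h x < h u)" if "x \<in> V \<inter> closure s" for x using w(2)[of x] that by auto
  then have cw: "consecutive L s u w" using w u by (subst consecutive_commute, subst consecutive_iff[OF s]) auto
  have "w' = w" if "consecutive L s u w'" "h w' < h u" for w'
  proof -
    have "w' \<in> ?A" using that consecutive_closure[OF s that(1)] by auto
    then have "h w = h w'"
      using w that consecutive_iff[OF s that(2)] consecutive_commute by force
    then show ?thesis using inj_h[of w w'] w \<open>w' \<in> ?A\<close> by auto
  qed
  then show ?thesis using cw w by (metis (no_types, lifting) mem_Collect_eq)
qed

definition up :: "complex \<Rightarrow> complex" where "up v = (THE w. consecutive L (seg v) v w \<and> h v < h w)"
definition dn :: "complex \<Rightarrow> complex" where "dn v = (THE w. consecutive L (seg v) v w \<and> h w < h v)"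

lemma between_ends:
  assumes "v \<in> N"
  obtains a b where "seg v = open_segment a b" "a \<in> V \<inter> closure (seg v)" "b \<in> V \<inter> closure (seg v)"
    "h a < h v" "h v < h b"
proof -
  obtain a b where ab: "seg v = open_segment a b" "a \<in> V" "b \<in> V" "h a < h b" "closure (seg v) = closed_segment a b"
    using segment_ends[OF seg(1)[OF assms]] .
  have v: "v \<in> open_segment a b" using seg(2)[OF assms] ab(1) by simp
  then have "v \<in> closed_segment a b" using segment_open_subset_closed by blast
  with v have "h a < h v" "h v < h b"
    using in_closed_segment_iff_h[OF ab(4) _ _ _ ab(4), of v] by simp_all
  then show ?thesis using that[of a b] ab by simp
qed

lemma N_closure: "v \<in> N \<Longrightarrow> v \<in> V \<inter> closure (seg v)"
  using seg[of v] closure_subset[of "seg v"] by blast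

lemma up: "consecutive L (seg v) v (up v)" "h v < h (up v)"
  and dn: "consecutive L (seg v) v (dn v)" "h (dn v) < h v" if v: "v \<in> N"
proof -
  obtain a b where ab: "a \<in> V \<inter> closure (seg v)" "b \<in> V \<inter> closure (seg v)" "h a < h v" "h v < h b"
    by (rule between_ends[OF v])
  show "consecutive L (seg v) v (up v)" "h v < h (up v)"
    using theI'[OF upper_neighbour[OF seg(1)[OF v] N_closure[OF v] ab(2,4)]] unfolding up_def by blast+
  show "consecutive L (seg v) v (dn v)" "h (dn v) < h v"
    using theI'[OF lower_neighbour[OF seg(1)[OF v] N_closure[OF v] ab(1,3)]] unfolding dn_def by blast+
qed

lemma consecutive_up_dn:
  assumes v: "v \<in> N" and c: "consecutive L (seg v) v w"
  shows "w = up v \<or> w = dn v"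
proof -
  have w: "w \<in> V \<inter> closure (seg v)" using consecutive_closure[OF seg(1)[OF v] c] by blast
  consider "h v < h w" | "h w < h v" using consecutive_neq[OF c] by linarith
  then show ?thesis
  proof cases
    case 1
    then show ?thesis using upper_neighbour[OF seg(1)[OF v] N_closure[OF v] w 1] up[OF v] c by blast
  next
    case 2
    then show ?thesis using lower_neighbour[OF seg(1)[OF v] N_closure[OF v] w 2] dn[OF v] c by blast
  qed
qed

lemma up_dn_neq: "v \<in> N \<Longrightarrow> up v \<noteq> dn v"
  using up(2)[of v] dn(2)[of v] by auto

lemma arcs_iff: "(v, w) \<in> arcs L \<longleftrightarrow> v \<in> N \<and> (w = up v \<or> w = dn v)"
proof
  assume "(v, w) \<in> arcs L"
  then obtain s where s: "s \<in> L" "v \<in> s" "consecutive L s v w" by (auto simp: arcs_def)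
  then have "v \<in> N" "seg v = s" by (auto simp: N_def consecutive_def seg_eqI)
  then show "v \<in> N \<and> (w = up v \<or> w = dn v)" using consecutive_up_dn s by auto
next
  assume "v \<in> N \<and> (w = up v \<or> w = dn v)"
  then show "(v, w) \<in> arcs L" using seg[of v] up(1)[of v] dn(1)[of v] unfolding arcs_def by blast
qed

section \<open>Choices of one arc per vertex\<close>

lemma h_bounds:
  assumes "h a < h b" "x \<in> closed_segment a b"
  shows "h a \<le> h x" "h x \<le> h b"
proof -
  obtain r where "0 \<le> r" "r \<le> 1" "h x = h a + r * (h b - h a)"
    using assms(2) unfolding in_closed_segment_h by blast
  then show "h a \<le> h x" "h x \<le> h b"
    using assms(1) mult_left_le_one_le[of "h b - h a" r] mult_nonneg_nonneg[of r "h b - h a"]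
    by linarith+
qed

lemma edgeI: "s \<in> L \<Longrightarrow> consecutive L s u w \<Longrightarrow> open_segment u w \<in> E"
  unfolding edges_def by blast

lemma edgeE:
  assumes "e \<in> E"
  obtains s u w where "s \<in> L" "consecutive L s u w" "h u < h w" "e = open_segment u w" "e \<subseteq> s"
proof -
  obtain s u w where *: "s \<in> L" "consecutive L s u w" "e = open_segment u w"
    using assms unfolding edges_def by blast
  have sub: "e \<subseteq> s" using * by (simp add: consecutive_def)
  show ?thesis
  proof (cases "h u < h w")
    case True
    then show ?thesis using that * sub by blast
  next
    case False
    then have "h w < h u" using consecutive_neq[OF *(2)] by linarith
    then show ?thesis
      using that[of s w u] * sub consecutive_commute[of s u w] open_segment_commute[of u w] by simp
  qed
qed

lemma edge_V: "e \<in> E \<Longrightarrow> e \<inter> V = {}"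
  unfolding edges_def consecutive_def by blast

lemma edge_nonempty: "e \<in> E \<Longrightarrow> e \<noteq> {}"
  by (elim edgeE) auto

lemma edge_L: "e \<in> E \<Longrightarrow> \<exists>s\<in>L. e \<subseteq> s"
  by (elim edgeE) blast

lemma edge_L_unique: "e \<in> E \<Longrightarrow> s \<in> L \<Longrightarrow> s' \<in> L \<Longrightarrow> e \<subseteq> s \<Longrightarrow> e \<subseteq> s' \<Longrightarrow> s = s'"
  using edge_nonempty L_unique by blast

lemma finite_E: "finite E"
proof (rule finite_subset)
  show "E \<subseteq> (\<lambda>(u, w). open_segment u w) ` (V \<times> V)"
    unfolding edges_def consecutive_def by auto
qed (use finite_V in simp)

text \<open>Overlapping edges lie on the same segment, and neither has a vertex strictly between its
  ends in height; so their lower ends are level, as are their upper ends, and both pairs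
  coincide.\<close>

lemma disjoint_E: "disjoint E"
  unfolding pairwise_def disjnt_def
proof (intro ballI impI, rule ccontr)
  fix e e' assume e: "e \<in> E" "e' \<in> E" "e \<noteq> e'" "e \<inter> e' \<noteq> {}"
  obtain s u w where 1: "s \<in> L" "consecutive L s u w" "h u < h w" "e = open_segment u w" "e \<subseteq> s"
    using edgeE[OF e(1)] .
  obtain s' u' w' where 2: "s' \<in> L" "consecutive L s' u' w'" "h u' < h w'" "e' = open_segment u' w'" "e' \<subseteq> s'"
    using edgeE[OF e(2)] .
  obtain x where x: "x \<in> e" "x \<in> e'" using e(4) by blast
  then have s: "s' = s" using L_unique[OF 1(1) 2(1), of x] 1(5) 2(5) by blast
  obtain a b where ab: "s = open_segment a b" "h a < h b" "closure s = closed_segment a b"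
    using segment_ends[OF 1(1)] by metis
  have c: "u \<in> V \<inter> closure s" "w \<in> V \<inter> closure s" "u' \<in> V \<inter> closure s" "w' \<in> V \<inter> closure s"
    using consecutive_closure[OF 1(1,2)] consecutive_closure[OF 2(1,2)] s by auto
  have xs: "x \<in> closed_segment a b" using x 1(5) closure_subset[of s] ab(3) by blast
  have hx: "h u < h x" "h x < h w" "h u' < h x" "h x < h w'"
    using in_closed_segment_iff_h[OF ab(2) _ _ xs, of u w] in_closed_segment_iff_h[OF ab(2) _ _ xs, of u' w']
      c ab(3) x 1(3,4) 2(3,4) by auto
  have "\<not> (h u < h u' \<and> h u' < h w)" "\<not> (h u < h w' \<and> h w' < h w)"
    using consecutive_iff[OF 1(1,3)] 1(2) c by blast+
  moreover have "\<not> (h u' < h u \<and> h u < h w')" "\<not> (h u' < h w \<and> h w < h w')"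
    using consecutive_iff[OF 2(1,3)] 2(2) c unfolding s by blast+
  ultimately have "h u = h u'" "h w = h w'" using hx by linarith+
  then have "u = u'" "w = w'" using inj_h c by auto
  then show False using e(3) 1(4) 2(4) by simp
qed

lemma up_edge: "open_segment v (up v) \<in> E" "open_segment v (up v) \<subseteq> seg v"
  and dn_edge: "open_segment v (dn v) \<in> E" "open_segment v (dn v) \<subseteq> seg v"
  and up_V: "up v \<in> V" and dn_V: "dn v \<in> V" if "v \<in> N"
  using up(1)[OF that] dn(1)[OF that] seg(1)[OF that] edgeI unfolding consecutive_def by auto

definition edges_on :: "complex set \<Rightarrow> complex set set" where
  "edges_on s = {e \<in> E. e \<subseteq> s}"

lemma V_Int_s: "s \<in> L \<Longrightarrow> V \<inter> s = N \<inter> s"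
  by (auto simp: N_def)

lemma card_edges_on:
  assumes s: "s \<in> L"
  shows "card (edges_on s) = card (N \<inter> s) + 1"
proof -
  obtain a b where ab: "s = open_segment a b" "a \<in> V" "b \<in> V" "h a < h b" "closure s = closed_segment a b"
    using segment_ends[OF s] .
  have "a \<notin> s" "b \<notin> s" using ab(1) by (simp_all add: open_segment_def)
  define nx where "nx u = (THE w. consecutive L s u w \<and> h u < h w)" for u
  have nx1: "\<exists>!w. consecutive L s u w \<and> h u < h w" if u: "u \<in> insert a (N \<inter> s)" for u
  proof -
    have us: "u \<in> V \<inter> closure s" using u ab closure_subset[of s] by (auto simp: N_def)
    have "u \<noteq> b" using u \<open>b \<notin> s\<close> ab(4) by auto
    then have "h u \<noteq> h b" using inj_h ab(3) us by blast
    moreover have "h u \<le> h b" using h_bounds[OF ab(4)] us ab(5) by auto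
    ultimately have "h u < h b" by simp
    then show ?thesis using upper_neighbour[OF s us, of b] ab by auto
  qed
  note nx = theI'[OF nx1, folded nx_def]
  have "bij_betw (\<lambda>u. open_segment u (nx u)) (insert a (N \<inter> s)) (edges_on s)"
    unfolding bij_betw_def
  proof
    show "inj_on (\<lambda>u. open_segment u (nx u)) (insert a (N \<inter> s))"
    proof (rule inj_onI)
      fix u v assume uv: "u \<in> insert a (N \<inter> s)" "v \<in> insert a (N \<inter> s)" "open_segment u (nx u) = open_segment v (nx v)"
      have "h u < h (nx u)" "h v < h (nx v)" using nx uv by blast+
      moreover from this have "{u, nx u} = {v, nx v}" using uv(3) by auto
      ultimately show "u = v" by (auto simp: doubleton_eq_iff)
    qed
    show "(\<lambda>u. open_segment u (nx u)) ` insert a (N \<inter> s) = edges_on s"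
    proof (intro subset_antisym subsetI)
      fix e assume "e \<in> (\<lambda>u. open_segment u (nx u)) ` insert a (N \<inter> s)"
      then obtain u where u: "u \<in> insert a (N \<inter> s)" "e = open_segment u (nx u)" by blast
      then have "consecutive L s u (nx u)" using nx by blast
      then show "e \<in> edges_on s" using edgeI[OF s] u(2) by (simp add: edges_on_def consecutive_def)
    next
      fix e assume e: "e \<in> edges_on s"
      then have eE: "e \<in> E" "e \<subseteq> s" by (simp_all add: edges_on_def)
      obtain s' u w where c: "s' \<in> L" "consecutive L s' u w" "h u < h w" "e = open_segment u w" "e \<subseteq> s'"
        using edgeE[OF eE(1)] .
      then have "s' = s" using edge_L_unique[OF eE(1) s c(1)] eE(2) by simp
      then have cs: "consecutive L s u w" using c by simp
      have uw: "u \<in> V \<inter> closure s" "w \<in> V \<inter> closure s" using consecutive_closure[OF s cs] by auto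
      then have "h w \<le> h b" using h_bounds[OF ab(4)] ab(5) by auto
      then have "u \<noteq> b" using c(3) by auto
      moreover have "u = a \<or> u = b \<or> u \<in> s" using uw ab by (auto simp: closed_segment_eq_open)
      ultimately have u: "u \<in> insert a (N \<inter> s)" using uw(1) V_Int_s[OF s] by blast
      moreover have "nx u = w" using nx1[OF u] nx[OF u] cs c(3) by blast
      ultimately show "e \<in> (\<lambda>u. open_segment u (nx u)) ` insert a (N \<inter> s)" using c(4) by blast
    qed
  qed
  then have "card (edges_on s) = card (insert a (N \<inter> s))" by (metis bij_betw_same_card)
  also have "\<dots> = card (N \<inter> s) + 1" using finite_N \<open>a \<notin> s\<close> by simp
  finally show ?thesis .
qed

text \<open>A point that is no vertex lies between the highest vertex below it on its segment and
  the upper neighbour of that vertex.\<close>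

lemma Union_L_eq: "\<Union>L = N \<union> \<Union>E"
proof (intro subset_antisym subsetI)
  fix x assume "x \<in> \<Union>L"
  then obtain s where s: "s \<in> L" "x \<in> s" by blast
  show "x \<in> N \<union> \<Union>E"
  proof (cases "x \<in> V")
    case False
    obtain a b where ab: "s = open_segment a b" "a \<in> V" "b \<in> V" "h a < h b" "closure s = closed_segment a b"
      using segment_ends[OF s(1)] .
    have ac: "a \<in> V \<inter> closure s" "b \<in> V \<inter> closure s" using ab by auto
    have xc: "x \<in> closed_segment a b" using s(2) closure_subset[of s] ab(5) by blast
    have hx: "h a < h x" "h x < h b"
      using in_closed_segment_iff_h[OF ab(4) _ _ xc ab(4)] s(2) ab(1) by simp_all
    let ?A = "{u \<in> V \<inter> closure s. h u < h x}"
    have "finite ?A" "?A \<noteq> {}" using finite_V ac hx by auto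
    then obtain u where u: "u \<in> ?A" "\<And>y. y \<in> ?A \<Longrightarrow> h y \<le> h u"
      using arg_min_if_finite[of ?A "\<lambda>x. - h x"] by (metis (no_types, lifting) not_less neg_less_iff_less)
    then have "h u < h b" using hx by auto
    then obtain w where w: "consecutive L s u w" "h u < h w"
      using upper_neighbour[OF s(1) _ ac(2), of u] u(1) by blast
    have wc: "w \<in> V \<inter> closure s" using consecutive_closure[OF s(1) w(1)] by blast
    have "w \<notin> ?A" using u(2)[of w] w(2) by auto
    then have "h x \<le> h w" using wc by auto
    moreover have "h x \<noteq> h w"
      using h_inj_segment[of a b x w] ab(4,5) xc wc False by auto
    ultimately have "x \<in> open_segment u w"
      using in_closed_segment_iff_h[OF ab(4) _ _ xc w(2)] u(1) wc ab(5) by auto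
    then show ?thesis using edgeI[OF s(1) w(1)] by blast
  qed (use s in \<open>auto simp: N_def\<close>)
next
  fix x assume "x \<in> N \<union> \<Union>E"
  then show "x \<in> \<Union>L" using edge_L by (auto simp: N_def)
qed

definition orientation :: "(complex \<Rightarrow> complex) \<Rightarrow> bool" where
  "orientation p \<longleftrightarrow> (\<forall>v\<in>N. p v = up v \<or> p v = dn v) \<and> (\<forall>v\<in>N. p v \<in> N \<longrightarrow> p (p v) \<noteq> v)"

definition used_edges :: "(complex \<Rightarrow> complex) \<Rightarrow> complex set set" where
  "used_edges p = (\<lambda>v. open_segment v (p v)) ` N"

lemma orientation_edge:
  assumes "orientation p" "v \<in> N"
  shows "open_segment v (p v) \<in> E" "open_segment v (p v) \<subseteq> seg v" "p v \<in> V" "p v \<noteq> v"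
  using assms up_edge[of v] dn_edge[of v] up_V[of v] dn_V[of v] up(2)[of v] dn(2)[of v]
  unfolding orientation_def by (metis less_irrefl)+

lemma used_edges_subset: "orientation p \<Longrightarrow> used_edges p \<subseteq> E"
  using orientation_edge by (auto simp: used_edges_def)

lemma used_edges_inj:
  assumes p: "orientation p"
  shows "inj_on (\<lambda>v. open_segment v (p v)) N"
proof (rule inj_onI)
  fix v w assume vw: "v \<in> N" "w \<in> N" "open_segment v (p v) = open_segment w (p w)"
  then have "{v, p v} = {w, p w}"
    using orientation_edge(4)[OF p] by (metis open_segment_eq)
  then show "v = w" using p vw(1,2) unfolding orientation_def by (auto simp: doubleton_eq_iff)
qed

text \<open>The used edges on \<open>s\<close> are exactly those of the vertices interior to
  \<open>s\<close>, all distinct, and \<open>s\<close> has one edge more than such vertices.\<close>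

lemma unused_edge:
  assumes p: "orientation p" and s: "s \<in> L"
  shows "\<exists>e. edges_on s - used_edges p = {e}"
proof -
  have eq: "edges_on s \<inter> used_edges p = (\<lambda>v. open_segment v (p v)) ` (N \<inter> s)"
  proof (intro subset_antisym subsetI)
    fix e assume e: "e \<in> edges_on s \<inter> used_edges p"
    then obtain v where v: "v \<in> N" "e = open_segment v (p v)" by (auto simp: used_edges_def)
    then have "seg v = s"
      using edge_L_unique[of e "seg v" s] orientation_edge[OF p v(1)] seg[OF v(1)] s e
      by (auto simp: edges_on_def)
    then show "e \<in> (\<lambda>v. open_segment v (p v)) ` (N \<inter> s)" using v seg(2)[OF v(1)] by blast
  next
    fix e assume "e \<in> (\<lambda>v. open_segment v (p v)) ` (N \<inter> s)"
    then obtain v where v: "v \<in> N" "v \<in> s" "e = open_segment v (p v)" by blast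
    then show "e \<in> edges_on s \<inter> used_edges p"
      using orientation_edge[OF p v(1)] seg_eqI[OF s v(2)] by (simp add: edges_on_def used_edges_def)
  qed
  have "card (edges_on s \<inter> used_edges p) = card (N \<inter> s)"
    unfolding eq by (rule card_image) (rule inj_on_subset[OF used_edges_inj[OF p]], simp)
  moreover have "finite (edges_on s)" using finite_E by (simp add: edges_on_def)
  ultimately have "card (edges_on s - used_edges p) = 1"
    using card_edges_on[OF s] by (simp add: card_Diff_subset_Int)
  then show ?thesis by (simp add: card_1_singleton_iff)
qed

lemma unused_edges_eq:
  assumes p: "orientation p" and T: "\<And>s. s \<in> L \<Longrightarrow> T s \<in> edges_on s - used_edges p"
  shows "E - used_edges p = T ` L"
proof (intro subset_antisym subsetI)
  fix e assume e: "e \<in> E - used_edges p"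
  then obtain s where s: "s \<in> L" "e \<subseteq> s" using edge_L by blast
  then have "e \<in> edges_on s - used_edges p" using e by (simp add: edges_on_def)
  with T[OF s(1)] unused_edge[OF p s(1)] have "e = T s" by auto
  then show "e \<in> T ` L" using s(1) by blast
qed (use T in \<open>auto simp: edges_on_def\<close>)

text \<open>Vertices above the chosen edge of their segment point up, the others point down. So no
  arc runs along a chosen edge, and a vertex reached by moving away from it continues in the same
  direction on that segment.\<close>

lemma orientation_away:
  assumes T: "\<And>s. s \<in> L \<Longrightarrow> T s \<in> edges_on s"
  obtains p where "orientation p" "E - used_edges p = T ` L"
proof -
  define p where "p v = (if \<forall>x\<in>T (seg v). h x < h v then up v else dn v)" for v
  have "p (p v) \<noteq> v" if v: "v \<in> N" "p v \<in> N" for v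
  proof
    assume eq: "p (p v) = v"
    define w where "w = p v"
    have w: "w \<in> N" "p w = v" using v eq by (simp_all add: w_def)
    have pp: "p x = up x \<or> p x = dn x" for x by (simp add: p_def)
    have "open_segment v w \<in> E" "open_segment v w \<subseteq> seg v"
      using pp[of v] up_edge[OF v(1)] dn_edge[OF v(1)] by (auto simp: w_def)
    moreover have "open_segment w v \<subseteq> seg w"
      using pp[of w] up_edge[OF w(1)] dn_edge[OF w(1)] w(2) by auto
    ultimately have same: "seg w = seg v"
      using edge_L_unique seg(1)[OF v(1)] seg(1)[OF w(1)] by (metis open_segment_commute)
    show False
    proof (cases "\<forall>x\<in>T (seg v). h x < h v")
      case True
      then have "h v < h w" using up(2)[OF v(1)] by (simp add: p_def w_def)
      then have "p w = up w" using True unfolding p_def same by fastforce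
      then show False using up(2)[OF w(1)] \<open>h v < h w\<close> w(2) by simp
    next
      case False
      then have "p v = dn v" unfolding p_def by (rule if_not_P)
      then have "h w < h v" using dn(2)[OF v(1)] by (simp add: w_def)
      moreover have "\<not> (\<forall>x\<in>T (seg v). h x < h w)" using False \<open>h w < h v\<close> by fastforce
      then have "p w = dn w" unfolding p_def same by (rule if_not_P)
      ultimately show False using dn(2)[OF w(1)] w(2) by simp
    qed
  qed
  then have p: "orientation p" by (auto simp: orientation_def p_def)
  have "T s \<notin> used_edges p" if s: "s \<in> L" for s
  proof
    assume "T s \<in> used_edges p"
    then obtain v where v: "v \<in> N" "T s = open_segment v (p v)" by (auto simp: used_edges_def)
    then have sv: "seg v = s"
      using T[OF s] edge_L_unique[of "T s" "seg v" s] orientation_edge[OF p v(1)] seg[OF v(1)] s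
      by (auto simp: edges_on_def)
    obtain a b where ab: "s = open_segment a b" "h a < h b" "closure s = closed_segment a b"
      using segment_ends[OF s] by metis
    have pc: "consecutive L s v (p v)" using up(1)[OF v(1)] dn(1)[OF v(1)] sv by (simp add: p_def)
    have c: "v \<in> closed_segment a b" "p v \<in> closed_segment a b"
      using consecutive_closure[OF s pc] ab by auto
    have mid: "x \<in> closed_segment a b" if "x \<in> T s" for x
      using that T[OF s] closure_subset[of s] ab(3) by (auto simp: edges_on_def)
    obtain x where x: "x \<in> T s" using edge_nonempty T[OF s] by (auto simp: edges_on_def)
    show False
    proof (cases "\<forall>x\<in>T (seg v). h x < h v")
      case True
      then have "p v = up v" "h x < h v" using x sv by (auto simp: p_def)
      then show False
        using in_closed_segment_iff_h[OF ab(2) c mid[OF x]] up(2)[OF v(1)] x v(2) by auto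
    next
      case False
      then have pv: "p v = dn v" unfolding p_def by (rule if_not_P)
      obtain y where y: "y \<in> T s" "\<not> h y < h v" using False sv by blast
      have "y \<in> open_segment (p v) v" using y v(2) by (simp add: open_segment_commute)
      then show False
        using in_closed_segment_iff_h[OF ab(2) c(2,1) mid[OF y(1)]] dn(2)[OF v(1)] pv y(2) by simp
    qed
  qed
  then have "E - used_edges p = T ` L" using T by (intro unused_edges_eq[OF p]) auto
  with p that show ?thesis by blast
qed

definition arrows :: "(complex \<Rightarrow> complex) \<Rightarrow> (complex \<times> complex) set" where
  "arrows p = {(v, p v) |v. v \<in> N}"

lemma orientation_if_acyclic:
  assumes "\<And>v. v \<in> N \<Longrightarrow> p v = up v \<or> p v = dn v" "acyclic (arrows p)"
  shows "orientation p"
proof -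
  have "p (p v) \<noteq> v" if "v \<in> N" "p v \<in> N" for v
  proof
    assume "p (p v) = v"
    then have "(v, p v) \<in> arrows p" "(p v, v) \<in> arrows p" using that unfolding arrows_def by force+
    then show False using assms(2) unfolding acyclic_def by (meson r_into_trancl trancl_trans)
  qed
  then show ?thesis using assms(1) by (simp add: orientation_def)
qed

lemma acyclic_up: "acyclic (arrows up)"
proof -
  have "h x < h y" if "(x, y) \<in> (arrows up)\<^sup>+" for x y
    using that
  proof (induction rule: trancl_induct)
    case (base y)
    then show ?case using up(2) by (auto simp: arrows_def)
  next
    case (step y z)
    then have "h y < h z" using up(2) by (auto simp: arrows_def)
    then show ?case using step by simp
  qed
  then show ?thesis unfolding acyclic_def by blast
qed

section \<open>Forests and their weights\<close>

lemma finite_arrows: "finite (arrows p)"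
  using finite_N by (simp add: arrows_def)

lemma arrows_iff: "(x, y) \<in> arrows p \<longleftrightarrow> x \<in> N \<and> y = p x"
  by (auto simp: arrows_def)

lemma wf_arrows: "acyclic (arrows p) \<Longrightarrow> wf ((arrows p)\<inverse>)"
  by (rule finite_acyclic_wf_converse[OF finite_arrows])

lemma reaches_root:
  assumes p: "orientation p" "acyclic (arrows p)" and v: "v \<in> V"
  shows "\<exists>r\<in>R. (v, r) \<in> (arrows p)\<^sup>*"
  using v
proof (induction v rule: wf_induct_rule[OF wf_arrows[OF p(2)]])
  case (1 v)
  show ?case
  proof (cases "v \<in> R")
    case False
    then have v: "v \<in> N" using 1(2) N_eq by blast
    then have "(v, p v) \<in> arrows p" by (simp add: arrows_iff)
    then obtain r where "r \<in> R" "(p v, r) \<in> (arrows p)\<^sup>*"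
      using 1(1)[of "p v"] orientation_edge(3)[OF p(1) v] by auto
    then show ?thesis using \<open>(v, p v) \<in> arrows p\<close> by (meson converse_rtrancl_into_rtrancl)
  qed auto
qed

lemma root_final: "r \<in> R \<Longrightarrow> (r, x) \<in> (arrows p)\<^sup>* \<Longrightarrow> x = r"
  by (erule converse_rtranclE) (auto simp: arrows_iff N_eq)

text \<open>A vertex has at most one arrow out and a root has none, so the root that is reached does
  not change across an arrow in either direction. This yields uniqueness of the root in an
  undirected component.\<close>

lemma same_root:
  assumes "(v, x) \<in> (arrows p \<union> (arrows p)\<inverse>)\<^sup>*" "r \<in> R"
  shows "(v, r) \<in> (arrows p)\<^sup>* \<longleftrightarrow> (x, r) \<in> (arrows p)\<^sup>*"
proof -
  have step: "(y, r) \<in> (arrows p)\<^sup>* \<longleftrightarrow> (z, r) \<in> (arrows p)\<^sup>*" if yz: "(y, z) \<in> arrows p" for y z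
  proof
    assume "(y, r) \<in> (arrows p)\<^sup>*"
    moreover have "y \<noteq> r" using yz assms(2) by (auto simp: arrows_iff N_eq)
    ultimately obtain w where w: "(y, w) \<in> arrows p" "(w, r) \<in> (arrows p)\<^sup>*"
      by (meson converse_rtranclE)
    then have "w = z" using yz by (simp add: arrows_iff)
    with w show "(z, r) \<in> (arrows p)\<^sup>*" by simp
  qed (use yz in \<open>meson converse_rtrancl_into_rtrancl\<close>)
  show ?thesis using assms(1)
  proof (induction rule: rtrancl_induct)
    case (step y z)
    then show ?case using \<open>\<And>y z. (y, z) \<in> arrows p \<Longrightarrow> _ y z\<close> by blast
  qed simp
qed

lemma arrows_spanning_forest:
  assumes p: "orientation p" "acyclic (arrows p)"
  shows "arrows p \<in> spanning_forests L R"
  unfolding spanning_forests_def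
proof (intro CollectI conjI ballI)
  show "arrows p \<subseteq> arcs L"
    using p(1) unfolding orientation_def by (auto simp: arrows_def arcs_iff)
  show "acyclic (arrows p)" by (rule p)
  show "\<exists>!w. (v, w) \<in> arrows p" if "v \<in> V - R" for v
    using that by (auto simp: arrows_iff N_eq)
  fix v assume v: "v \<in> V"
  obtain r where r: "r \<in> R" "(v, r) \<in> (arrows p)\<^sup>*" using reaches_root[OF p v] by blast
  have "(v, r) \<in> (arrows p \<union> (arrows p)\<inverse>)\<^sup>*" using r(2) by (meson in_rtrancl_UnI)
  moreover have "r' = r" if "r' \<in> R" "(v, r') \<in> (arrows p \<union> (arrows p)\<inverse>)\<^sup>*" for r'
    using same_root[OF that(2) r(1)] r root_final[OF that(1)] by metis
  ultimately show "\<exists>!r. r \<in> R \<and> (v, r) \<in> (arrows p \<union> (arrows p)\<inverse>)\<^sup>*" using r(1) by blast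
qed

lemma spanning_forestE:
  assumes F: "F \<in> spanning_forests L R"
  obtains p where "orientation p" "acyclic (arrows p)" "F = arrows p"
proof -
  have sub: "F \<subseteq> arcs L" and ac: "acyclic F" and ex: "\<And>v. v \<in> N \<Longrightarrow> \<exists>!w. (v, w) \<in> F"
    using F unfolding spanning_forests_def N_eq by auto
  define p where "p v = (THE w. (v, w) \<in> F)" for v
  have pF: "(v, p v) \<in> F" if "v \<in> N" for v unfolding p_def by (rule theI'[OF ex[OF that]])
  have "F = arrows p"
  proof (intro subset_antisym subrelI)
    fix v w assume vw: "(v, w) \<in> F"
    then have v: "v \<in> N" using sub arcs_iff by blast
    then show "(v, w) \<in> arrows p" using ex[OF v] pF[OF v] vw by (auto simp: arrows_iff)
  qed (use pF in \<open>auto simp: arrows_iff\<close>)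
  moreover have "orientation p"
  proof (rule orientation_if_acyclic)
    show "p v = up v \<or> p v = dn v" if "v \<in> N" for v using pF[OF that] sub arcs_iff by blast
    show "acyclic (arrows p)" using ac calculation by simp
  qed
  ultimately show ?thesis using that ac by blast
qed

lemma used_edges_iff:
  assumes p: "orientation p"
  shows "open_segment x y \<in> used_edges p \<longleftrightarrow> x \<in> N \<and> y = p x \<or> y \<in> N \<and> x = p y"
proof
  assume "open_segment x y \<in> used_edges p"
  then obtain v where v: "v \<in> N" "open_segment x y = open_segment v (p v)" by (auto simp: used_edges_def)
  then have "{x, y} = {v, p v}" using orientation_edge(4)[OF p v(1)] by (metis open_segment_eq)
  then show "x \<in> N \<and> y = p x \<or> y \<in> N \<and> x = p y" using v(1) by (auto simp: doubleton_eq_iff)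
next
  assume "x \<in> N \<and> y = p x \<or> y \<in> N \<and> x = p y"
  then show "open_segment x y \<in> used_edges p"
    unfolding used_edges_def using open_segment_commute[of x y] by (elim disjE conjE) auto
qed

text \<open>Read from the root end: a root has no arrow out, so the last edge is the arrow of its
  first vertex. An earlier edge from \<open>u\<close> to \<open>v\<close> cannot be the arrow of
  \<open>v\<close>, which already leads on to the next vertex, and the path does not return.\<close>

lemma orient_forward:
  assumes p: "orientation p"
  shows "\<lbrakk>distinct (u # v # q); successively (\<lambda>x y. open_segment x y \<in> used_edges p) (u # v # q); last (v # q) \<in> R\<rbrakk>
    \<Longrightarrow> u \<in> N \<and> v = p u"
proof (induction q arbitrary: u v)
  case Nil
  then show ?case using used_edges_iff[OF p, of u v] N_eq by auto
next
  case (Cons w q)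
  have "v \<in> N \<and> w = p v" by (rule Cons.IH) (use Cons.prems in auto)
  then show ?case using used_edges_iff[OF p, of u v] Cons.prems(1,2) by auto
qed

text \<open>The path follows \<open>p\<close>. The clause on \<open>set q\<close> is carried for the
  induction: by acyclicity it keeps \<open>v\<close> off the rest of the path, which gives
  distinctness.\<close>

lemma path_to_root:
  assumes p: "orientation p" "acyclic (arrows p)" and v: "v \<in> V"
  shows "\<exists>q. distinct (v # q) \<and> successively (\<lambda>x y. open_segment x y \<in> used_edges p) (v # q) \<and>
    last (v # q) \<in> R \<and> set q \<subseteq> (arrows p)\<^sup>+ `` {v} \<and> (v \<in> N \<longrightarrow> q \<noteq> [] \<and> hd q = p v)"
  using v
proof (induction v rule: wf_induct_rule[OF wf_arrows[OF p(2)]])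
  case (1 v)
  show ?case
  proof (cases "v \<in> R")
    case True
    then show ?thesis using N_eq by (intro exI[of _ "[]"]) auto
  next
    case False
    then have v: "v \<in> N" using 1(2) N_eq by blast
    then have vp: "(v, p v) \<in> arrows p" by (simp add: arrows_iff)
    then obtain q where q: "distinct (p v # q)"
      "successively (\<lambda>x y. open_segment x y \<in> used_edges p) (p v # q)" "last (p v # q) \<in> R"
      "set q \<subseteq> (arrows p)\<^sup>+ `` {p v}"
      using 1(1)[of "p v"] orientation_edge(3)[OF p(1) v] by auto
    have sub: "set (p v # q) \<subseteq> (arrows p)\<^sup>+ `` {v}"
      using q(4) vp by (auto intro: trancl_into_trancl2)
    have "v \<notin> set (p v # q)" using sub p(2) by (auto simp: acyclic_def)
    moreover have "open_segment v (p v) \<in> used_edges p" using v unfolding used_edges_def by blast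
    ultimately show ?thesis using q sub by (intro exI[of _ "p v # q"]) auto
  qed
qed

lemma orient_used_edges:
  assumes p: "orientation p" "acyclic (arrows p)"
  shows "orient_to_roots R (used_edges p) = arrows p"
proof (intro subset_antisym subrelI)
  fix u v assume "(u, v) \<in> orient_to_roots R (used_edges p)"
  then show "(u, v) \<in> arrows p"
    using orient_forward[OF p(1)] unfolding orient_to_roots_def by (auto simp only: arrows_iff mem_Collect_eq case_prod_conv)
next
  fix u v assume "(u, v) \<in> arrows p"
  then have u: "u \<in> N" "v = p u" by (simp_all add: arrows_iff)
  then have "u \<in> V" using seg(3) by blast
  then obtain q where q: "distinct (u # q)" "successively (\<lambda>x y. open_segment x y \<in> used_edges p) (u # q)"
    "last (u # q) \<in> R" "q \<noteq> []" "hd q = p u"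
    using path_to_root[OF p] u(1) by blast
  then obtain q' where "q = v # q'" using u(2) by (cases q) auto
  then have "distinct (u # v # q') \<and> successively (\<lambda>x y. open_segment x y \<in> used_edges p) (u # v # q') \<and>
      last (v # q') \<in> R"
    using q(1-3) by simp
  then show "(u, v) \<in> orient_to_roots R (used_edges p)"
    unfolding orient_to_roots_def mem_Collect_eq case_prod_conv by (rule exI)
qed

lemma bij_arrows_used_edges:
  assumes p: "orientation p"
  shows "bij_betw (\<lambda>(u, v). open_segment u v) (arrows p) (used_edges p)"
proof -
  have "arrows p = (\<lambda>v. (v, p v)) ` N" by (auto simp: arrows_def)
  moreover have "inj_on (\<lambda>v. (v, p v)) N" by (auto simp: inj_on_def)
  ultimately show ?thesis
    using used_edges_inj[OF p] by (auto simp: bij_betw_def used_edges_def inj_on_def)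
qed

definition arc_total :: "complex \<Rightarrow> real" where
  "arc_total v = 1 / dist v (up v) + 1 / dist v (dn v)"

definition weight_ratio :: real where
  "weight_ratio = (\<Prod>e\<in>E. diameter e) * (\<Prod>v\<in>N. arc_total v)"

lemma diameter_open_segment: "a \<noteq> b \<Longrightarrow> diameter (open_segment a b) = dist a (b :: complex)"
proof (rule antisym)
  assume ab: "a \<noteq> b"
  have bd: "bounded (closed_segment a b)" by (simp add: compact_imp_bounded)
  have cl: "diameter (open_segment a b) = diameter (closed_segment a b)"
    using diameter_closure[of "open_segment a b"] bounded_subset[OF bd segment_open_subset_closed] ab by simp
  show "dist a b \<le> diameter (open_segment a b)"
    unfolding cl by (rule diameter_bounded_bound[OF bd]) auto
  show "diameter (open_segment a b) \<le> dist a b"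
    unfolding cl
  proof (rule diameter_le)
    fix x y assume "x \<in> closed_segment a b" "y \<in> closed_segment a b"
    then obtain u w where u: "0 \<le> u" "u \<le> 1" "x = (1 - u) *\<^sub>R a + u *\<^sub>R b"
      and w: "0 \<le> w" "w \<le> 1" "y = (1 - w) *\<^sub>R a + w *\<^sub>R b" by (auto simp: in_segment)
    have "x - y = (w - u) *\<^sub>R (a - b)" unfolding u(3) w(3) by (simp add: algebra_simps)
    then have "norm (x - y) = \<bar>w - u\<bar> * dist a b" by (simp only: norm_scaleR dist_norm)
    also have "\<dots> \<le> 1 * dist a b" using u w by (intro mult_right_mono) auto
    finally show "norm (x - y) \<le> dist a b" by simp
  qed simp
qed

lemma diameter_edge_pos: "e \<in> E \<Longrightarrow> diameter e > 0"
  by (elim edgeE) (auto simp: diameter_open_segment consecutive_def)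

lemma weight_ratio_pos: "weight_ratio > 0"
proof -
  have "arc_total v > 0" if "v \<in> N" for v
  proof -
    have "v \<noteq> up v" "v \<noteq> dn v" using up(2)[OF that] dn(2)[OF that] by auto
    then show ?thesis by (simp add: arc_total_def add_pos_pos)
  qed
  then show ?thesis unfolding weight_ratio_def using diameter_edge_pos by (simp add: prod_pos)
qed

lemma forest_weight:
  assumes p: "orientation p"
  shows "(\<Prod>e\<in>arrows p. arc_weight L e) * weight_ratio = (\<Prod>e\<in>E - used_edges p. diameter e)"
proof -
  have arcs: "{w. (v, w) \<in> arcs L} = {up v, dn v}" if "v \<in> N" for v
    using that by (auto simp: arcs_iff)
  have aw: "arc_weight L (v, p v) * arc_total v = 1 / dist v (p v)" if v: "v \<in> N" for v
  proof -
    have "v \<noteq> up v" "v \<noteq> dn v" using up(2)[OF v] dn(2)[OF v] by auto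
    then have "arc_total v > 0" by (simp add: arc_total_def add_pos_pos)
    moreover have "arc_weight L (v, p v) = (1 / dist v (p v)) / arc_total v"
      using up_dn_neq[OF v] by (simp add: arc_weight_def arcs[OF v] arc_total_def)
    ultimately show ?thesis by simp
  qed
  have eq: "arrows p = (\<lambda>v. (v, p v)) ` N" by (auto simp: arrows_def)
  have "(\<Prod>e\<in>arrows p. arc_weight L e) = (\<Prod>v\<in>N. arc_weight L (v, p v))"
    unfolding eq by (subst prod.reindex) (auto simp: inj_on_def)
  then have 1: "(\<Prod>e\<in>arrows p. arc_weight L e) * (\<Prod>v\<in>N. arc_total v) = (\<Prod>v\<in>N. 1 / dist v (p v))"
    using aw by (simp flip: prod.distrib)
  have "(\<Prod>e\<in>used_edges p. diameter e) = (\<Prod>v\<in>N. diameter (open_segment v (p v)))"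
    unfolding used_edges_def by (subst prod.reindex[OF used_edges_inj[OF p]]) simp
  also have "\<dots> = (\<Prod>v\<in>N. dist v (p v))"
    using orientation_edge(4)[OF p] by (intro prod.cong refl diameter_open_segment) metis
  finally have 2: "(\<Prod>e\<in>used_edges p. diameter e) = (\<Prod>v\<in>N. dist v (p v))" .
  have 3: "(\<Prod>e\<in>E. diameter e) = (\<Prod>e\<in>E - used_edges p. diameter e) * (\<Prod>e\<in>used_edges p. diameter e)"
    using finite_E used_edges_subset[OF p] by (rule prod.subset_diff[rotated])
  have "(\<Prod>v\<in>N. 1 / dist v (p v)) * (\<Prod>v\<in>N. dist v (p v)) = 1"
  proof (subst prod.distrib[symmetric], rule prod.neutral, rule ballI)
    fix v assume "v \<in> N"
    then have "dist v (p v) \<noteq> 0" using orientation_edge(4)[OF p] by (metis dist_eq_0_iff)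
    then show "1 / dist v (p v) * dist v (p v) = 1" by simp
  qed
  then have "((\<Prod>e\<in>arrows p. arc_weight L e) * (\<Prod>v\<in>N. arc_total v)) * (\<Prod>v\<in>N. dist v (p v)) = 1"
    unfolding 1 .
  then show ?thesis unfolding weight_ratio_def 3 2 by (simp add: ac_simps)
qed

end

section \<open>Faces and the dual tree\<close>

lemma closure_component_Compl:
  fixes C :: "'a::real_normed_vector set"
  assumes "closed C" "\<Omega> \<in> components (- C)"
  shows "closure \<Omega> \<subseteq> \<Omega> \<union> C"
  using frontier_of_components_closed_complement[OF assms] by (auto simp: closure_Un_frontier)

context tgraph
begin

lemma orbit_of_cycle:
  assumes "(x, y) \<in> arrows p ^^ n"
  shows "y = (p ^^ n) x \<and> (\<forall>i<n. (p ^^ i) x \<in> N)"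
  using assms
proof (induction n arbitrary: y)
  case (Suc n)
  then obtain z where z: "(x, z) \<in> arrows p ^^ n" "(z, y) \<in> arrows p" by auto
  then have "z = (p ^^ n) x" "\<forall>i<n. (p ^^ i) x \<in> N" using Suc.IH by auto
  then show ?case using z(2) by (auto simp: arrows_iff less_Suc_eq)
qed simp

text \<open>The cycle is split into its first edge \<open>S\<close> and the rest \<open>T\<close>,
  two continua that share exactly \<open>x\<close> and \<open>p x\<close>. The dual form of
  Janiszewski's theorem then gives the separation, with no parametrisation of the polygon as a
  simple closed curve.\<close>

lemma cycle_separates:
  assumes p: "orientation p" and cyc: "\<not> acyclic (arrows p)"
  obtains K where "K \<subseteq> N" "p ` K \<subseteq> K" "compact (\<Union>v\<in>K. closed_segment v (p v))"
    "connected (\<Union>v\<in>K. closed_segment v (p v))" "\<not> connected (- (\<Union>v\<in>K. closed_segment v (p v)))"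
proof -
  obtain x where "(x, x) \<in> (arrows p)\<^sup>+" using cyc by (auto simp: acyclic_def)
  then obtain m where m: "m > 0" "(x, x) \<in> arrows p ^^ m" by (auto simp: trancl_power)
  define z where "z i = (p ^^ i) x" for i
  have zS: "z (Suc i) = p (z i)" "z 0 = x" for i by (simp_all add: z_def)
  have zm: "z m = x" "\<And>i. i < m \<Longrightarrow> z i \<in> N" using orbit_of_cycle[OF m(2)] by (auto simp: z_def)
  \<comment> \<open>By taking the least return time, \<open>x\<close> is not revisited before the
    end, so none of the later edges is the first one again.\<close>
  define n where "n = (LEAST n. n > 0 \<and> z n = x)"
  have n: "n > 0" "z n = x" using LeastI[of "\<lambda>n. n > 0 \<and> z n = x" m] m(1) zm by (auto simp: n_def)
  have nm: "n \<le> m" unfolding n_def by (rule Least_le) (use m(1) zm in simp)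
  have nmin: "z i \<noteq> x" if "0 < i" "i < n" for i
    using not_less_Least[of i "\<lambda>n. n > 0 \<and> z n = x"] that by (auto simp: n_def)
  have zN: "z i \<in> N" if "i < n" for i using zm(2) that nm by simp
  have xN: "x \<in> N" using zN[of 0] n(1) zS by simp
  have "n \<noteq> 1"
  proof
    assume "n = 1"
    then have "p x = x" using n zS(1)[of 0] zS(2) by simp
    then show False using orientation_edge(4)[OF p xN] by simp
  qed
  then have n2: "n \<ge> 2" using n(1) by simp
  let ?c = "\<lambda>i. closed_segment (z i) (z (Suc i))"
  define S where "S = closed_segment x (p x)"
  define T where "T = (\<Union>i\<in>{1..<n}. ?c i)"
  define K where "K = z ` {..<n}"
  have KN: "K \<subseteq> N" using zN by (auto simp: K_def)
  have pK: "p ` K \<subseteq> K"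
  proof
    fix y assume "y \<in> p ` K"
    then obtain i where i: "i < n" "y = z (Suc i)" by (auto simp: K_def zS)
    show "y \<in> K"
    proof (cases "Suc i < n")
      case False
      then have "Suc i = n" using i(1) by simp
      then have "y = z 0" using i(2) n(2) zS(2) by simp
      then show ?thesis using n(1) by (auto simp: K_def)
    qed (use i in \<open>auto simp: K_def\<close>)
  qed
  have "{..<n} = insert 0 {1..<n}" using n(1) by auto
  then have eq: "(\<Union>v\<in>K. closed_segment v (p v)) = S \<union> T"
    by (simp add: K_def S_def T_def zS)
  have comp: "compact S" "connected S" "compact T"
    by (auto simp: S_def T_def convex_connected intro!: compact_UN)
  have "connected (\<Union>i\<in>{1..<k}. ?c i) \<and> z k \<in> (\<Union>i\<in>{1..<k}. ?c i)" if "k \<ge> 2" for k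
    using that
  proof (induction k rule: nat_induct_at_least)
    case base
    have "{1..<2} = {1::nat}" by auto
    then show ?case by (auto simp: convex_connected numeral_2_eq_2)
  next
    case (Suc k)
    have "{1..<Suc k} = insert k {1..<k}" using Suc.hyps by auto
    then have "(\<Union>i\<in>{1..<Suc k}. ?c i) = ?c k \<union> (\<Union>i\<in>{1..<k}. ?c i)" by simp
    moreover have "connected (?c k \<union> (\<Union>i\<in>{1..<k}. ?c i))"
      using Suc.IH by (intro connected_Un) (auto simp: convex_connected)
    ultimately show ?case by auto
  qed
  from this[OF n2] have T: "connected T" "x \<in> T" by (auto simp: T_def n(2))
  have pxT: "p x \<in> T"
  proof -
    have "p x \<in> ?c 1" using zS(1)[of 0] zS(2) by simp
    then show ?thesis using n2 unfolding T_def by (intro UN_I[of 1]) auto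
  qed
  have "open_segment x (p x) \<inter> T = {}"
  proof -
    have "open_segment x (p x) \<inter> ?c i = {}" if i: "i \<in> {1..<n}" for i
    proof -
      have zi: "z i \<in> N" "z i \<noteq> x" using zN nmin i by auto
      then have "open_segment (z i) (z (Suc i)) \<noteq> open_segment x (p x)"
        using inj_onD[OF used_edges_inj[OF p], of "z i" x] xN zS by auto
      moreover have "open_segment (z i) (z (Suc i)) \<in> E" "z (Suc i) \<in> V"
        using orientation_edge[OF p zi(1)] zS by auto
      ultimately have "open_segment x (p x) \<inter> open_segment (z i) (z (Suc i)) = {}"
        using disjoint_E orientation_edge(1)[OF p xN] by (metis disjointD)
      moreover have "open_segment x (p x) \<inter> {z i, z (Suc i)} = {}"
        using edge_V[OF orientation_edge(1)[OF p xN]] seg(3)[OF zi(1)] \<open>z (Suc i) \<in> V\<close> by blast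
      ultimately show ?thesis unfolding closed_segment_eq_open by blast
    qed
    then show ?thesis unfolding T_def by blast
  qed
  then have int: "S \<inter> T = {x, p x}" using T(2) pxT unfolding S_def closed_segment_eq_open by blast
  have "\<not> connected (- (S \<union> T))"
  proof
    assume "connected (- (S \<union> T))"
    then have "connected {x, p x}" using Janiszewski_dual[OF comp(1,3,2) T(1)] int by simp
    then have "\<exists>a. {x, p x} = {a}" using connected_finite_iff_sing[of "{x, p x}"] by simp
    then show False using orientation_edge(4)[OF p xN] by auto
  qed
  moreover have "connected (S \<union> T)" using comp T int by (intro connected_Un) auto
  moreover have "compact (S \<union> T)" using comp by (simp add: compact_Un)
  ultimately show ?thesis using that[OF KN pK] unfolding eq by blast
qed

end

locale encircled_tgraph = tgraph +
  fixes c :: "real \<Rightarrow> complex" and F0 :: "complex set"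
  assumes curve: "encircling_curve L R c" and F0: "F0 \<in> outer_faces L c"
begin

abbreviation "\<Gamma> \<equiv> path_image c"
abbreviation "\<Phi> \<equiv> faces L c"

lemma curve_simple: "simple_path c" "pathfinish c = pathstart c"
  and L_inside: "\<Union>L \<subseteq> inside \<Gamma>" and R_curve: "R \<subseteq> \<Gamma>"
  using curve by (auto simp: encircling_curve_def)

lemma \<Gamma>: "compact \<Gamma>" "connected \<Gamma>"
  using curve_simple(1) by (simp_all add: compact_simple_path_image connected_simple_path_image)

lemma inside_component: "inside \<Gamma> \<in> components (- \<Gamma>)" "bounded (inside \<Gamma>)"
  using Jordan_inside_outside[OF curve_simple] by (auto simp: inside_in_components)

lemma inside_curve: "inside \<Gamma> \<inter> \<Gamma> = {}"
  using inside_no_overlap by blast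

text \<open>The outside of the curve is connected, unbounded and free of segments, so a bounded
  component that met it would have to contain it.\<close>

lemma faces_eq: "\<Phi> = components (inside \<Gamma> - (\<Union>L \<union> \<Gamma>))"
proof (intro subset_antisym subsetI)
  fix F assume "F \<in> \<Phi>"
  then have F: "F \<in> components (- (\<Union>L \<union> \<Gamma>))" "bounded F" by (auto simp: faces_def)
  have sub: "F \<subseteq> - (\<Union>L \<union> \<Gamma>)" "connected F" "F \<noteq> {}"
    using F(1) in_components_subset in_components_connected in_components_nonempty by blast+
  have "F \<inter> outside \<Gamma> = {}"
  proof (rule ccontr)
    assume "F \<inter> outside \<Gamma> \<noteq> {}"
    moreover have "outside \<Gamma> \<subseteq> - (\<Union>L \<union> \<Gamma>)"
      using L_inside inside_Int_outside[of \<Gamma>] outside_no_overlap[of \<Gamma>] by blast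
    moreover have "connected (outside \<Gamma>)" using Jordan_inside_outside[OF curve_simple] by simp
    ultimately have "outside \<Gamma> \<subseteq> F" using components_maximal[OF F(1)] by blast
    then have "bounded (outside \<Gamma>)" using F(2) bounded_subset by blast
    then show False using Jordan_inside_outside[OF curve_simple] by simp
  qed
  then have "F \<subseteq> inside \<Gamma>" using sub(1) inside_Un_outside[of \<Gamma>] by blast
  then show "F \<in> components (inside \<Gamma> - (\<Union>L \<union> \<Gamma>))"
    using F(1) sub unfolding in_components_maximal by blast
next
  fix F assume F: "F \<in> components (inside \<Gamma> - (\<Union>L \<union> \<Gamma>))"
  then have "F \<in> components (- (\<Union>L \<union> \<Gamma>))"
    by (intro components_Diff_superset[OF inside_component(1)]) auto
  moreover have "bounded F"
    using in_components_subset[OF F] inside_component(2) bounded_subset by blast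
  ultimately show "F \<in> \<Phi>" by (simp add: faces_def)
qed

text \<open>Contact with the curve is what distinguishes \<open>F0\<close> from every face enclosed
  by a cycle of arcs, as used in \<open>region_of_cycle\<close>.\<close>

lemma F0_face: "F0 \<in> \<Phi>" and F0_curve: "frontier F0 \<inter> \<Gamma> \<noteq> {}"
proof -
  show "F0 \<in> \<Phi>" using F0 by (simp add: outer_faces_def)
  obtain u v where uv: "0 \<le> u" "u < v" "v \<le> 1" "c ` {u..v} \<subseteq> frontier F0"
    using F0 by (auto simp: outer_faces_def)
  then have "c u \<in> frontier F0" "c u \<in> \<Gamma>" by (auto simp: path_image_def)
  then show "frontier F0 \<inter> \<Gamma> \<noteq> {}" by blast
qed

lemma planar_region_of_forest:
  assumes p: "orientation p" "acyclic (arrows p)"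
  shows "planar_region \<Gamma> (inside \<Gamma>) N p E"
proof
  show "N \<subseteq> inside \<Gamma>" using L_inside by (auto simp: N_def)
  show "\<exists>u v. u \<noteq> v \<and> u \<in> N \<union> \<Gamma> \<and> v \<in> N \<union> \<Gamma> \<and> e = open_segment u v" if e: "e \<in> E" for e
  proof -
    obtain s u w where "s \<in> L" "consecutive L s u w" "e = open_segment u w" using edgeE[OF e] by metis
    then show ?thesis using V_eq R_curve unfolding consecutive_def by blast
  qed
  show "e \<subseteq> inside \<Gamma>" if "e \<in> E" for e using edge_L[OF that] L_inside by blast
  show "e \<inter> N = {}" if "e \<in> E" for e using edge_V[OF that] by (auto simp: N_def)
  show "p v \<in> N \<union> \<Gamma>" if "v \<in> N" for v using orientation_edge(3)[OF p(1) that] V_eq R_curve by auto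
qed (use \<Gamma> inside_component finite_N finite_E disjoint_E orientation_edge(1)[OF p(1)] p(2) in
    \<open>simp_all add: arrows_def\<close>)

lemma dual_tree:
  assumes p: "orientation p" "acyclic (arrows p)"
  shows "linked_incidence \<Phi> (E - used_edges p) (\<lambda>F e. e \<subseteq> frontier F) F0"
    and "finite \<Phi> \<Longrightarrow> card (E - used_edges p) + 1 \<le> card \<Phi>"
proof -
  interpret planar_region \<Gamma> "inside \<Gamma>" N p E using planar_region_of_forest[OF p] .
  have "drawing E = \<Union>L \<union> \<Gamma>" using Union_L_eq by (auto simp: drawing_def)
  then have \<Phi>: "\<Phi> = components (inside \<Gamma> - drawing E)" using faces_eq by simp
  have X: "E - used_edges p = cross_edges"
    by (simp add: cross_edges_def tree_edges_def used_edges_def)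
  show "linked_incidence \<Phi> (E - used_edges p) (\<lambda>F e. e \<subseteq> frontier F) F0"
  proof
    show "finite (E - used_edges p)" using finite_E by simp
    show "F0 \<in> \<Phi>" by (rule F0_face)
    show "\<exists>K1 K2. \<forall>K\<in>\<Phi>. e \<subseteq> frontier K \<longleftrightarrow> K = K1 \<or> K = K2" if "e \<in> E - used_edges p" for e
    proof -
      have "e \<in> E" using that by simp
      then show ?thesis unfolding \<Phi> by (rule edge_borders) blast
    qed
    fix A assume "A \<subseteq> \<Phi>" "A \<noteq> {}"
      "\<And>e K K'. \<lbrakk>e \<in> E - used_edges p; K \<in> A; K' \<in> \<Phi>; e \<subseteq> frontier K; e \<subseteq> frontier K'\<rbrakk> \<Longrightarrow> K' \<in> A"
    then show "A = \<Phi>" unfolding \<Phi> X by (rule components_linked)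
  qed
  show "card (E - used_edges p) + 1 \<le> card \<Phi>" if "finite \<Phi>"
    using card_components_ge that unfolding \<Phi> X by blast
qed

lemma orientation_up: "orientation up"
  by (rule orientation_if_acyclic) (simp_all add: acyclic_up)

text \<open>The growth bound of \<open>matching_exists\<close>, applied to the dual graph of the
  upward forest, which is always available.\<close>

lemma finite_faces: "finite \<Phi>"
  using linked_incidence.matching_exists(1)[OF dual_tree(1)[OF orientation_up acyclic_up]] .

text \<open>The cycle is made of whole edges and vertices, so any edge lies in
  \<open>\<gamma>\<close> or misses it. The part of the T-graph in \<open>\<Omega>\<close> is
  therefore again a drawing with an upward forest, now rooted on the cycle instead of the
  curve.\<close>

lemma region_of_cycle:
  fixes K \<Omega> :: "complex set" and p :: "complex \<Rightarrow> complex"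
  defines "\<gamma> \<equiv> \<Union>v\<in>K. closed_segment v (p v)"
  assumes p: "orientation p" and K: "K \<subseteq> N" "p ` K \<subseteq> K" "compact \<gamma>" "connected \<gamma>"
    and \<Omega>: "\<Omega> \<in> components (- \<gamma>)" "bounded \<Omega>"
  defines "V' \<equiv> N \<inter> \<Omega>" and "E' \<equiv> {e \<in> E. e \<subseteq> \<Omega>}"
  shows "planar_region \<gamma> \<Omega> V' up E'"
    and "components (\<Omega> - planar_region.drawing \<gamma> V' E') \<subseteq> {F \<in> \<Phi> - {F0}. F \<subseteq> \<Omega>}"
    and "\<And>e F. e \<in> E - used_edges p \<Longrightarrow> F \<subseteq> \<Omega> \<Longrightarrow> e \<subseteq> frontier F \<Longrightarrow> e \<subseteq> \<Omega>"
    and "\<And>e v. e \<in> E \<Longrightarrow> v \<in> closure e \<inter> \<Omega> \<Longrightarrow> e \<subseteq> \<Omega>"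
proof -
  have \<gamma>_eq: "\<gamma> = K \<union> (\<Union>v\<in>K. open_segment v (p v))"
    using K(2) unfolding \<gamma>_def closed_segment_eq_open by blast
  have \<gamma>L: "\<gamma> \<subseteq> \<Union>L"
    unfolding \<gamma>_eq Union_L_eq using K(1) orientation_edge(1)[OF p] by blast
  have closed_\<gamma>: "closed \<gamma>" using K(3) compact_imp_closed by blast
  have \<Omega>\<gamma>: "\<Omega> \<inter> \<gamma> = {}" using in_components_subset[OF \<Omega>(1)] by blast
  have cl\<Omega>: "closure \<Omega> \<subseteq> \<Omega> \<union> \<gamma>" by (rule closure_component_Compl[OF closed_\<gamma> \<Omega>(1)])
  \<comment> \<open>The complement of \<open>inside \<Gamma>\<close> is connected and misses
    \<open>\<gamma>\<close>; if it met \<open>\<Omega>\<close> it would lie in it, but it is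
    unbounded.\<close>
  have \<Omega>_inside: "\<Omega> \<subseteq> inside \<Gamma>"
  proof -
    have "connected (- inside \<Gamma>)"
      by (rule component_complement_connected[OF \<Gamma>(2) inside_component(1)])
    moreover have "- inside \<Gamma> \<subseteq> - \<gamma>" using \<gamma>L L_inside by blast
    moreover have "\<not> - inside \<Gamma> \<subseteq> \<Omega>"
      using \<Omega>(2) inside_component(2) bounded_subset cobounded_imp_unbounded[of "- inside \<Gamma>"] by auto
    ultimately have "\<Omega> \<inter> - inside \<Gamma> = {}" using components_maximal[OF \<Omega>(1)] by blast
    then show ?thesis by blast
  qed
  have edge_\<gamma>: "e \<inter> \<gamma> = {} \<or> (e \<subseteq> \<gamma> \<and> e \<in> used_edges p)" if e: "e \<in> E" for e
  proof (cases "\<exists>v\<in>K. e = open_segment v (p v)")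
    case True
    then show ?thesis using K(1) unfolding \<gamma>_eq used_edges_def by blast
  next
    case False
    have "e \<inter> open_segment v (p v) = {}" if "v \<in> K" for v
      using False that K(1) e disjoint_E orientation_edge(1)[OF p, of v] by (metis disjointD subsetD)
    moreover have "e \<inter> K = {}" using edge_V[OF e] K(1) by (auto simp: N_def)
    ultimately show ?thesis unfolding \<gamma>_eq by blast
  qed
  have stay: "e \<subseteq> \<Omega>" if e: "e \<in> E" "v \<in> closure e \<inter> \<Omega>" for e v
  proof -
    obtain u w where uw: "e = open_segment u w" using edgeE[OF e(1)] by metis
    have con: "connected (insert v e)"
    proof (rule connected_intermediate_closure)
      show "connected e" unfolding uw by (simp add: convex_connected)
    qed (use e closure_subset in auto)
    have "e \<inter> \<gamma> = {}"
    proof (rule ccontr)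
      assume "e \<inter> \<gamma> \<noteq> {}"
      then have "e \<subseteq> \<gamma>" using edge_\<gamma>[OF e(1)] by blast
      then have "closure e \<subseteq> \<gamma>" using closed_\<gamma> closure_minimal by blast
      then show False using e(2) \<Omega>\<gamma> by blast
    qed
    then have "insert v e \<subseteq> - \<gamma>" using e(2) \<Omega>\<gamma> by blast
    then show "e \<subseteq> \<Omega>" using components_maximal[OF \<Omega>(1) con] e(2) by blast
  qed
  then show "\<And>e v. e \<in> E \<Longrightarrow> v \<in> closure e \<inter> \<Omega> \<Longrightarrow> e \<subseteq> \<Omega>" .
  have V\<Omega>: "v \<in> V' \<union> \<gamma>" if v: "v \<in> V" "v \<in> closure \<Omega>" for v
  proof (cases "v \<in> \<gamma>")
    case False
    then have "v \<in> \<Omega>" using v cl\<Omega> by blast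
    moreover have "v \<notin> R" using \<open>v \<in> \<Omega>\<close> \<Omega>_inside R_curve inside_curve by blast
    ultimately show ?thesis using v(1) V_eq by (auto simp: V'_def)
  qed simp
  show pr: "planar_region \<gamma> \<Omega> V' up E'"
  proof
    show "\<exists>u v. u \<noteq> v \<and> u \<in> V' \<union> \<gamma> \<and> v \<in> V' \<union> \<gamma> \<and> e = open_segment u v" if e: "e \<in> E'" for e
    proof -
      have eE: "e \<in> E" "e \<subseteq> \<Omega>" using e by (auto simp: E'_def)
      obtain s u w where uw: "consecutive L s u w" "e = open_segment u w" using edgeE[OF eE(1)] by metis
      have n: "u \<noteq> w" "u \<in> V" "w \<in> V" using uw(1) by (auto simp: consecutive_def)
      have "closure e \<subseteq> closure \<Omega>" using eE(2) by (rule closure_mono)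
      then have "u \<in> closure \<Omega>" "w \<in> closure \<Omega>" using uw(2) n(1) by auto
      then show ?thesis using V\<Omega> n uw(2) by blast
    qed
    have up': "open_segment v (up v) \<in> E'" "up v \<in> V' \<union> \<gamma>" if v: "v \<in> V'" for v
    proof -
      have vN: "v \<in> N" "v \<in> \<Omega>" using v by (auto simp: V'_def)
      have neq: "v \<noteq> up v" using up(2)[OF vN(1)] by auto
      have sub: "open_segment v (up v) \<subseteq> \<Omega>"
        using stay[OF up_edge(1)[OF vN(1)], of v] vN(2) neq by simp
      then show "open_segment v (up v) \<in> E'" using up_edge(1)[OF vN(1)] by (simp add: E'_def)
      have "closure (open_segment v (up v)) \<subseteq> closure \<Omega>" using sub by (rule closure_mono)
      then have "up v \<in> closure \<Omega>" using neq by auto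
      then show "up v \<in> V' \<union> \<gamma>" using V\<Omega> up_V[OF vN(1)] by blast
    qed
    then show "\<And>v. v \<in> V' \<Longrightarrow> open_segment v (up v) \<in> E'" "\<And>v. v \<in> V' \<Longrightarrow> up v \<in> V' \<union> \<gamma>"
      by blast+
    show "acyclic {(v, up v) |v. v \<in> V'}"
      by (rule acyclic_subset[OF acyclic_up]) (auto simp: arrows_def V'_def)
    show "disjoint E'" using disjoint_E by (rule pairwise_subset) (auto simp: E'_def)
    show "e \<inter> V' = {}" if "e \<in> E'" for e
      using edge_V[of e] that unfolding E'_def V'_def N_def by blast
  qed (use K \<Omega> finite_N finite_E in \<open>auto simp: V'_def E'_def\<close>)
  have "\<Omega> \<inter> \<Union>L \<subseteq> V' \<union> \<Union>E'"
  proof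
    fix x assume x: "x \<in> \<Omega> \<inter> \<Union>L"
    then consider "x \<in> N" | e where "e \<in> E" "x \<in> e" unfolding Union_L_eq by blast
    then show "x \<in> V' \<union> \<Union>E'"
    proof cases
      case 2
      then have "e \<subseteq> \<Omega>" using stay[of e x] x closure_subset[of e] by blast
      then show ?thesis using 2 by (auto simp: E'_def)
    qed (use x in \<open>simp add: V'_def\<close>)
  qed
  moreover have "V' \<union> \<Union>E' \<subseteq> \<Union>L" unfolding Union_L_eq V'_def E'_def by blast
  ultimately have eq: "\<Omega> - planar_region.drawing \<gamma> V' E' = \<Omega> - (\<Union>L \<union> \<Gamma>)"
    using \<gamma>L \<Omega>_inside inside_curve unfolding planar_region.drawing_def[OF pr] by blast
  show "components (\<Omega> - planar_region.drawing \<gamma> V' E') \<subseteq> {F \<in> \<Phi> - {F0}. F \<subseteq> \<Omega>}"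
    unfolding eq
  proof
    fix F assume F: "F \<in> components (\<Omega> - (\<Union>L \<union> \<Gamma>))"
    then have sub: "F \<subseteq> \<Omega>" using in_components_subset by blast
    have "F \<in> components (- (\<Union>L \<union> \<Gamma>))"
      using F \<gamma>L by (intro components_Diff_superset[OF \<Omega>(1)]) auto
    then have "F \<in> \<Phi>" using sub \<Omega>(2) bounded_subset by (auto simp: faces_def)
    \<comment> \<open>The closure of \<open>\<Omega>\<close> stays strictly inside the curve,
      whereas the frontier of \<open>F0\<close> touches the curve.\<close>
    moreover have "F \<noteq> F0"
    proof
      assume "F = F0"
      then have "frontier F0 \<subseteq> closure \<Omega>" using sub closure_mono by (auto simp: frontier_def)
      then show False using F0_curve cl\<Omega> \<Omega>_inside \<gamma>L L_inside inside_curve by blast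
    qed
    ultimately show "F \<in> {F \<in> \<Phi> - {F0}. F \<subseteq> \<Omega>}" using sub by simp
  qed
  show "e \<subseteq> \<Omega>" if e: "e \<in> E - used_edges p" "F \<subseteq> \<Omega>" "e \<subseteq> frontier F" for e F
  proof -
    have "frontier F \<subseteq> closure \<Omega>" using e(2) closure_mono by (auto simp: frontier_def)
    then have "e \<subseteq> \<Omega> \<union> \<gamma>" using e(3) cl\<Omega> by blast
    then show ?thesis using edge_\<gamma>[of e] e(1) by blast
  qed
qed

text \<open>
  Inside a cycle of unmarked edges the faces outnumber the segments that have an
  edge there, because each such segment contributes a cross edge of the forest \<^term>\<open>up\<close>.
\<close>

lemma acyclic_of_matching:
  assumes p: "orientation p"
    and \<mu>: "\<And>F. F \<in> \<Phi> - {F0} \<Longrightarrow> \<mu> F \<in> E - used_edges p \<and> \<mu> F \<subseteq> frontier F \<and> \<mu> F \<subseteq> \<sigma> F \<and> \<sigma> F \<in> L"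
    and inj: "inj_on \<sigma> (\<Phi> - {F0})"
  shows "acyclic (arrows p)"
proof (rule ccontr)
  assume "\<not> acyclic (arrows p)"
  then obtain K where K: "K \<subseteq> N" "p ` K \<subseteq> K" "compact (\<Union>v\<in>K. closed_segment v (p v))"
    "connected (\<Union>v\<in>K. closed_segment v (p v))" "\<not> connected (- (\<Union>v\<in>K. closed_segment v (p v)))"
    using cycle_separates[OF p] by metis
  define \<gamma> where "\<gamma> = (\<Union>v\<in>K. closed_segment v (p v))"
  have "bounded (- (- \<gamma>))" using K(3) by (simp add: \<gamma>_def compact_imp_bounded)
  then obtain \<Omega> where \<Omega>: "\<Omega> \<in> components (- \<gamma>)" "bounded \<Omega>"
    using cobounded_has_bounded_component[of "- \<gamma>"] K(5) by (auto simp: \<gamma>_def)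
  note region = region_of_cycle[OF p K(1-4), folded \<gamma>_def, OF \<Omega>]
  let ?V' = "N \<inter> \<Omega>" and ?E' = "{e \<in> E. e \<subseteq> \<Omega>}"
  interpret planar_region \<gamma> \<Omega> ?V' up ?E' by (rule region(1))
  let ?Fin = "components (\<Omega> - drawing ?E')"
  have fin: "finite ?Fin" using region(2) finite_faces finite_subset by fastforce
  have low: "\<exists>e\<in>cross_edges. e \<subseteq> s" if s: "s \<in> L" and e0: "e0 \<in> ?E'" "e0 \<subseteq> s" for s e0
  proof -
    \<comment> \<open>Among the edges of \<open>s\<close> in \<open>\<Omega>\<close>, the one with
      the lowest lower end \<open>u\<close> is a cross edge. Were it the upward edge of
      \<open>u\<close>, then \<open>u\<close> would lie in \<open>\<Omega>\<close> and on
      \<open>s\<close>, and the edge below \<open>u\<close> would be a lower candidate.\<close>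
    let ?B = "{u \<in> V. \<exists>w. consecutive L s u w \<and> h u < h w \<and> open_segment u w \<subseteq> \<Omega>}"
    have "?B \<noteq> {}"
    proof -
      have "e0 \<in> E" using e0 by simp
      then obtain s' u w where c: "s' \<in> L" "consecutive L s' u w" "h u < h w" "e0 = open_segment u w" "e0 \<subseteq> s'"
        using edgeE by metis
      then have "s' = s" using edge_L_unique[OF \<open>e0 \<in> E\<close> c(1) s c(5) e0(2)] by simp
      then have "u \<in> ?B" using c e0(1) by (auto simp: consecutive_def)
      then show ?thesis by blast
    qed
    moreover have "finite ?B" using finite_V by simp
    ultimately obtain u where u: "u \<in> ?B" "\<And>x. x \<in> ?B \<Longrightarrow> h u \<le> h x"
      using arg_min_if_finite[of ?B h] by (metis (no_types, lifting) not_less)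
    then obtain w where w: "consecutive L s u w" "h u < h w" "open_segment u w \<subseteq> \<Omega>" by blast
    have eE: "open_segment u w \<in> ?E'" "open_segment u w \<subseteq> s"
      using edgeI[OF s w(1)] w by (simp_all add: consecutive_def)
    have "open_segment u w \<notin> tree_edges"
    proof
      assume "open_segment u w \<in> tree_edges"
      then obtain v where v: "v \<in> N" "v \<in> \<Omega>" "open_segment u w = open_segment v (up v)"
        by (auto simp: tree_edges_def)
      have "u \<noteq> w" using w(2) by auto
      then have "{u, w} = {v, up v}" using v(3) by (metis open_segment_eq open_segment_eq_empty)
      then have uv: "u = v" using w(2) up(2)[OF v(1)] by (auto simp: doubleton_eq_iff)
      have "open_segment u w \<subseteq> seg u" using up_edge(2)[OF v(1)] v(3) uv by metis
      then have sg: "seg u = s"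
        using edge_L_unique[of "open_segment u w" "seg u" s] eE s seg(1)[OF v(1)] uv by simp
      have uN: "u \<in> N" using v(1) uv by simp
      have "consecutive L s (dn u) u" "h (dn u) < h u" "open_segment (dn u) u \<in> E"
        using dn[OF uN] sg consecutive_commute[of s u "dn u"] dn_edge(1)[OF uN] open_segment_commute[of u "dn u"]
        by auto
      moreover have "open_segment (dn u) u \<subseteq> \<Omega>"
      proof (rule region(4))
        show "u \<in> closure (open_segment (dn u) u) \<inter> \<Omega>" using calculation(2) v(2) uv by auto
      qed (use calculation in simp)
      ultimately have "dn u \<in> ?B" by (auto simp: consecutive_def)
      then show False using u(2) dn(2)[OF uN] by fastforce
    qed
    then show ?thesis using eE by (auto simp: cross_edges_def)
  qed
  \<comment> \<open>Each enclosed face receives a cross edge on the segment matched with it.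
    Different faces have different segments, so there are at most as many enclosed faces as cross
    edges, against \<open>card_components_ge\<close>.\<close>
  define g where "g F = (SOME e. e \<in> cross_edges \<and> e \<subseteq> \<sigma> F)" for F
  have g: "g F \<in> cross_edges \<and> g F \<subseteq> \<sigma> F" if F: "F \<in> ?Fin" for F
  proof -
    have F': "F \<in> \<Phi> - {F0}" "F \<subseteq> \<Omega>" using region(2) F by auto
    have "\<mu> F \<in> ?E'" using \<mu>[OF F'(1)] region(3)[of "\<mu> F" F] F'(2) by auto
    then have "\<exists>e. e \<in> cross_edges \<and> e \<subseteq> \<sigma> F" using low \<mu>[OF F'(1)] by blast
    then show ?thesis unfolding g_def by (rule someI_ex)
  qed
  have "inj_on g ?Fin"
  proof (rule inj_onI)
    fix F G assume FG: "F \<in> ?Fin" "G \<in> ?Fin" "g F = g G"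
    have FG': "F \<in> \<Phi> - {F0}" "G \<in> \<Phi> - {F0}" using region(2) FG by auto
    have "g F \<in> E" using g[OF FG(1)] by (auto simp: cross_edges_def)
    then have "\<sigma> F = \<sigma> G"
      using edge_L_unique[of "g F" "\<sigma> F" "\<sigma> G"] g[OF FG(1)] g[OF FG(2)] FG(3) \<mu>[OF FG'(1)] \<mu>[OF FG'(2)]
      by simp
    then show "F = G" using inj FG' by (simp add: inj_on_def)
  qed
  moreover have "g ` ?Fin \<subseteq> cross_edges" using g by blast
  moreover have "finite cross_edges" using finite_E by (simp add: cross_edges_def)
  ultimately have "card ?Fin \<le> card cross_edges" by (rule card_inj_on_le)
  then show False using card_components_ge[OF fin] by simp
qed

end

section \<open>The bijection\<close>

lemma normalized_measure:
  assumes "finite A" "A \<noteq> {}" "\<And>x. x \<in> A \<Longrightarrow> w x > 0"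
  shows "prob_space (normalized_measure A w)"
    and "x \<in> A \<Longrightarrow> emeasure (normalized_measure A w) {x} = ennreal (w x / (\<Sum>y\<in>A. w y))"
proof -
  have pos: "(\<Sum>y\<in>A. w y) > 0" using assms by (simp add: sum_pos)
  have nn: "w x / (\<Sum>y\<in>A. w y) \<ge> 0" if "x \<in> A" for x using assms(3)[OF that] pos by simp
  have em: "emeasure (normalized_measure A w) X = (\<Sum>x\<in>X. ennreal (w x / (\<Sum>y\<in>A. w y)))" if "X \<subseteq> A" for X
    unfolding normalized_measure_def using assms(1) that by (rule emeasure_point_measure_finite)
  show "prob_space (normalized_measure A w)"
  proof (rule prob_spaceI)
    have "space (normalized_measure A w) = A" by (simp add: normalized_measure_def space_point_measure)
    then have "emeasure (normalized_measure A w) (space (normalized_measure A w))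
        = (\<Sum>x\<in>A. ennreal (w x / (\<Sum>y\<in>A. w y)))"
      using em by simp
    also have "\<dots> = ennreal (\<Sum>x\<in>A. w x / (\<Sum>y\<in>A. w y))" using nn by (rule sum_ennreal)
    also have "\<dots> = 1" using pos by (simp flip: sum_divide_distrib)
    finally show "emeasure (normalized_measure A w) (space (normalized_measure A w)) = 1" .
  qed
  show "emeasure (normalized_measure A w) {x} = ennreal (w x / (\<Sum>y\<in>A. w y))" if "x \<in> A"
    using em[of "{x}"] that by simp
qed

context encircled_tgraph
begin

definition face_segment :: "(complex set \<times> complex set) set \<Rightarrow> complex set \<Rightarrow> complex set" where
  "face_segment M F = (THE s. (F, s) \<in> M)"

text \<open>A marked matching read as a map from faces to edges, the form in which
  \<open>linked_incidence\<close> compares matchings; \<open>matching_of_face_edge\<close> shows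
  that nothing is lost.\<close>

definition face_edge :: "marked_matching \<Rightarrow> complex set \<Rightarrow> complex set" where
  "face_edge = (\<lambda>(M, S) F. S (F, face_segment M F))"

context
  fixes M :: "(complex set \<times> complex set) set" and S :: "complex set \<times> complex set \<Rightarrow> complex set"
  assumes MS: "(M, S) \<in> marked_matchings L c F0"
begin

lemma matching_graph:
  "M = (\<lambda>F. (F, face_segment M F)) ` (\<Phi> - {F0})"
  "bij_betw (face_segment M) (\<Phi> - {F0}) L"
proof -
  have sub: "M \<subseteq> dual_edges L c F0"
    and ex1: "\<And>F. F \<in> \<Phi> - {F0} \<Longrightarrow> \<exists>!s. (F, s) \<in> M" and ex2: "\<And>s. s \<in> L \<Longrightarrow> \<exists>!F. (F, s) \<in> M"
    using MS by (auto simp: marked_matchings_def perfect_matchings_def)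
  have M: "(F, face_segment M F) \<in> M" if "F \<in> \<Phi> - {F0}" for F
    unfolding face_segment_def by (rule theI'[OF ex1[OF that]])
  have in_M: "F \<in> \<Phi> - {F0} \<and> s \<in> L \<and> s = face_segment M F" if Fs: "(F, s) \<in> M" for F s
  proof -
    have "F \<in> \<Phi> - {F0}" "s \<in> L" using sub Fs by (auto simp: dual_edges_def)
    then show ?thesis using ex1[of F] M[of F] Fs by blast
  qed
  show "M = (\<lambda>F. (F, face_segment M F)) ` (\<Phi> - {F0})"
    using M in_M by fast
  show "bij_betw (face_segment M) (\<Phi> - {F0}) L"
    unfolding bij_betw_def
  proof
    show "inj_on (face_segment M) (\<Phi> - {F0})"
    proof (rule inj_onI)
      fix F G assume FG: "F \<in> \<Phi> - {F0}" "G \<in> \<Phi> - {F0}" "face_segment M F = face_segment M G"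
      have "face_segment M F \<in> L" using in_M[OF M[OF FG(1)]] by blast
      then show "F = G" using ex2[of "face_segment M F"] M[OF FG(1)] M[OF FG(2)] FG(3) by auto
    qed
    show "face_segment M ` (\<Phi> - {F0}) = L"
    proof (intro subset_antisym subsetI)
      fix s assume "s \<in> L"
      then obtain F where "(F, s) \<in> M" using ex2 by blast
      then show "s \<in> face_segment M ` (\<Phi> - {F0})" using in_M[of F s] by blast
    qed (use M in_M in blast)
  qed
qed

lemma face_edge:
  assumes F: "F \<in> \<Phi> - {F0}"
  shows "face_edge (M, S) F \<in> E" "face_edge (M, S) F \<subseteq> frontier F" "face_edge (M, S) F \<subseteq> face_segment M F"
    "face_segment M F \<in> L"
proof -
  have "(F, face_segment M F) \<in> M" using matching_graph(1) F by blast
  then have "S (F, face_segment M F) \<in> subsegments L (F, face_segment M F)"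
    using MS by (auto simp: marked_matchings_def)
  then show "face_edge (M, S) F \<in> E" "face_edge (M, S) F \<subseteq> frontier F" "face_edge (M, S) F \<subseteq> face_segment M F"
    by (auto simp: face_edge_def subsegments_def portion_def)
  show "face_segment M F \<in> L" using matching_graph(2) F by (auto simp: bij_betw_def)
qed

text \<open>A marked edge lies on only one segment, and that segment is matched with only one
  face.\<close>

lemma bij_face_edge: "bij_betw (face_edge (M, S)) (\<Phi> - {F0}) (S ` M)"
  unfolding bij_betw_def
proof
  have "S ` M = S ` (\<lambda>F. (F, face_segment M F)) ` (\<Phi> - {F0})" using matching_graph(1) by simp
  then show "face_edge (M, S) ` (\<Phi> - {F0}) = S ` M" by (simp add: face_edge_def image_image)
  show "inj_on (face_edge (M, S)) (\<Phi> - {F0})"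
  proof (rule inj_onI)
    fix F G assume FG: "F \<in> \<Phi> - {F0}" "G \<in> \<Phi> - {F0}" "face_edge (M, S) F = face_edge (M, S) G"
    have "face_segment M F = face_segment M G"
      using edge_L_unique[OF face_edge(1)[OF FG(1)] face_edge(4)[OF FG(1)] face_edge(4)[OF FG(2)]
          face_edge(3)[OF FG(1)]] face_edge(3)[OF FG(2)] FG(3) by simp
    then show "F = G" using matching_graph(2) FG(1,2) by (simp add: bij_betw_def inj_on_def)
  qed
qed

lemma inj_marking: "inj_on S M"
proof (rule inj_onI)
  fix x y assume xy: "x \<in> M" "y \<in> M" "S x = S y"
  have "\<exists>F\<in>\<Phi> - {F0}. x = (F, face_segment M F)" "\<exists>G\<in>\<Phi> - {F0}. y = (G, face_segment M G)"
    using xy(1,2) matching_graph(1) by blast+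
  then obtain F G where FG: "F \<in> \<Phi> - {F0}" "x = (F, face_segment M F)"
    "G \<in> \<Phi> - {F0}" "y = (G, face_segment M G)" by blast
  then have "face_edge (M, S) F = face_edge (M, S) G" using xy(3) by (simp add: face_edge_def)
  then have "F = G" using bij_face_edge FG by (simp add: bij_betw_def inj_on_def)
  then show "x = y" using FG by simp
qed

text \<open>\<open>orientation_away\<close> is applied to the edge marked on each segment; only the
  adjacency of marked edges to their faces then excludes cycles, through
  \<open>acyclic_of_matching\<close>.\<close>

lemma orientation_of_matching:
  obtains p where "orientation p" "acyclic (arrows p)" "E - used_edges p = S ` M"
    "unmarked_edges L (M, S) = used_edges p"
proof -
  define G where "G = inv_into (\<Phi> - {F0}) (face_segment M)"
  have G: "G s \<in> \<Phi> - {F0}" "face_segment M (G s) = s" if "s \<in> L" for s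
  proof -
    have "s \<in> face_segment M ` (\<Phi> - {F0})" using matching_graph(2) that by (simp add: bij_betw_def)
    then show "G s \<in> \<Phi> - {F0}" "face_segment M (G s) = s"
      unfolding G_def by (rule inv_into_into, rule f_inv_into_f)
  qed
  have GL: "G ` L = \<Phi> - {F0}"
    using matching_graph(2) unfolding G_def by (metis bij_betw_def bij_betw_inv_into)
  define T where "T s = face_edge (M, S) (G s)" for s
  have "T s \<in> edges_on s" if "s \<in> L" for s
    using face_edge(1,3)[OF G(1)[OF that]] G(2)[OF that] by (simp add: T_def edges_on_def)
  then obtain p where p: "orientation p" "E - used_edges p = T ` L" using orientation_away by metis
  have "T ` L = face_edge (M, S) ` (G ` L)" by (simp add: T_def image_image)
  also have "\<dots> = S ` M" using bij_face_edge by (simp add: GL bij_betw_def)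
  finally have X: "E - used_edges p = S ` M" using p(2) by simp
  have "acyclic (arrows p)"
  proof (rule acyclic_of_matching[OF p(1), of "face_edge (M, S)" "face_segment M"])
    fix F assume F: "F \<in> \<Phi> - {F0}"
    have "face_edge (M, S) F \<in> S ` M" using bij_face_edge F by (auto simp: bij_betw_def)
    then show "face_edge (M, S) F \<in> E - used_edges p \<and> face_edge (M, S) F \<subseteq> frontier F \<and>
        face_edge (M, S) F \<subseteq> face_segment M F \<and> face_segment M F \<in> L"
      unfolding X using face_edge[OF F] by blast
  qed (use matching_graph(2) in \<open>simp add: bij_betw_def\<close>)
  moreover have "unmarked_edges L (M, S) = used_edges p"
    using X used_edges_subset[OF p(1)] unfolding unmarked_edges_def by auto
  ultimately show ?thesis using that p(1) X by blast
qed

end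

text \<open>An edge determines its segment, so the edges determine \<open>M\<close> and the values
  of \<open>S\<close> on it; outside \<open>M\<close> extensionality fixes \<open>S\<close>.\<close>

lemma matching_of_face_edge:
  assumes "(M, S) \<in> marked_matchings L c F0" "(M', S') \<in> marked_matchings L c F0"
    and eq: "\<And>F. F \<in> \<Phi> - {F0} \<Longrightarrow> face_edge (M, S) F = face_edge (M', S') F"
  shows "(M, S) = (M', S')"
proof -
  have seg_eq: "face_segment M F = face_segment M' F" if F: "F \<in> \<Phi> - {F0}" for F
    using face_edge[OF assms(1) F] face_edge[OF assms(2) F] eq[OF F]
      edge_L_unique[of "face_edge (M, S) F" "face_segment M F" "face_segment M' F"] by simp
  have "(\<lambda>F. (F, face_segment M F)) ` (\<Phi> - {F0}) = (\<lambda>F. (F, face_segment M' F)) ` (\<Phi> - {F0})"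
    by (rule image_cong) (use seg_eq in simp_all)
  then have "M = M'" using matching_graph(1)[OF assms(1)] matching_graph(1)[OF assms(2)] by simp
  moreover have "S = S'"
  proof (rule extensionalityI)
    show "S \<in> extensional M" "S' \<in> extensional M"
      using assms(1,2) \<open>M = M'\<close> by (auto simp: marked_matchings_def PiE_def)
    fix x assume "x \<in> M"
    then obtain F where F: "F \<in> \<Phi> - {F0}" "x = (F, face_segment M F)"
      using matching_graph(1)[OF assms(1)] by blast
    then show "S x = S' x" using eq[OF F(1)] seg_eq[OF F(1)] by (simp add: face_edge_def)
  qed
  ultimately show ?thesis by simp
qed

lemma forest_of_matching:
  assumes "m \<in> marked_matchings L c F0"
  obtains p where "orientation p" "acyclic (arrows p)" "unmarked_edges L m = used_edges p"
    "forest_of L R m = arrows p" "E - used_edges p = snd m ` fst m"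
proof -
  obtain M S where m: "m = (M, S)" by (cases m)
  obtain p where p: "orientation p" "acyclic (arrows p)" "E - used_edges p = S ` M"
    "unmarked_edges L (M, S) = used_edges p"
    using orientation_of_matching assms unfolding m by blast
  then have "forest_of L R m = arrows p" using orient_used_edges[OF p(1,2)] by (simp add: forest_of_def m)
  then show ?thesis using that p m by simp
qed

lemma inj_forest_of: "inj_on (forest_of L R) (marked_matchings L c F0)"
proof (rule inj_onI)
  fix m m' assume mm: "m \<in> marked_matchings L c F0" "m' \<in> marked_matchings L c F0" "forest_of L R m = forest_of L R m'"
  obtain M S M' S' where m: "m = (M, S)" "m' = (M', S')" by (cases m, cases m')
  obtain p where p: "orientation p" "acyclic (arrows p)" "forest_of L R m = arrows p" "E - used_edges p = S ` M"
    using forest_of_matching[OF mm(1)] m by (metis fst_conv snd_conv)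
  obtain p' where p': "orientation p'" "forest_of L R m' = arrows p'" "E - used_edges p' = S' ` M'"
    using forest_of_matching[OF mm(2)] m by (metis fst_conv snd_conv)
  have "arrows p = arrows p'" using mm(3) p(3) p'(2) by simp
  then have "used_edges p = used_edges p'"
    using bij_arrows_used_edges[OF p(1)] bij_arrows_used_edges[OF p'(1)] by (simp add: bij_betw_def)
  then have X: "S ` M = E - used_edges p" "S' ` M' = E - used_edges p" using p(4) p'(3) by simp_all
  interpret linked_incidence \<Phi> "E - used_edges p" "\<lambda>F e. e \<subseteq> frontier F" F0
    by (rule dual_tree(1)[OF p(1,2)])
  have MS: "(M, S) \<in> marked_matchings L c F0" "(M', S') \<in> marked_matchings L c F0" using mm m by auto
  have "face_edge (M, S) F = face_edge (M', S') F" if F: "F \<in> \<Phi> - {F0}" for F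
    using bij_face_edge[OF MS(1)] face_edge(2)[OF MS(1)] bij_face_edge[OF MS(2)] face_edge(2)[OF MS(2)] F
    unfolding X by (rule matching_unique)
  then show "m = m'" unfolding m by (rule matching_of_face_edge[OF MS])
qed

lemma surj_forest_of:
  assumes "F \<in> spanning_forests L R"
  shows "F \<in> forest_of L R ` marked_matchings L c F0"
proof -
  obtain p where p: "orientation p" "acyclic (arrows p)" "F = arrows p" using spanning_forestE[OF assms] .
  let ?X = "E - used_edges p"
  interpret linked_incidence \<Phi> ?X "\<lambda>F e. e \<subseteq> frontier F" F0 by (rule dual_tree(1)[OF p(1,2)])
  obtain \<mu> where \<mu>: "bij_betw \<mu> (\<Phi> - {F0}) ?X" "\<And>G. G \<in> \<Phi> - {F0} \<Longrightarrow> \<mu> G \<subseteq> frontier G"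
    using matching_exists(3) dual_tree(2)[OF p(1,2) finite_faces] by blast
  have \<mu>X: "\<mu> G \<in> ?X" if "G \<in> \<Phi> - {F0}" for G using \<mu>(1) that by (auto simp: bij_betw_def)
  define \<sigma> where "\<sigma> G = (SOME s. s \<in> L \<and> \<mu> G \<subseteq> s)" for G
  have \<sigma>: "\<sigma> G \<in> L \<and> \<mu> G \<subseteq> \<sigma> G" if "G \<in> \<Phi> - {F0}" for G
    unfolding \<sigma>_def by (rule someI_ex) (use edge_L[of "\<mu> G"] \<mu>X[OF that] in blast)
  define M where "M = (\<lambda>G. (G, \<sigma> G)) ` (\<Phi> - {F0})"
  define S where "S = restrict (\<lambda>(G, s). \<mu> G) M"
  have M_iff: "(G, s) \<in> M \<longleftrightarrow> G \<in> \<Phi> - {F0} \<and> s = \<sigma> G" for G s by (auto simp: M_def)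
  have S_eq: "S (G, \<sigma> G) = \<mu> G" if "G \<in> \<Phi> - {F0}" for G using that by (simp add: S_def M_iff)
  have "M \<in> perfect_matchings L c F0"
    unfolding perfect_matchings_def
  proof (intro CollectI conjI ballI subsetI)
    fix e assume "e \<in> M"
    then obtain G where G: "G \<in> \<Phi> - {F0}" "e = (G, \<sigma> G)" by (auto simp: M_def)
    obtain a b where "\<mu> G = open_segment a b" using edgeE[of "\<mu> G"] \<mu>X[OF G(1)] by (metis DiffD1)
    moreover have "a \<noteq> b" using edge_nonempty[of "\<mu> G"] \<mu>X[OF G(1)] calculation by auto
    moreover have "\<mu> G \<subseteq> portion (G, \<sigma> G)" using \<mu>(2)[OF G(1)] \<sigma>[OF G(1)] by (simp add: portion_def)
    ultimately show "e \<in> dual_edges L c F0"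
      using G \<sigma>[OF G(1)] unfolding dual_edges_def by auto
  next
    show "\<exists>!s. (G, s) \<in> M" if "G \<in> \<Phi> - {F0}" for G using that by (auto simp: M_iff)
    fix s assume s: "s \<in> L"
    obtain e where e: "edges_on s - used_edges p = {e}" using unused_edge[OF p(1) s] by blast
    then have eX: "e \<in> ?X" "e \<subseteq> s" by (auto simp: edges_on_def)
    have "e \<in> \<mu> ` (\<Phi> - {F0})" using \<mu>(1) eX(1) by (simp add: bij_betw_def)
    then obtain G where G: "G \<in> \<Phi> - {F0}" "\<mu> G = e" by (elim imageE) simp
    have \<sigma>G: "\<sigma> G = s" using edge_L_unique[of e "\<sigma> G" s] \<sigma>[OF G(1)] eX s G(2) by simp
    have uniq: "G' = G" if "G' \<in> \<Phi> - {F0}" "s = \<sigma> G'" for G'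
    proof -
      have "\<mu> G' \<in> edges_on s - used_edges p"
        using \<mu>X[OF that(1)] \<sigma>[OF that(1)] that(2) by (simp add: edges_on_def)
      then have "\<mu> G' = \<mu> G" unfolding e G(2) by simp
      then show ?thesis using \<mu>(1) that(1) G(1) by (simp add: bij_betw_def inj_on_def)
    qed
    show "\<exists>!G. (G, s) \<in> M"
    proof (rule ex1I)
      show "(G, s) \<in> M" using G(1) \<sigma>G by (simp add: M_iff)
      show "G' = G" if "(G', s) \<in> M" for G' using that uniq unfolding M_iff by blast
    qed
  qed
  moreover have "S \<in> PiE M (subsegments L)"
  proof (rule PiE_I)
    fix e assume "e \<in> M"
    then obtain G where G: "G \<in> \<Phi> - {F0}" "e = (G, \<sigma> G)" by (auto simp: M_def)
    then show "S e \<in> subsegments L e"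
      using S_eq[OF G(1)] \<mu>X[OF G(1)] \<mu>(2)[OF G(1)] \<sigma>[OF G(1)] by (simp add: subsegments_def portion_def)
  qed (simp add: S_def)
  ultimately have m: "(M, S) \<in> marked_matchings L c F0" by (simp add: marked_matchings_def)
  have "S ` M = \<mu> ` (\<Phi> - {F0})" unfolding M_def image_image by (rule image_cong) (use S_eq in simp_all)
  also have "\<dots> = ?X" using \<mu>(1) by (simp add: bij_betw_def)
  finally have "unmarked_edges L (M, S) = used_edges p"
    using used_edges_subset[OF p(1)] by (auto simp: unmarked_edges_def)
  then have "forest_of L R (M, S) = F" using orient_used_edges[OF p(1,2)] p(3) by (simp add: forest_of_def)
  then show ?thesis using m by blast
qed

lemma bij_forest_of: "bij_betw (forest_of L R) (marked_matchings L c F0) (spanning_forests L R)"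
  unfolding bij_betw_def
proof (intro conjI subset_antisym subsetI)
  show "inj_on (forest_of L R) (marked_matchings L c F0)" by (rule inj_forest_of)
next
  fix F assume "F \<in> forest_of L R ` marked_matchings L c F0"
  then obtain m where m: "m \<in> marked_matchings L c F0" "F = forest_of L R m" by blast
  show "F \<in> spanning_forests L R"
    using forest_of_matching[OF m(1)] arrows_spanning_forest m(2) by metis
qed (rule surj_forest_of)

lemma matching_weight:
  assumes m: "m \<in> marked_matchings L c F0"
  shows "(\<lambda>(M, S). \<Prod>e\<in>M. diameter (S e)) m = (\<Prod>e\<in>forest_of L R m. arc_weight L e) * weight_ratio"
    and "(\<Prod>e\<in>forest_of L R m. arc_weight L e) > 0"
proof -
  obtain M S where MS: "m = (M, S)" by (cases m)
  obtain p where p: "orientation p" "forest_of L R m = arrows p" "E - used_edges p = S ` M"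
    using forest_of_matching[OF m] MS by (metis fst_conv snd_conv)
  have "(\<Prod>e\<in>M. diameter (S e)) = (\<Prod>e\<in>E - used_edges p. diameter e)"
    unfolding p(3) using inj_marking[of M S] m MS by (simp add: prod.reindex)
  also have "\<dots> = (\<Prod>e\<in>forest_of L R m. arc_weight L e) * weight_ratio"
    using forest_weight[OF p(1)] p(2) by simp
  finally show "(\<lambda>(M, S). \<Prod>e\<in>M. diameter (S e)) m = (\<Prod>e\<in>forest_of L R m. arc_weight L e) * weight_ratio"
    by (simp add: MS)
  have "(\<Prod>e\<in>E - used_edges p. diameter e) > 0"
    by (rule prod_pos) (simp add: diameter_edge_pos)
  then show "(\<Prod>e\<in>forest_of L R m. arc_weight L e) > 0"
    using forest_weight[OF p(1)] p(2) weight_ratio_pos by (metis zero_less_mult_pos2)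
qed

lemma finite_spanning_forests: "finite (spanning_forests L R)"
proof (rule finite_subset)
  show "spanning_forests L R \<subseteq> Pow (V \<times> V)"
    unfolding spanning_forests_def arcs_def consecutive_def by auto
qed (use finite_V in simp)

text \<open>Finiteness is transported from the forests by the bijection. The upward forest shows
  that neither set is empty, so the normalisation does not divide by zero.\<close>

lemma marked_matchings_finite: "finite (marked_matchings L c F0)"
  and marked_matchings_nonempty: "marked_matchings L c F0 \<noteq> {}"
proof -
  show "finite (marked_matchings L c F0)"
    using bij_betw_finite[OF bij_forest_of] finite_spanning_forests by simp
  have "arrows up \<in> spanning_forests L R" by (rule arrows_spanning_forest[OF orientation_up acyclic_up])
  then show "marked_matchings L c F0 \<noteq> {}" using surj_forest_of by blast
qed

text \<open>Weights that correspond under the bijection differ by the common factor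
  \<open>weight_ratio\<close>, which also multiplies the total and so cancels.\<close>

lemma measure_preserving:
  shows "prob_space (matching_measure L c F0)" "prob_space (forest_measure L R)"
    and "m \<in> marked_matchings L c F0 \<Longrightarrow>
      emeasure (matching_measure L c F0) {m} = emeasure (forest_measure L R) {forest_of L R m}"
proof -
  let ?A = "marked_matchings L c F0" and ?B = "spanning_forests L R"
  define u where "u = (\<lambda>(M, S). \<Prod>e\<in>M. diameter ((S :: complex set \<times> complex set \<Rightarrow> complex set) e))"
  define w where "w = (\<lambda>F. \<Prod>e\<in>F. arc_weight L e)"
  have uw: "u m = w (forest_of L R m) * weight_ratio" "w (forest_of L R m) > 0" if "m \<in> ?A" for m
    using matching_weight[OF that] by (simp_all add: u_def w_def)
  have B: "?B = forest_of L R ` ?A" using bij_forest_of by (simp add: bij_betw_def)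
  have wB: "w F > 0" if "F \<in> ?B" for F using that uw(2) unfolding B by auto
  have "?B \<noteq> {}" using marked_matchings_nonempty unfolding B by simp
  have uA: "u m > 0" if "m \<in> ?A" for m using uw[OF that] weight_ratio_pos by simp
  have mm: "matching_measure L c F0 = normalized_measure ?A u" "forest_measure L R = normalized_measure ?B w"
    by (simp_all add: matching_measure_def forest_measure_def u_def w_def)
  show "prob_space (matching_measure L c F0)" "prob_space (forest_measure L R)"
    unfolding mm using marked_matchings_finite marked_matchings_nonempty finite_spanning_forests \<open>?B \<noteq> {}\<close>
    by (auto intro!: normalized_measure(1) uA wB)
  assume m: "m \<in> ?A"
  have "(\<Sum>m\<in>?A. u m) = (\<Sum>m\<in>?A. w (forest_of L R m) * weight_ratio)"
    by (rule sum.cong) (use uw in simp_all)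
  also have "\<dots> = (\<Sum>F\<in>?B. w F) * weight_ratio"
    by (simp add: sum.reindex_bij_betw[OF bij_forest_of] flip: sum_distrib_right)
  finally have "u m / (\<Sum>m\<in>?A. u m) = w (forest_of L R m) / (\<Sum>F\<in>?B. w F)"
    using uw(1)[OF m] weight_ratio_pos by simp
  moreover have "emeasure (normalized_measure ?A u) {m} = ennreal (u m / (\<Sum>m\<in>?A. u m))"
    by (rule normalized_measure(2)[OF marked_matchings_finite marked_matchings_nonempty _ m]) (rule uA)
  moreover have "forest_of L R m \<in> ?B" using m B by blast
  then have "emeasure (normalized_measure ?B w) {forest_of L R m} = ennreal (w (forest_of L R m) / (\<Sum>F\<in>?B. w F))"
    by (rule normalized_measure(2)[OF finite_spanning_forests \<open>?B \<noteq> {}\<close>, rotated]) (rule wB)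
  ultimately show "emeasure (matching_measure L c F0) {m} = emeasure (forest_measure L R) {forest_of L R m}"
    unfolding mm by simp
qed

end

theorem theorem1:
  fixes L :: "complex set set" and R :: "complex set"
    and c :: "real \<Rightarrow> complex" and F0 :: "complex set"
  assumes "t_graph L R"
    and "encircling_curve L R c"
    and "F0 \<in> outer_faces L c"
  shows "(\<forall>m \<in> marked_matchings L c F0.
            forest_of L R m \<in> spanning_forests L R \<and>
            bij_betw (\<lambda>(u, v). open_segment u v) (forest_of L R m) (unmarked_edges L m))
       \<and> bij_betw (forest_of L R) (marked_matchings L c F0) (spanning_forests L R)
       \<and> prob_space (matching_measure L c F0) \<and> prob_space (forest_measure L R)
       \<and> (\<forall>m \<in> marked_matchings L c F0.
            emeasure (matching_measure L c F0) {m} = emeasure (forest_measure L R) {forest_of L R m})"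
proof -
  have "finite (vertices L)" using assms(1) by (rule finite_vertices)
  then obtain t where t: "inj_on (\<lambda>z. Re z + t * Im z) (vertices L)" using exists_injective_height by blast
  interpret encircled_tgraph L R t c F0
    using assms t by unfold_locales auto
  have "forest_of L R m \<in> spanning_forests L R \<and>
      bij_betw (\<lambda>(u, v). open_segment u v) (forest_of L R m) (unmarked_edges L m)"
    if "m \<in> marked_matchings L c F0" for m
    using forest_of_matching[OF that] arrows_spanning_forest bij_arrows_used_edges by metis
  then show ?thesis using bij_forest_of measure_preserving by blast
qed

end
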